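(* Let $(\Omega,\mathcal F,m)$ be a $\sigma$-finite measure space and $1\le p,q<\infty$. Let $S,T$ be positive $C_0$-semigroups on $L_2(m)$ with generators $A_S,A_T$, respectively. Let $S$ also act on $L_p(m)$ and have a kernel $k^S$ on $L_2(m)\cap L_p(m)$, and let $T$ also act on $L_q(m)$ and have a kernel $k^T$ on $L_2(m)\cap L_q(m)$. Assume there exist $0\le f\in L_p(m)$, $0\le g'\in L_{q'}(m)$, $C\ge0$ such that $$\langle A_Tu,v'\rangle_{2,2}\le\langle u,A_S^\sigma v'\rangle_{2,2}+C\,\langle u,g'\rangle_{q,q'}\,\langle f,v'\rangle_{p,p'}$$ for all $0\le u\in D(A_T)\cap L_q(m)$ and $0\le v'\in D(A_S^\sigma)\cap L_{p'}(m)$. Then $$k^T(t,x,y)\le k^S(t,x,y)+C\int_0^t\int_\Omega k^T(t-s,w,y)\,g'(w)\,dm(w)\int_\Omega k^S(s,x,z)\,f(z)\,dm(z)\,ds$$ for all $t>0$ and $m^2$-a.a. $(x,y)\in\Omega^2$.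
   Context: All vector spaces are over $\mathbb R$; $m^2$ is the product measure on $\Omega^2$. For $1\le p<\infty$, $p'$ is the dual exponent, $\frac1p+\frac1{p'}=1$ (with $\frac1\infty=0$), and likewise for $q$. For $\varphi\in L_p(m)$, $\psi\in L_{p'}(m)=L_p(m)'$, $\langle\varphi,\psi\rangle_{p,p'}:=\int_\Omega\varphi\psi\,dm$. A semigroup is positive if it maps nonnegative functions to nonnegative functions. A $C_0$-semigroup $T$ on $L_2(m)$ also acts on $L_q(m)$ if there are $M\ge1$, $\omega\in\mathbb R$ with $\|T(t)u\|_q\le Me^{\omega t}\|u\|_q$ for all $u\in L_2(m)\cap L_q(m)$, $t\ge0$; then $T$ extends to a $C_0$-semigroup on $L_q(m)$. $S$ has a kernel $k^S\colon(0,\infty)\times\Omega^2\to\mathbb R$ on $L_2(m)\cap L_p(m)$ if $k^S$ is an integral kernel for $S$ there, i.e. $S(t)u=\int_\Omega k^S(t,\cdot,y)u(y)\,dm(y)$ for all $u\in L_2(m)\cap L_p(m)$, $t>0$; similarly for $T$ and $k^T$ on $L_2(m)\cap L_q(m)$. For a $C_0$-semigroup $S$ with generator $A$ on a Banach space $X$, the weak$^*$-generator of $S(\cdot)'$ is $A^\sigma:=\{(x',y')\in X'\times X':\ \text{w}^*\text{-}\lim_{t\downarrow0}\frac1t(S(t)'x'-x')=y'\}$ (which equals the dual operator $A'$). Here $A_S^\sigma$ is formed for $S$ on $X=L_2(m)$, with $L_2(m)'=L_2(m)$. *)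

theory Defs
  imports "HOL-Analysis.Analysis"
begin

text \<open>
  Elements of \<open>L\<^sub>p(M)\<close> are represented by measurable functions, with almost everywhere
  equality in place of equality. Operators on \<open>L\<^sub>p(M)\<close> are maps on such representatives.
  Exponents are of type \<^typ>\<open>ennreal\<close>, where \<open>1 / \<infinity> = 0\<close>, so that the dual exponent
  \<open>p'\<close> of \<open>p\<close> is determined by \<open>1 / p + 1 / p' = 1\<close>.
\<close>

definition Lp :: "'a measure \<Rightarrow> ennreal \<Rightarrow> ('a \<Rightarrow> real) set" where
  "Lp M p = {u \<in> borel_measurable M.
     if p = \<infinity> then \<exists>c. AE x in M. \<bar>u x\<bar> \<le> c
     else integrable M (\<lambda>x. \<bar>u x\<bar> powr enn2real p)}"

definition Lp_norm :: "'a measure \<Rightarrow> ennreal \<Rightarrow> ('a \<Rightarrow> real) \<Rightarrow> real" where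
  "Lp_norm M p u =
     (if p = \<infinity> then Inf {c. 0 \<le> c \<and> (AE x in M. \<bar>u x\<bar> \<le> c)}
      else (LINT x|M. \<bar>u x\<bar> powr enn2real p) powr (1 / enn2real p))"

definition pairing :: "'a measure \<Rightarrow> ('a \<Rightarrow> real) \<Rightarrow> ('a \<Rightarrow> real) \<Rightarrow> real" where
  "pairing M u v = (LINT x|M. u x * v x)"

text \<open>
  Invariance under almost everywhere equality is not listed: it follows from linearity
  together with the norm bound.
\<close>

definition bounded_operator_on_Lp ::
    "'a measure \<Rightarrow> ennreal \<Rightarrow> (('a \<Rightarrow> real) \<Rightarrow> 'a \<Rightarrow> real) \<Rightarrow> bool" where
  "bounded_operator_on_Lp M p B \<longleftrightarrow>
     (\<forall>u\<in>Lp M p. B u \<in> Lp M p) \<and>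
     (\<forall>u\<in>Lp M p. \<forall>v\<in>Lp M p. AE x in M. B (\<lambda>y. u y + v y) x = B u x + B v x) \<and>
     (\<forall>c. \<forall>u\<in>Lp M p. AE x in M. B (\<lambda>y. c * u y) x = c * B u x) \<and>
     (\<exists>K. \<forall>u\<in>Lp M p. Lp_norm M p (B u) \<le> K * Lp_norm M p u)"

definition C0_semigroup_on_Lp ::
    "'a measure \<Rightarrow> ennreal \<Rightarrow> (real \<Rightarrow> ('a \<Rightarrow> real) \<Rightarrow> 'a \<Rightarrow> real) \<Rightarrow> bool" where
  "C0_semigroup_on_Lp M p T \<longleftrightarrow>
     (\<forall>t\<ge>0. bounded_operator_on_Lp M p (T t)) \<and>
     (\<forall>u\<in>Lp M p. AE x in M. T 0 u x = u x) \<and>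
     (\<forall>s\<ge>0. \<forall>t\<ge>0. \<forall>u\<in>Lp M p. AE x in M. T (s + t) u x = T s (T t u) x) \<and>
     (\<forall>u\<in>Lp M p. ((\<lambda>t. Lp_norm M p (\<lambda>x. T t u x - u x)) \<longlongrightarrow> 0) (at_right 0))"

definition positive_semigroup_on_Lp ::
    "'a measure \<Rightarrow> ennreal \<Rightarrow> (real \<Rightarrow> ('a \<Rightarrow> real) \<Rightarrow> 'a \<Rightarrow> real) \<Rightarrow> bool" where
  "positive_semigroup_on_Lp M p T \<longleftrightarrow>
     (\<forall>t\<ge>0. \<forall>u\<in>Lp M p. (AE x in M. 0 \<le> u x) \<longrightarrow> (AE x in M. 0 \<le> T t u x))"

text \<open>The generator, as a graph.\<close>

definition generator ::
    "'a measure \<Rightarrow> ennreal \<Rightarrow> (real \<Rightarrow> ('a \<Rightarrow> real) \<Rightarrow> 'a \<Rightarrow> real) \<Rightarrow>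
     (('a \<Rightarrow> real) \<times> ('a \<Rightarrow> real)) set" where
  "generator M p T =
     {(u, v). u \<in> Lp M p \<and> v \<in> Lp M p \<and>
       ((\<lambda>t. Lp_norm M p (\<lambda>x. (T t u x - u x) / t - v x)) \<longlongrightarrow> 0) (at_right 0)}"

text \<open>
  The dual operator acts on functionals by composition. Here \<open>p'\<close> is the dual exponent of
  \<open>p < \<infinity>\<close>, and \<open>v' \<in> L\<^sub>p\<^sub>'(M)\<close> is identified with the functional
  \<open>u \<mapsto> \<langle>u, v'\<rangle>\<close> on \<open>L\<^sub>p(M)\<close>.
\<close>

definition dual_operator :: "('x \<Rightarrow> 'x) \<Rightarrow> ('x \<Rightarrow> real) \<Rightarrow> 'x \<Rightarrow> real" where
  "dual_operator B \<phi> = (\<lambda>u. \<phi> (B u))"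

definition weak_star_generator ::
    "'a measure \<Rightarrow> ennreal \<Rightarrow> ennreal \<Rightarrow> (real \<Rightarrow> ('a \<Rightarrow> real) \<Rightarrow> 'a \<Rightarrow> real) \<Rightarrow>
     (('a \<Rightarrow> real) \<times> ('a \<Rightarrow> real)) set" where
  "weak_star_generator M p p' T =
     {(v', w'). v' \<in> Lp M p' \<and> w' \<in> Lp M p' \<and>
       (\<forall>u\<in>Lp M p.
         ((\<lambda>t. 1 / t * (dual_operator (T t) (\<lambda>h. pairing M h v') u - pairing M u v'))
           \<longlongrightarrow> pairing M u w') (at_right 0))}"

text \<open>For a semigroup on \<open>L\<^sub>2(M)\<close> and \<open>q < \<infinity>\<close>.\<close>

definition acts_on_Lp ::
    "'a measure \<Rightarrow> ennreal \<Rightarrow> (real \<Rightarrow> ('a \<Rightarrow> real) \<Rightarrow> 'a \<Rightarrow> real) \<Rightarrow> bool" where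
  "acts_on_Lp M q T \<longleftrightarrow>
     (\<exists>K\<ge>1. \<exists>\<omega>. \<forall>u\<in>Lp M 2 \<inter> Lp M q. \<forall>t\<ge>0.
       T t u \<in> Lp M q \<and> Lp_norm M q (T t u) \<le> K * exp (\<omega> * t) * Lp_norm M q u)"

text \<open>
  Joint measurability in \<open>(t, x, y)\<close> is part of the notion of a kernel
  \<open>(0, \<infinity>) \<times> \<Omega>\<^sup>2 \<rightarrow> \<real>\<close>. Values at \<open>t \<le> 0\<close> are irrelevant. Integrability is
  required explicitly because the Bochner integral of a non-integrable function is 0.
\<close>

definition has_kernel_on_Lp ::
    "'a measure \<Rightarrow> ennreal \<Rightarrow> (real \<Rightarrow> ('a \<Rightarrow> real) \<Rightarrow> 'a \<Rightarrow> real) \<Rightarrow>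
     (real \<Rightarrow> 'a \<Rightarrow> 'a \<Rightarrow> real) \<Rightarrow> bool" where
  "has_kernel_on_Lp M p S k \<longleftrightarrow>
     (\<lambda>(t, x, y). k t x y) \<in> borel_measurable (restrict_space borel {0<..} \<Otimes>\<^sub>M (M \<Otimes>\<^sub>M M)) \<and>
     (\<forall>t>0. \<forall>u\<in>Lp M 2 \<inter> Lp M p. AE x in M.
       integrable M (\<lambda>y. k t x y * u y) \<and> S t u x = (LINT y|M. k t x y * u y))"

end

theory Submission
  imports Defs
begin

text \<open>
  Fix nonnegative \<open>u\<close>, \<open>v\<close> and put \<open>F a b = \<langle>T(a) u, S(b)' v\<rangle>\<close>. Formally
  \<open>(\<partial>\<^sub>a - \<partial>\<^sub>b) F \<le> C \<langle>T(a) u, g'\<rangle> \<langle>S(b) f, v\<rangle>\<close>, and integrating along the line \<open>a + b = t\<close> gives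
  \<open>\<langle>T(t) u, v\<rangle> \<le> \<langle>S(t) u, v\<rangle> + C \<integral> \<langle>T(t - s) u, g'\<rangle> \<langle>S(s) f, v\<rangle> ds\<close>. Taking \<open>u\<close> and \<open>v\<close> to be
  indicator functions, this is the claimed kernel inequality integrated over rectangles, and
  rectangles suffice.

  The hypothesis only speaks about elements of the domains. It is applied to the time averages
  \<open>\<integral>\<^bsub>a\<^esub>\<^bsup>a+h\<^esup> T(r) u dr\<close> and \<open>\<integral>\<^bsub>b\<^esub>\<^bsup>b+h\<^esup> S(r)' v dr\<close>, which yields a difference inequality for \<open>F\<close>
  at scale \<open>h\<close>. Its limit \<open>h \<rightarrow> 0\<close> needs only right continuity of \<open>F\<close> at the two end points of
  the line and the Lebesgue differentiation theorem for \<open>s \<mapsto> \<langle>T(s) u, g'\<rangle>\<close> and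
  \<open>s \<mapsto> \<langle>S(s) f, v\<rangle>\<close>.
  All integrands being nonnegative, the averages are built pointwise from the kernels with
  extended nonnegative integrals.
\<close>

section \<open>Lebesgue spaces and Hoelder duality\<close>

text \<open>Differentiating \<open>F\<close> directly would require \<open>u\<close> and
  \<open>v\<close> in the domains, and the hypothesis moreover wants its arguments in
  \<open>L\<^sub>q\<close> and \<open>L\<^sub>p\<^sub>'\<close>. Averages of orbits over an interval
  of length \<open>h\<close> meet both demands, and the generators turn them into increments of the
  orbits. With averages in both variables the terms of the hypothesis become integrals of
  \<open>F\<close> over the four edges of a square of side \<open>h\<close>, and a factor
  \<open>h\<^sup>2\<close> has to be divided out in the end. The averages are not formed as
  vector-valued integrals: for \<open>p = 1\<close> the dual orbits live in
  \<open>L\<^sub>\<infinity>\<close>, where they need not be norm continuous. Membership in the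
  spaces is read off from bounded pairings by the converse of Hoelder's inequality. Also
  \<open>f\<close> and \<open>g'\<close> need not be in \<open>L\<^sub>2\<close>, so
  \<open>S(s) f\<close> gets its meaning from the kernel. This calls for nonnegative kernels, which
  positivity of the operators has to provide first. Bounds in \<open>L\<^sub>2\<close> that are
  uniform on bounded time intervals are likewise drawn from positivity.\<close>

lemma Lp_measurable [measurable_dest]: "u \<in> Lp M p \<Longrightarrow> u \<in> borel_measurable M"
  by (auto simp: Lp_def)

lemma Lp_finite_iff:
  assumes "p < \<infinity>"
  shows "u \<in> Lp M p \<longleftrightarrow> u \<in> borel_measurable M \<and>
    (\<integral>\<^sup>+x. ennreal (\<bar>u x\<bar> powr enn2real p) \<partial>M) < \<infinity>"
proof -
  have "p \<noteq> \<infinity>" using assms by auto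
  then show ?thesis
    by (auto simp: Lp_def integrable_iff_bounded)
qed

lemma nn_integral_powr_Lp:
  assumes "1 \<le> p" "p < \<infinity>" "u \<in> Lp M p"
  shows "(\<integral>\<^sup>+x. ennreal (\<bar>u x\<bar> powr enn2real p) \<partial>M) = ennreal (Lp_norm M p u powr enn2real p)"
proof -
  have p: "p \<noteq> \<infinity>" using assms by auto
  have P: "1 \<le> enn2real p"
    using assms by (cases p) (auto simp: ennreal_ge_1)
  have "integrable M (\<lambda>x. \<bar>u x\<bar> powr enn2real p)"
    using assms p by (auto simp: Lp_def)
  then have "(\<integral>\<^sup>+x. ennreal (\<bar>u x\<bar> powr enn2real p) \<partial>M) = ennreal (LINT x|M. \<bar>u x\<bar> powr enn2real p)"
    by (intro nn_integral_eq_integral) auto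
  also have "(LINT x|M. \<bar>u x\<bar> powr enn2real p) = Lp_norm M p u powr enn2real p"
    using P p by (simp add: Lp_norm_def powr_powr integral_nonneg_AE)
  finally show ?thesis .
qed

text \<open>The infimum is attained: each bound \<open>Lp_norm M \<infinity> u + 1 / (n + 1)\<close>
  fails only on a null set, and countably many null sets can be discarded together.\<close>

lemma Lp_infinity_bounds:
  assumes "u \<in> Lp M \<infinity>"
  shows "0 \<le> Lp_norm M \<infinity> u" "AE x in M. \<bar>u x\<bar> \<le> Lp_norm M \<infinity> u"
proof -
  let ?S = "{c. 0 \<le> c \<and> (AE x in M. \<bar>u x\<bar> \<le> c)}"
  obtain c where c: "AE x in M. \<bar>u x\<bar> \<le> c" using assms by (auto simp: Lp_def)
  \<comment> \<open>On a null measure \<open>c\<close> may be negative, whereas \<open>?S\<close>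
    admits only nonnegative bounds.\<close>
  have "AE x in M. \<bar>u x\<bar> \<le> max 0 c" using c by eventually_elim auto
  then have ne: "?S \<noteq> {}" by (auto intro!: exI[of _ "max 0 c"])
  have eq: "Lp_norm M \<infinity> u = Inf ?S" by (simp add: Lp_norm_def)
  show "0 \<le> Lp_norm M \<infinity> u" unfolding eq by (rule cInf_greatest[OF ne]) auto
  have "AE x in M. \<forall>n. \<bar>u x\<bar> \<le> Lp_norm M \<infinity> u + 1 / real (Suc n)"
  proof (subst AE_all_countable, intro allI)
    fix n
    have "Inf ?S < Lp_norm M \<infinity> u + 1 / real (Suc n)" unfolding eq by simp
    from cInf_lessD[OF ne this]
    obtain d where "d < Lp_norm M \<infinity> u + 1 / real (Suc n)" "AE x in M. \<bar>u x\<bar> \<le> d" by auto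
    then show "AE x in M. \<bar>u x\<bar> \<le> Lp_norm M \<infinity> u + 1 / real (Suc n)" by auto
  qed
  then show "AE x in M. \<bar>u x\<bar> \<le> Lp_norm M \<infinity> u"
  proof eventually_elim
    case (elim x)
    show ?case
    proof (rule field_le_epsilon)
      fix e :: real assume "0 < e"
      then obtain n where "1 / real (Suc n) < e"
        using nat_approx_posE by blast
      with elim[rule_format, of n] show "\<bar>u x\<bar> \<le> Lp_norm M \<infinity> u + e" by linarith
    qed
  qed
qed

lemma Lp_norm_nonneg:
  assumes "u \<in> Lp M p"
  shows "0 \<le> Lp_norm M p u"
proof (cases "p = \<infinity>")
  case True
  then show ?thesis using Lp_infinity_bounds(1) assms by blast
qed (simp add: Lp_norm_def)

lemma one_divide_ennreal_eq_1:
  fixes x :: ennreal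
  assumes "1 / x = 1"
  shows "x = 1"
proof (cases x rule: ennreal_cases)
  case (real r)
  with assms have "r \<noteq> 0" by auto
  with real assms have "ennreal (1 / r) = ennreal 1"
    by (simp add: divide_ennreal flip: ennreal_1)
  then show ?thesis using real \<open>r \<noteq> 0\<close> by (simp add: ennreal_inj)
qed (use assms in auto)

text \<open>The endpoint pairs are kept apart because \<open>Lp\<close> and \<open>Lp_norm\<close>
  are defined differently at \<open>\<infinity>\<close>; in the remaining case both exponents are
  real numbers above 1 and power arithmetic applies.\<close>

lemma dual_exponents_cases:
  fixes p p' :: ennreal
  assumes "1 \<le> p" "1 / p + 1 / p' = 1"
  obtains "p = 1" "p' = \<infinity>" | "p = \<infinity>" "p' = 1"
  | P Q where "1 < P" "1 < Q" "1 / P + 1 / Q = 1" "p = ennreal P" "p' = ennreal Q"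
proof (cases p rule: ennreal_cases)
  case top
  then have "1 / p' = 1" using assms by simp
  then have "p' = 1"
    by (rule one_divide_ennreal_eq_1)
  then show thesis using top that by auto
next
  case (real P)
  then have P: "1 \<le> P" using assms by (auto simp: ennreal_ge_1)
  show thesis
  proof (cases p' rule: ennreal_cases)
    case top
    then have "1 / p = 1" using assms by simp
    then have "p = 1"
      by (rule one_divide_ennreal_eq_1)
    then show thesis using top that by auto
  next
    case (real Q)
    \<comment> \<open>In \<open>ennreal\<close> the quotient \<open>1 / 0\<close> is infinite, so
      \<open>Q = 0\<close> would make the sum of the reciprocals infinite.\<close>
    have Q: "Q \<noteq> 0" using assms real by (auto simp: divide_ennreal_def)
    have "ennreal (1 / P + 1 / Q) = 1"
      using assms P Q real \<open>p = ennreal P\<close>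
      by (simp add: divide_ennreal flip: ennreal_1 ennreal_plus)
    then have eq: "1 / P + 1 / Q = 1" by (rule ennreal_eq_1[THEN iffD1])
    have "1 / Q > 0" using Q real by auto
    then have "1 / P < 1" using eq by linarith
    then have "P > 1" using P by (cases "P = 1") auto
    then have "1 / P > 0" by simp
    then have "1 / Q < 1" using eq by linarith
    then have "Q > 1" using Q real less_divide_eq_1_pos[of 1 Q] by (simp add: divide_less_eq_1)
    show thesis by (rule that(3)[OF \<open>P > 1\<close> \<open>Q > 1\<close> eq]) fact+
  qed
qed

lemma one_le_dual_exponent:
  fixes p p' :: ennreal
  assumes "1 \<le> p" "1 / p + 1 / p' = 1"
  shows "1 \<le> p'"
  using assms
proof (cases rule: dual_exponents_cases)
  case (3 P Q)
  then show ?thesis by simp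
qed simp_all

lemma Hoelder_one_infinity:
  assumes "u \<in> Lp M 1" "v \<in> Lp M \<infinity>"
  shows "(\<integral>\<^sup>+x. ennreal \<bar>u x * v x\<bar> \<partial>M) \<le> ennreal (Lp_norm M 1 u * Lp_norm M \<infinity> v)"
proof -
  have [measurable]: "u \<in> borel_measurable M" using assms by (auto simp: Lp_def)
  have "(\<integral>\<^sup>+x. ennreal \<bar>u x * v x\<bar> \<partial>M) \<le> (\<integral>\<^sup>+x. ennreal (\<bar>u x\<bar> powr enn2real 1) * ennreal (Lp_norm M \<infinity> v) \<partial>M)"
    by (rule nn_integral_mono_AE, use Lp_infinity_bounds(2)[OF assms(2)] in eventually_elim)
      (auto simp: abs_mult mult_left_mono simp flip: ennreal_mult' intro!: ennreal_leI)
  also have "\<dots> = ennreal (Lp_norm M 1 u powr enn2real 1) * ennreal (Lp_norm M \<infinity> v)"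
    by (subst nn_integral_multc) (use nn_integral_powr_Lp[of 1 u M] assms in auto)
  also have "\<dots> = ennreal (Lp_norm M 1 u * Lp_norm M \<infinity> v)"
    using Lp_norm_nonneg[OF assms(1)] by (simp add: ennreal_mult')
  finally show ?thesis .
qed

lemma Lp_norm_0_AE:
  assumes "1 \<le> p" "p < \<infinity>" "u \<in> Lp M p" "Lp_norm M p u = 0"
  shows "AE x in M. u x = 0"
proof -
  have [measurable]: "u \<in> borel_measurable M" using assms by (auto simp: Lp_def)
  have "enn2real p > 0" using assms by (cases p) (auto simp: ennreal_ge_1)
  then have "(\<integral>\<^sup>+x. ennreal (\<bar>u x\<bar> powr enn2real p) \<partial>M) = 0"
    using nn_integral_powr_Lp[OF assms(1-3)] assms(4) by simp
  then have "AE x in M. \<bar>u x\<bar> powr enn2real p = 0"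
    by (subst (asm) nn_integral_0_iff_AE) auto
  then show ?thesis by eventually_elim auto
qed

text \<open>Young's inequality for the normalised values \<open>\<bar>u x\<bar> / A\<close> and
  \<open>\<bar>v x\<bar> / B\<close>, multiplied by \<open>A * B\<close>. On integration the
  coefficients \<open>A * B / (P * A powr P)\<close> and \<open>A * B / (Q * B powr Q)\<close> leave
  \<open>A * B / P\<close> and \<open>A * B / Q\<close>. A vanishing norm is treated first, since it
  cannot be divided by.\<close>

lemma Hoelder_finite:
  assumes PQ: "1 < P" "1 < Q" "1 / P + 1 / Q = 1" and u: "u \<in> Lp M (ennreal P)" and v: "v \<in> Lp M (ennreal Q)"
  shows "(\<integral>\<^sup>+x. ennreal \<bar>u x * v x\<bar> \<partial>M) \<le> ennreal (Lp_norm M (ennreal P) u * Lp_norm M (ennreal Q) v)"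
proof -
  define A where "A = Lp_norm M (ennreal P) u"
  define B where "B = Lp_norm M (ennreal Q) v"
  have [measurable]: "u \<in> borel_measurable M" "v \<in> borel_measurable M" using u v by (auto simp: Lp_def)
  have nn: "A \<ge> 0" "B \<ge> 0" using Lp_norm_nonneg u v by (auto simp: A_def B_def)
  have r: "enn2real (ennreal P) = P" "enn2real (ennreal Q) = Q" using PQ by auto
  have le: "1 \<le> ennreal P" "1 \<le> ennreal Q" using PQ by (auto simp: ennreal_ge_1)
  show ?thesis
  proof (cases "A = 0 \<or> B = 0")
    case True
    then have "(AE x in M. u x = 0) \<or> (AE x in M. v x = 0)"
      using Lp_norm_0_AE[OF le(1) _ u] Lp_norm_0_AE[OF le(2) _ v] by (auto simp: A_def B_def)
    then have "AE x in M. u x * v x = 0" by auto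
    then have "(\<integral>\<^sup>+x. ennreal \<bar>u x * v x\<bar> \<partial>M) = 0" by (subst nn_integral_0_iff_AE) auto
    then show ?thesis by simp
  next
    case False
    then have pos: "A > 0" "B > 0" using nn by auto
    have "(\<integral>\<^sup>+x. ennreal \<bar>u x * v x\<bar> \<partial>M) \<le>
      (\<integral>\<^sup>+x. ennreal (A * B / (P * A powr P)) * ennreal (\<bar>u x\<bar> powr P) +
              ennreal (A * B / (Q * B powr Q)) * ennreal (\<bar>v x\<bar> powr Q) \<partial>M)"
    proof (rule nn_integral_mono)
      fix x
      have "(\<bar>u x\<bar> / A) * (\<bar>v x\<bar> / B) \<le> (\<bar>u x\<bar> / A) powr P / P + (\<bar>v x\<bar> / B) powr Q / Q"
        by (rule Youngs_inequality) (use PQ pos in auto)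
      then have "A * B * ((\<bar>u x\<bar> / A) * (\<bar>v x\<bar> / B)) \<le> A * B * ((\<bar>u x\<bar> / A) powr P / P + (\<bar>v x\<bar> / B) powr Q / Q)"
        by (rule mult_left_mono) (use pos in auto)
      also have "A * B * ((\<bar>u x\<bar> / A) * (\<bar>v x\<bar> / B)) = \<bar>u x * v x\<bar>"
        using pos by (simp add: abs_mult)
      also have "A * B * ((\<bar>u x\<bar> / A) powr P / P + (\<bar>v x\<bar> / B) powr Q / Q) =
         A * B / (P * A powr P) * (\<bar>u x\<bar> powr P) + A * B / (Q * B powr Q) * (\<bar>v x\<bar> powr Q)"
        using pos by (simp add: powr_divide algebra_simps)
      finally show "ennreal \<bar>u x * v x\<bar> \<le> ennreal (A * B / (P * A powr P)) * ennreal (\<bar>u x\<bar> powr P) +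
              ennreal (A * B / (Q * B powr Q)) * ennreal (\<bar>v x\<bar> powr Q)"
        using pos PQ by (simp add: ennreal_leI flip: ennreal_mult ennreal_plus)
    qed
    also have "\<dots> = ennreal (A * B / (P * A powr P)) * ennreal (A powr P) + ennreal (A * B / (Q * B powr Q)) * ennreal (B powr Q)"
      using nn_integral_powr_Lp[OF le(1) _ u] nn_integral_powr_Lp[OF le(2) _ v] r
      by (subst nn_integral_add) (auto simp: nn_integral_cmult A_def B_def)
    also have "\<dots> = ennreal (A * B * (1 / P + 1 / Q))"
      using pos PQ by (simp add: field_simps flip: ennreal_mult ennreal_plus)
    finally show ?thesis using PQ by (simp add: A_def B_def)
  qed
qed

lemma Hoelder:
  fixes p p' :: ennreal
  assumes "1 \<le> p" "1 / p + 1 / p' = 1" "u \<in> Lp M p" "v \<in> Lp M p'"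
  shows "(\<integral>\<^sup>+x. ennreal \<bar>u x * v x\<bar> \<partial>M) \<le> ennreal (Lp_norm M p u * Lp_norm M p' v)"
  using assms(1,2)
proof (cases rule: dual_exponents_cases)
  case 1
  then show ?thesis using Hoelder_one_infinity[of u M v] assms by simp
next
  case 2
  then show ?thesis using Hoelder_one_infinity[of v M u] assms by (simp add: mult.commute)
next
  case (3 P Q)
  then show ?thesis using Hoelder_finite[of P Q u M v] assms by simp
qed

section \<open>Test functions and the converse of Hoelder's inequality\<close>

lemma bounded_finite_support_Lp:
  assumes [measurable]: "w \<in> borel_measurable M" "A \<in> sets M"
    and fin: "emeasure M A < \<infinity>" and bd: "\<And>x. x \<in> space M \<Longrightarrow> \<bar>w x\<bar> \<le> c * indicator A x" and p: "1 \<le> p"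
  shows "w \<in> Lp M p"
proof (cases "p = \<infinity>")
  case True
  have "\<bar>w x\<bar> \<le> \<bar>c\<bar>" if "x \<in> space M" for x using bd[OF that] by (cases "x \<in> A") auto
  then have "AE x in M. \<bar>w x\<bar> \<le> \<bar>c\<bar>" by (intro AE_I2)
  then show ?thesis using True by (auto simp: Lp_def)
next
  case False
  then have P: "p < \<infinity>" by (simp add: less_top)
  have "(\<integral>\<^sup>+x. ennreal (\<bar>w x\<bar> powr enn2real p) \<partial>M) \<le> (\<integral>\<^sup>+x. ennreal (\<bar>c\<bar> powr enn2real p) * indicator A x \<partial>M)"
  proof (rule nn_integral_mono)
    fix x assume "x \<in> space M"
    from bd[OF this] show "ennreal (\<bar>w x\<bar> powr enn2real p) \<le> ennreal (\<bar>c\<bar> powr enn2real p) * indicator A x"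
      by (cases "x \<in> A") (auto intro!: ennreal_leI powr_mono2)
  qed
  also have "\<dots> < \<infinity>" using fin by (auto simp: nn_integral_cmult ennreal_mult_less_top)
  finally show ?thesis using P by (simp add: Lp_finite_iff)
qed

text \<open>Level sets of \<open>\<bar>u\<bar>\<close> intersected with an exhaustion by sets of
  finite measure. Restricted to \<open>E n\<close>, the function \<open>u\<close> is bounded with
  support of finite measure, hence in every \<open>L\<^sub>s\<close> with \<open>s \<ge> 1\<close>
  at once.\<close>

lemma (in sigma_finite_measure) truncation_sets:
  fixes u :: "'a \<Rightarrow> real"
  assumes [measurable]: "u \<in> borel_measurable M"
  obtains E :: "nat \<Rightarrow> 'a set" where "\<And>n. E n \<in> sets M" "\<And>n. emeasure M (E n) < \<infinity>"
    "\<And>n x. x \<in> E n \<Longrightarrow> \<bar>u x\<bar> \<le> real n" "incseq E" "(\<Union>n. E n) = space M"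
proof -
  obtain A :: "nat \<Rightarrow> 'a set" where A: "range A \<subseteq> sets M" "(\<Union>i. A i) = space M" "\<And>i. emeasure M (A i) \<noteq> \<infinity>" "incseq A"
    by (rule sigma_finite_incseq) blast
  have [measurable]: "A n \<in> sets M" for n using A by auto
  define E where "E n = {x \<in> space M. x \<in> A n \<and> \<bar>u x\<bar> \<le> real n}" for n
  show thesis
  proof (rule that[of E])
    show "E n \<in> sets M" for n unfolding E_def by measurable
    have "emeasure M (E n) \<le> emeasure M (A n)" for n
      unfolding E_def by (rule emeasure_mono) auto
    then show "emeasure M (E n) < \<infinity>" for n using A(3)[of n] by (simp add: less_top top_unique) (metis top_unique less_top)
    show "\<bar>u x\<bar> \<le> real n" if "x \<in> E n" for n x using that by (auto simp: E_def)
    show "incseq E"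
      using \<open>incseq A\<close> by (force simp: E_def incseq_def)
    show "(\<Union>n. E n) = space M"
    proof (intro set_eqI iffI)
      fix x assume x: "x \<in> space M"
      then obtain i where "x \<in> A i" using A(2) by blast
      define j where "j = max i (nat \<lceil>\<bar>u x\<bar>\<rceil>)"
      have "A i \<subseteq> A j" using \<open>incseq A\<close> by (auto simp: j_def incseq_def)
      then have "x \<in> A j" using \<open>x \<in> A i\<close> by auto
      moreover have "\<bar>u x\<bar> \<le> real j" by (simp add: j_def) linarith
      ultimately show "x \<in> (\<Union>n. E n)" using x by (auto simp: E_def)
    qed (auto simp: E_def)
  qed
qed

text \<open>Monotone convergence, read as continuity from below of the measure with density
  \<open>g\<close>.\<close>

lemma nn_integral_le_exhaustion:
  assumes [measurable]: "g \<in> borel_measurable M" "\<And>n. E n \<in> sets M"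
    and E: "incseq E" "(\<Union>n::nat. E n) = space M"
    and le: "\<And>n. (\<integral>\<^sup>+x. g x * indicator (E n) x \<partial>M) \<le> c"
  shows "(\<integral>\<^sup>+x. g x \<partial>M) \<le> c"
proof -
  have "(\<integral>\<^sup>+x. g x \<partial>M) = emeasure (density M g) (\<Union>n. E n)"
    unfolding E(2) by (subst emeasure_density) (auto intro!: nn_integral_cong)
  also have "\<dots> = (SUP n. emeasure (density M g) (E n))"
    by (rule SUP_emeasure_incseq[symmetric]) (use E in auto)
  also have "\<dots> \<le> c"
    by (rule SUP_least) (simp add: emeasure_density le)
  finally show ?thesis .
qed

text \<open>The converse of Hoelder's inequality. It is meant for time averages, which are known
  only as functions with values in \<open>[0, \<infinity>]\<close> together with bounds on their
  integrals against test functions. The proof tests with bounded functions supported on sets of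
  finite measure; they lie in all the spaces involved, so the bound is only asked for on
  \<open>L\<^sub>2 \<inter> L\<^sub>r\<^sub>'\<close>.\<close>

lemma (in sigma_finite_measure) Lp_by_duality:
  fixes r r' :: ennreal and V :: "'a \<Rightarrow> ennreal"
  assumes r: "1 \<le> r" "1 / r + 1 / r' = 1"
    and [measurable]: "V \<in> borel_measurable M" and c: "0 \<le> c"
    and le: "\<And>w. w \<in> Lp M 2 \<Longrightarrow> w \<in> Lp M r' \<Longrightarrow> (\<And>x. 0 \<le> w x) \<Longrightarrow>
      (\<integral>\<^sup>+x. V x * ennreal (w x) \<partial>M) \<le> ennreal (c * Lp_norm M r' w)"
  shows "AE x in M. V x < \<infinity>" "(\<lambda>x. enn2real (V x)) \<in> Lp M r"
proof -
  have r': "1 \<le> r'" using one_le_dual_exponent[OF r] .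
  have ind: "(\<lambda>x. indicator A x :: real) \<in> Lp M s" if "A \<in> sets M" "emeasure M A < \<infinity>" "1 \<le> s" for A s
    by (rule bounded_finite_support_Lp[of _ _ A 1]) (use that in auto)
  define V0 where "V0 = (\<lambda>x. enn2real (V x))"
  have [measurable]: "V0 \<in> borel_measurable M" unfolding V0_def by measurable
  obtain E where E [measurable]: "\<And>n. E n \<in> sets M" and fin: "\<And>n. emeasure M (E n) < \<infinity>"
    and bd: "\<And>n x. x \<in> E n \<Longrightarrow> \<bar>V0 x\<bar> \<le> real n" and inc: "incseq E" "(\<Union>n. E n) = space M"
    using truncation_sets[of V0] by (metis \<open>V0 \<in> borel_measurable M\<close>)
  have V0_nn: "0 \<le> V0 x" for x by (simp add: V0_def)
  show AE_fin: "AE x in M. V x < \<infinity>"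
  proof -
    \<comment> \<open>Testing with the indicator of \<open>E n\<close> makes the integral of
      \<open>V\<close> over \<open>E n\<close> finite, hence \<open>V\<close> finite almost
      everywhere there.\<close>
    have "AE x in M. \<forall>n. V x * ennreal (indicator (E n) x) \<noteq> \<infinity>"
    proof (subst AE_all_countable, intro allI)
      fix n
      have "(\<integral>\<^sup>+x. V x * ennreal (indicator (E n) x) \<partial>M) \<noteq> \<infinity>"
        using le[of "indicator (E n)"] ind[OF E fin] r' by (auto simp: top_unique)
      then show "AE x in M. V x * ennreal (indicator (E n) x) \<noteq> \<infinity>"
        by (intro nn_integral_PInf_AE) auto
    qed
    with AE_space show ?thesis
    proof eventually_elim
      case (elim x)
      then obtain n where "x \<in> E n" using inc by blast
      with elim(2)[rule_format, of n] show ?case by (simp add: less_top)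
    qed
  qed
  have V0: "AE x in M. ennreal (V0 x) = V x"
    using AE_fin by eventually_elim (auto simp: V0_def less_top)
  have le0: "(\<integral>\<^sup>+x. ennreal (V0 x * w x) \<partial>M) \<le> ennreal (c * Lp_norm M r' w)"
    if "w \<in> Lp M 2" "w \<in> Lp M r'" "\<And>x. 0 \<le> w x" for w
  proof -
    have "(\<integral>\<^sup>+x. ennreal (V0 x * w x) \<partial>M) = (\<integral>\<^sup>+x. V x * ennreal (w x) \<partial>M)"
      by (rule nn_integral_cong_AE, use V0 in eventually_elim)
        (auto simp: ennreal_mult V0_nn that)
    then show ?thesis using le[OF that] by simp
  qed
  have "V0 \<in> Lp M r" using r
  proof (cases rule: dual_exponents_cases)
    case 1
    have "(\<integral>\<^sup>+x. ennreal (V0 x) \<partial>M) \<le> ennreal c"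
    proof (rule nn_integral_le_exhaustion[OF _ E inc])
      fix n
      have m: "(indicator (E n) :: 'a \<Rightarrow> real) \<in> Lp M \<infinity>" using ind[OF E fin] by auto
      have "Lp_norm M \<infinity> (indicator (E n)) \<le> 1"
        unfolding Lp_norm_def by (auto intro!: cInf_lower bdd_belowI[of _ 0] simp: indicator_def)
      then have "c * Lp_norm M r' (indicator (E n)) \<le> c"
        using c 1 Lp_norm_nonneg[OF m] by (simp add: mult_left_le)
      moreover have "(\<integral>\<^sup>+x. ennreal (V0 x * indicator (E n) x) \<partial>M) \<le> ennreal (c * Lp_norm M r' (indicator (E n)))"
        by (rule le0) (use ind[OF E fin] r' in auto)
      ultimately have "(\<integral>\<^sup>+x. ennreal (V0 x * indicator (E n) x) \<partial>M) \<le> ennreal c"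
        by (meson ennreal_leI order_trans)
      then show "(\<integral>\<^sup>+x. ennreal (V0 x) * indicator (E n) x \<partial>M) \<le> ennreal c"
        by (simp add: ennreal_mult V0_nn ennreal_indicator)
    qed auto
    then show ?thesis using 1 V0_nn
      by (simp add: Lp_finite_iff) (meson ennreal_less_top le_less_trans)
  next
    case 2
    have "AE x in M. \<forall>n. \<not> (x \<in> E n \<and> V0 x > c)"
    proof (subst AE_all_countable, intro allI)
      fix n
      \<comment> \<open>Test with the set where \<open>V0\<close> exceeds \<open>c\<close>: the
        integral over it is at most \<open>c\<close> times its measure, which is impossible for
        \<open>V0 > c\<close> unless it is a null set. Cutting down to \<open>E n\<close> keeps the
        measure finite, so that it can be subtracted.\<close>
      define A where "A = {x \<in> space M. x \<in> E n \<and> V0 x > c}"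
      have A [measurable]: "A \<in> sets M" unfolding A_def by measurable
      have "emeasure M A \<le> emeasure M (E n)" by (rule emeasure_mono) (auto simp: A_def)
      then have Afin: "emeasure M A < \<infinity>" using fin[of n] by (rule le_less_trans)
      have "ennreal (Lp_norm M 1 (indicator A) powr enn2real 1) = (\<integral>\<^sup>+x. ennreal (\<bar>indicator A x\<bar> powr enn2real 1) \<partial>M)"
        by (rule nn_integral_powr_Lp[symmetric]) (use ind[OF A Afin] in auto)
      also have "\<dots> = emeasure M A" by (simp add: ennreal_indicator)
      finally have nrm: "ennreal (Lp_norm M 1 (indicator A)) = emeasure M A"
        using Lp_norm_nonneg[OF ind[OF A Afin, of 1]] by simp
      have "(\<integral>\<^sup>+x. ennreal (V0 x - c) * indicator A x \<partial>M) + ennreal c * emeasure M A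
         = (\<integral>\<^sup>+x. ennreal (V0 x - c) * indicator A x + ennreal c * indicator A x \<partial>M)"
        by (subst nn_integral_add) (auto simp: nn_integral_cmult_indicator)
      also have "\<dots> = (\<integral>\<^sup>+x. ennreal (V0 x * indicator A x) \<partial>M)"
        using c by (intro nn_integral_cong) (auto simp: indicator_def A_def simp flip: ennreal_plus)
      also have "\<dots> \<le> ennreal (c * Lp_norm M r' (indicator A))"
        by (rule le0) (use ind[OF A Afin] r' in auto)
      also have "\<dots> = ennreal c * emeasure M A"
        using 2 c Lp_norm_nonneg[OF ind[OF A Afin, of 1]] nrm by (simp add: ennreal_mult)
      finally have "(\<integral>\<^sup>+x. ennreal (V0 x - c) * indicator A x \<partial>M) + ennreal c * emeasure M A
          \<le> 0 + ennreal c * emeasure M A" unfolding add_0 .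
      then have "(\<integral>\<^sup>+x. ennreal (V0 x - c) * indicator A x \<partial>M) = 0"
        using Afin by (subst (asm) (1 2) add.commute, subst (asm) ennreal_add_left_cancel_le)
          (auto simp: ennreal_mult_eq_top_iff)
      then have "AE x in M. ennreal (V0 x - c) * indicator A x = 0"
        by (subst (asm) nn_integral_0_iff_AE) auto
      with AE_space show "AE x in M. \<not> (x \<in> E n \<and> V0 x > c)"
        by eventually_elim (auto simp: A_def indicator_def split: if_splits)
    qed
    with AE_space have "AE x in M. \<bar>V0 x\<bar> \<le> c"
    proof eventually_elim
      case (elim x)
      then obtain n where "x \<in> E n" using inc by blast
      with elim(2) show ?case using V0_nn[of x] by (auto simp: not_less)
    qed
    then show ?thesis using 2 by (auto simp: Lp_def)
  next
    case (3 R R')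
    have RR: "(R - 1) * R' = R" using 3 by (simp add: field_simps)
    have "(\<integral>\<^sup>+x. ennreal (V0 x powr R) \<partial>M) \<le> ennreal (c powr R)"
    proof (rule nn_integral_le_exhaustion[OF _ E inc])
      fix n
      \<comment> \<open>The case of equality in Hoelder's inequality: on \<open>E n\<close> both
        \<open>V0 * w\<close> and \<open>w powr R'\<close> are \<open>V0 powr R\<close>, because
        \<open>(R - 1) * R' = R\<close>. The bound then reads \<open>N powr R' \<le> c * N\<close>
        for the norm \<open>N\<close> of \<open>w\<close>, which is finite thanks to the truncation
        and can be divided out.\<close>
      define w where "w = (\<lambda>x. V0 x powr (R - 1) * indicator (E n) x)"
      have [measurable]: "w \<in> borel_measurable M" unfolding w_def by measurable
      have w: "w \<in> Lp M s" if "1 \<le> s" for s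
        by (rule bounded_finite_support_Lp[OF _ E[of n] fin _ that, of _ "real n powr (R - 1)"])
          (use 3 bd[of _ n] V0_nn in \<open>auto simp: w_def indicator_def intro!: powr_mono2\<close>)
      define N where "N = Lp_norm M r' w"
      have N: "0 \<le> N" unfolding N_def using w r' by (intro Lp_norm_nonneg) auto
      have wR: "\<bar>w x\<bar> powr R' = V0 x powr R * indicator (E n) x" for x
        using 3 by (auto simp: w_def indicator_def powr_powr RR)
      have I: "(\<integral>\<^sup>+x. ennreal (V0 x powr R) * indicator (E n) x \<partial>M) = ennreal (N powr R')"
        using nn_integral_powr_Lp[OF r' _ w[OF r']] 3
        by (simp add: wR N_def ennreal_mult ennreal_indicator)
      have "(\<integral>\<^sup>+x. ennreal (V0 x powr R) * indicator (E n) x \<partial>M) = (\<integral>\<^sup>+x. ennreal (V0 x * w x) \<partial>M)"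
      proof (rule nn_integral_cong)
        fix x
        have "V0 x * V0 x powr (R - 1) = V0 x powr R"
          using V0_nn[of x] 3 by (cases "V0 x = 0") (auto simp: powr_diff)
        then show "ennreal (V0 x powr R) * indicator (E n) x = ennreal (V0 x * w x)"
          by (auto simp: w_def indicator_def)
      qed
      also have "\<dots> \<le> ennreal (c * N)"
        unfolding N_def by (rule le0) (use w r' in \<open>auto simp: w_def\<close>)
      finally have "N powr R' \<le> c * N" using I c N by (simp add: ennreal_le_iff)
      have "N powr R' \<le> c powr R"
      proof (cases "N = 0")
        case False
        then have "N powr (R' - 1) \<le> c" using N \<open>N powr R' \<le> c * N\<close>
          by (simp add: powr_diff field_simps)
        then have "(N powr (R' - 1)) powr R \<le> c powr R"
          using 3 by (intro powr_mono2) auto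
        moreover have "(R' - 1) * R = R'" using 3 by (simp add: field_simps)
        ultimately show ?thesis by (simp add: powr_powr)
      qed (use 3 in auto)
      then show "(\<integral>\<^sup>+x. ennreal (V0 x powr R) * indicator (E n) x \<partial>M) \<le> ennreal (c powr R)"
        unfolding I by (rule ennreal_leI)
    qed auto
    then show ?thesis using 3 V0_nn
      by (simp add: Lp_finite_iff) (meson ennreal_less_top le_less_trans)
  qed
  then show "(\<lambda>x. enn2real (V x)) \<in> Lp M r" by (simp add: V0_def)
qed

section \<open>Norm and pairing of square integrable functions\<close>

lemma Lp2_iff: "u \<in> Lp M 2 \<longleftrightarrow> u \<in> borel_measurable M \<and> (\<integral>\<^sup>+x. ennreal ((u x)\<^sup>2) \<partial>M) < \<infinity>"
  by (simp add: Lp_finite_iff powr_numeral)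

lemma nn_integral_square_Lp2:
  assumes "u \<in> Lp M 2"
  shows "(\<integral>\<^sup>+x. ennreal ((u x)\<^sup>2) \<partial>M) = ennreal ((Lp_norm M 2 u)\<^sup>2)"
  using nn_integral_powr_Lp[of 2 u M] assms Lp_norm_nonneg[OF assms]
  by (simp add: powr_numeral)

text \<open>From \<open>(a + b)\<^sup>2 \<le> 2 * a\<^sup>2 + 2 * b\<^sup>2\<close>. This form takes
  the place of the triangle inequality; it suffices because norms of sums are only shown to be
  bounded or to tend to 0.\<close>

lemma Lp2_add:
  assumes "u \<in> Lp M 2" "v \<in> Lp M 2"
  shows "(\<lambda>x. u x + v x) \<in> Lp M 2"
    "(Lp_norm M 2 (\<lambda>x. u x + v x))\<^sup>2 \<le> 2 * (Lp_norm M 2 u)\<^sup>2 + 2 * (Lp_norm M 2 v)\<^sup>2"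
proof -
  have [measurable]: "u \<in> borel_measurable M" "v \<in> borel_measurable M" using assms by (auto simp: Lp_def)
  have "(\<integral>\<^sup>+x. ennreal ((u x + v x)\<^sup>2) \<partial>M) \<le> (\<integral>\<^sup>+x. 2 * ennreal ((u x)\<^sup>2) + 2 * ennreal ((v x)\<^sup>2) \<partial>M)"
  proof (rule nn_integral_mono)
    fix x
    have "(u x + v x)\<^sup>2 \<le> 2 * (u x)\<^sup>2 + 2 * (v x)\<^sup>2"
      using zero_le_power2[of "u x - v x"] by (simp add: power2_sum power2_diff)
    then have "ennreal ((u x + v x)\<^sup>2) \<le> ennreal (2 * (u x)\<^sup>2 + 2 * (v x)\<^sup>2)" by (rule ennreal_leI)
    then show "ennreal ((u x + v x)\<^sup>2) \<le> 2 * ennreal ((u x)\<^sup>2) + 2 * ennreal ((v x)\<^sup>2)"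
      by (simp add: ennreal_plus ennreal_mult)
  qed
  also have "\<dots> = ennreal (2 * (Lp_norm M 2 u)\<^sup>2 + 2 * (Lp_norm M 2 v)\<^sup>2)"
    using assms by (simp add: nn_integral_add nn_integral_cmult nn_integral_square_Lp2 ennreal_plus ennreal_mult)
  finally have *: "(\<integral>\<^sup>+x. ennreal ((u x + v x)\<^sup>2) \<partial>M) \<le> ennreal (2 * (Lp_norm M 2 u)\<^sup>2 + 2 * (Lp_norm M 2 v)\<^sup>2)" .
  also have "\<dots> < \<infinity>" by simp
  finally show **: "(\<lambda>x. u x + v x) \<in> Lp M 2" by (simp add: Lp2_iff)
  show "(Lp_norm M 2 (\<lambda>x. u x + v x))\<^sup>2 \<le> 2 * (Lp_norm M 2 u)\<^sup>2 + 2 * (Lp_norm M 2 v)\<^sup>2"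
    using * unfolding nn_integral_square_Lp2[OF **] by (subst (asm) ennreal_le_iff) auto
qed

lemma Lp2_cmult:
  assumes "u \<in> Lp M 2"
  shows "(\<lambda>x. c * u x) \<in> Lp M 2" "Lp_norm M 2 (\<lambda>x. c * u x) = \<bar>c\<bar> * Lp_norm M 2 u"
proof -
  have [measurable]: "u \<in> borel_measurable M" using assms by (auto simp: Lp_def)
  have *: "(\<integral>\<^sup>+x. ennreal ((c * u x)\<^sup>2) \<partial>M) = ennreal (c\<^sup>2 * (Lp_norm M 2 u)\<^sup>2)"
    using assms by (simp add: power_mult_distrib ennreal_mult nn_integral_cmult nn_integral_square_Lp2)
  then show **: "(\<lambda>x. c * u x) \<in> Lp M 2" by (simp add: Lp2_iff)
  have "(Lp_norm M 2 (\<lambda>x. c * u x))\<^sup>2 = (\<bar>c\<bar> * Lp_norm M 2 u)\<^sup>2"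
    using * unfolding nn_integral_square_Lp2[OF **] by (simp add: power_mult_distrib)
  then show "Lp_norm M 2 (\<lambda>x. c * u x) = \<bar>c\<bar> * Lp_norm M 2 u"
    using Lp_norm_nonneg[OF **] Lp_norm_nonneg[OF assms] by (simp add: power2_eq_iff_nonneg)
qed

lemma Lp2_diff:
  assumes "u \<in> Lp M 2" "v \<in> Lp M 2"
  shows "(\<lambda>x. u x - v x) \<in> Lp M 2"
    "(Lp_norm M 2 (\<lambda>x. u x - v x))\<^sup>2 \<le> 2 * (Lp_norm M 2 u)\<^sup>2 + 2 * (Lp_norm M 2 v)\<^sup>2"
  using Lp2_add[OF assms(1) Lp2_cmult(1)[OF assms(2), of "-1"]] Lp2_cmult(2)[OF assms(2), of "-1"] by auto

lemma Lp_mono: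
  assumes p: "1 \<le> p" "p < \<infinity>" and u: "u \<in> Lp M p" and [measurable]: "w \<in> borel_measurable M"
    and le: "AE x in M. \<bar>w x\<bar> \<le> \<bar>u x\<bar>"
  shows "w \<in> Lp M p" "Lp_norm M p w \<le> Lp_norm M p u"
proof -
  have P: "enn2real p > 0" using p by (cases p) auto
  have *: "(\<integral>\<^sup>+x. ennreal (\<bar>w x\<bar> powr enn2real p) \<partial>M) \<le> (\<integral>\<^sup>+x. ennreal (\<bar>u x\<bar> powr enn2real p) \<partial>M)"
    by (rule nn_integral_mono_AE, use le in eventually_elim) (use P in \<open>auto intro!: ennreal_leI powr_mono2\<close>)
  also have "\<dots> < \<infinity>" using u p by (simp add: Lp_finite_iff)
  finally show w: "w \<in> Lp M p" using p by (simp add: Lp_finite_iff)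
  have "Lp_norm M p w powr enn2real p \<le> Lp_norm M p u powr enn2real p"
    using * unfolding nn_integral_powr_Lp[OF p u] nn_integral_powr_Lp[OF p w] by (simp add: ennreal_le_iff)
  then show "Lp_norm M p w \<le> Lp_norm M p u"
    using powr_mono_both Lp_norm_nonneg[OF u] Lp_norm_nonneg[OF w] P
    by (metis linorder_not_le powr_less_mono2)
qed

lemma integrable_mult_Lp:
  fixes p p' :: ennreal
  assumes "1 \<le> p" "1 / p + 1 / p' = 1" "u \<in> Lp M p" "v \<in> Lp M p'"
  shows "integrable M (\<lambda>x. u x * v x)"
proof -
  have [measurable]: "u \<in> borel_measurable M" "v \<in> borel_measurable M" using assms by (auto simp: Lp_def)
  have "(\<integral>\<^sup>+x. ennreal \<bar>u x * v x\<bar> \<partial>M) < \<infinity>"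
    using Hoelder[OF assms] by (rule le_less_trans) simp
  then show ?thesis by (simp add: integrable_iff_bounded)
qed

lemma two_dual: "1 / (2::ennreal) + 1 / 2 = 1"
proof -
  have h: "1 / (2::ennreal) = ennreal (1 / 2)" by (subst divide_ennreal[symmetric]) auto
  have "ennreal (1 / 2) + ennreal (1 / 2) = 1" by (subst ennreal_plus[symmetric]) auto
  then show ?thesis unfolding h .
qed

lemma integrable_mult_Lp2: "u \<in> Lp M 2 \<Longrightarrow> v \<in> Lp M 2 \<Longrightarrow> integrable M (\<lambda>x. u x * v x)"
  by (rule integrable_mult_Lp[of 2 2]) (auto simp: two_dual)

lemma pairing_bound_Lp2:
  assumes "u \<in> Lp M 2" "v \<in> Lp M 2"
  shows "\<bar>pairing M u v\<bar> \<le> Lp_norm M 2 u * Lp_norm M 2 v"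
proof -
  have "ennreal \<bar>pairing M u v\<bar> \<le> (\<integral>\<^sup>+x. ennreal \<bar>u x * v x\<bar> \<partial>M)"
    unfolding pairing_def using integral_norm_bound_ennreal[OF integrable_mult_Lp2[OF assms]] by simp
  also have "\<dots> \<le> ennreal (Lp_norm M 2 u * Lp_norm M 2 v)"
    by (rule Hoelder) (auto simp: two_dual assms)
  finally show ?thesis
    using Lp_norm_nonneg[OF assms(1)] Lp_norm_nonneg[OF assms(2)] by (simp add: ennreal_le_iff)
qed

section \<open>Comparison of measures on rectangles\<close>

text \<open>The sets that can be approximated from \<open>G\<close> form a \<open>\<sigma>\<close>-algebra.\<close>

lemma algebra_approximation:
  assumes alg: "algebra \<Omega> G" and fin: "finite_measure N"
    and sets: "sets N = sigma_sets \<Omega> G" and X: "X \<in> sets N" and e: "0 < e"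
  shows "\<exists>A\<in>G. measure N ((X - A) \<union> (A - X)) < e"
proof -
  interpret algebra \<Omega> G by fact
  interpret finite_measure N by fact
  have G: "A \<in> sets N" if "A \<in> G" for A using that by (auto simp: sets)
  have "X \<in> sigma_sets \<Omega> G" using X sets by simp
  then have "\<forall>e>0. \<exists>A\<in>G. measure N ((X - A) \<union> (A - X)) < e"
  proof induction
    case (Basic a)
    then show ?case by (auto intro!: bexI[of _ a])
  next
    case Empty
    then show ?case by (auto intro!: bexI[of _ "{}"])
  next
    case (Compl a)
    show ?case
    proof (intro allI impI)
      fix e :: real assume "0 < e"
      then obtain A where A: "A \<in> G" "measure N ((a - A) \<union> (A - a)) < e" using Compl by auto
      have "a \<subseteq> \<Omega>" using sigma_sets_into_sp[OF space_closed Compl(1)] .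
      moreover have "A \<subseteq> \<Omega>" using A space_closed by auto
      ultimately have "(\<Omega> - a - (\<Omega> - A)) \<union> (\<Omega> - A - (\<Omega> - a)) = (a - A) \<union> (A - a)" by auto
      then show "\<exists>A\<in>G. measure N ((\<Omega> - a - A) \<union> (A - (\<Omega> - a))) < e"
        using A by (intro bexI[of _ "\<Omega> - A"]) auto
    qed
  next
    case (Union a)
    show ?case
    proof (intro allI impI)
      fix e :: real assume e: "0 < e"
      have as: "a i \<in> sets N" for i using Union(1) sets by auto
      \<comment> \<open>Finitely many of the errors \<open>d i\<close> add up to at most
        \<open>e / 2\<close>; the other half of \<open>e\<close> is spent on replacing the union by
        a finite one, as \<open>G\<close> is closed only under finite unions.\<close>
      define d where "d i = e / 2 * (1 / 2) ^ Suc i" for i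
      have "d i > 0" for i using e by (simp add: d_def)
      then have "\<forall>i. \<exists>A. A \<in> G \<and> measure N ((a i - A) \<union> (A - a i)) < d i"
        using Union(2) by blast
      from choice[OF this] obtain A
        where A: "\<And>i. A i \<in> G" "\<And>i. measure N ((a i - A i) \<union> (A i - a i)) < d i"
        by blast
      let ?U = "\<lambda>n. (\<Union>i<n. a i)"
      have "(\<lambda>n. measure N (?U n)) \<longlonglongrightarrow> measure N (\<Union>n. ?U n)"
      proof (rule finite_Lim_measure_incseq)
        show "range ?U \<subseteq> sets N" using as by auto
        show "incseq ?U" unfolding incseq_def by (intro allI impI UN_mono) auto
      qed
      moreover have "(\<Union>n. ?U n) = (\<Union>i. a i)"
        using UN_UN_finite_eq[of a] unfolding atLeast0LessThan .
      ultimately have "(\<lambda>n. measure N (?U n)) \<longlonglongrightarrow> measure N (\<Union>i. a i)" by simp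
      then have "\<forall>\<^sub>F n in sequentially. measure N (?U n) > measure N (\<Union>i. a i) - e / 2"
        by (rule order_tendstoD(1)) (use e in auto)
      then obtain n where n: "measure N (?U n) > measure N (\<Union>i. a i) - e / 2"
        by (auto simp: eventually_sequentially)
      define B where "B = (\<Union>i<n. A i)"
      have B: "B \<in> G" unfolding B_def using A by (intro finite_UN) auto
      have "((\<Union>i. a i) - B) \<union> (B - (\<Union>i. a i)) \<subseteq> ((\<Union>i. a i) - ?U n) \<union> (\<Union>i<n. (a i - A i) \<union> (A i - a i))"
        unfolding B_def by auto
      then have "measure N (((\<Union>i. a i) - B) \<union> (B - (\<Union>i. a i))) \<le>
          measure N (((\<Union>i. a i) - ?U n) \<union> (\<Union>i<n. (a i - A i) \<union> (A i - a i)))"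
        by (rule finite_measure_mono) (use as A G in auto)
      also have "\<dots> \<le> measure N ((\<Union>i. a i) - ?U n) + measure N (\<Union>i<n. (a i - A i) \<union> (A i - a i))"
        by (rule measure_subadditive) (use as A G in \<open>auto simp: emeasure_eq_measure\<close>)
      also have "measure N ((\<Union>i. a i) - ?U n) = measure N (\<Union>i. a i) - measure N (?U n)"
        by (rule finite_measure_Diff) (use as in auto)
      also have "\<dots> < e / 2" using n by simp
      also have "measure N (\<Union>i<n. (a i - A i) \<union> (A i - a i)) \<le> (\<Sum>i<n. measure N ((a i - A i) \<union> (A i - a i)))"
        by (rule finite_measure_subadditive_finite) (use as A G in auto)
      also have "\<dots> \<le> (\<Sum>i<n. d i)" using A(2) by (intro sum_mono less_imp_le)
      also have "\<dots> = e / 2 * (\<Sum>i<n. (1 / 2) ^ Suc i)" by (simp add: d_def sum_distrib_left)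
      also have "\<dots> = e / 2 * (1 - (1 / 2) ^ n)"
        by (induction n) (auto simp: field_simps)
      also have "\<dots> \<le> e / 2" using e by (simp add: algebra_simps)
      finally show "\<exists>A\<in>G. measure N (((\<Union>i. a i) - A) \<union> (A - (\<Union>i. a i))) < e"
        using B by auto
    qed
  qed
  then show ?thesis using e by blast
qed

text \<open>Complements that split into finitely many members make \<open>R\<close> a semiring of
  sets, so the finite disjoint unions form the ring generated by it, and this ring contains
  \<open>\<Omega>\<close>. Disjointness stays in the description because measures are to be added up
  over the members of \<open>C\<close>.\<close>

lemma disjoint_finite_unions_algebra:
  assumes int: "Int_stable R" and empty: "{} \<in> R" and univ: "\<Omega> \<in> R" and sub: "R \<subseteq> Pow \<Omega>"
    and compl: "\<And>a. a \<in> R \<Longrightarrow> \<exists>C. finite C \<and> C \<subseteq> R \<and> disjoint C \<and> \<Omega> - a = \<Union>C"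
  shows "algebra \<Omega> {\<Union>C |C. finite C \<and> C \<subseteq> R \<and> disjoint C}"
proof -
  interpret semiring_of_sets \<Omega> R
  proof
    show "R \<subseteq> Pow \<Omega>" "{} \<in> R" by fact+
    show "a \<inter> b \<in> R" if "a \<in> R" "b \<in> R" for a b using int that unfolding Int_stable_def by blast
    show "\<exists>C\<subseteq>R. finite C \<and> disjoint C \<and> a - b = \<Union>C" if ab: "a \<in> R" "b \<in> R" for a b
    proof -
      obtain C where C: "finite C" "C \<subseteq> R" "disjoint C" "\<Omega> - b = \<Union>C" using compl[OF ab(2)] by (elim exE conjE) (rule that)
      have "a \<subseteq> \<Omega>" using sub ab(1) by blast
      \<comment> \<open>A difference inside \<open>R\<close> is obtained by intersecting the
        decomposition of the complement of \<open>b\<close> with \<open>a\<close>.\<close>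
      then have "a - b = a \<inter> (\<Omega> - b)" by blast
      then have eq: "a - b = \<Union>((\<inter>) a ` C)" unfolding C(4) by blast
      have R: "(\<inter>) a ` C \<subseteq> R"
      proof
        fix x assume "x \<in> (\<inter>) a ` C"
        then obtain c where "x = a \<inter> c" "c \<in> C" by blast
        then show "x \<in> R" using int C(2) ab(1) unfolding Int_stable_def by blast
      qed
      have dj: "disjoint ((\<inter>) a ` C)"
      proof (rule disjointI)
        fix x y assume "x \<in> (\<inter>) a ` C" "y \<in> (\<inter>) a ` C" "x \<noteq> y"
        then obtain c d where "x = a \<inter> c" "y = a \<inter> d" "c \<in> C" "d \<in> C" "c \<noteq> d" by blast
        then show "x \<inter> y = {}" using disjointD[OF C(3), of c d] by blast
      qed
      show ?thesis
        by (intro exI[of _ "(\<inter>) a ` C"] conjI R dj eq finite_imageI C(1))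
    qed
  qed
  have "generated_ring = {\<Union>C |C. finite C \<and> C \<subseteq> R \<and> disjoint C}"
    by (auto simp: generated_ring_def)
  moreover have "ring_of_sets \<Omega> generated_ring" by (rule generating_ring)
  moreover have "\<Omega> \<in> generated_ring" using univ by (rule generated_ringI_Basic)
  ultimately show ?thesis
    by (auto simp: algebra_def algebra_axioms_def)
qed

section \<open>Rectangles in a product of two sigma-finite measures\<close>

context pair_sigma_finite
begin

text \<open>\<open>P\<close> need not be a measurable predicate, so its exceptional set is first
  enlarged to a measurable null set \<open>N\<close>; the cylinder over \<open>N\<close> is then a
  null set of the product.\<close>

lemma AE_fst_pair:
  assumes "AE x in M1. P x"
  shows "AE z in M1 \<Otimes>\<^sub>M M2. P (fst z)"
proof -
  obtain N where N: "N \<in> null_sets M1" "{x \<in> space M1. \<not> P x} \<subseteq> N"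
    using assms by (auto simp: eventually_ae_filter)
  have [measurable]: "N \<in> sets M1" using N by auto
  have "AE z in M1 \<Otimes>\<^sub>M M2. fst z \<notin> N"
    by (rule AE_pair_measure) (use AE_not_in[OF N(1)] in auto)
  with AE_space show ?thesis
    by eventually_elim (use N(2) in \<open>auto simp: space_pair_measure\<close>)
qed

lemma AE_snd_pair:
  assumes "AE y in M2. P y"
  shows "AE z in M1 \<Otimes>\<^sub>M M2. P (snd z)"
proof -
  obtain N where N: "N \<in> null_sets M2" "{x \<in> space M2. \<not> P x} \<subseteq> N"
    using assms by (auto simp: eventually_ae_filter)
  have [measurable]: "N \<in> sets M2" using N by auto
  have "AE z in M1 \<Otimes>\<^sub>M M2. snd z \<notin> N"
    by (rule AE_pair_measure) (use AE_not_in[OF N(1)] in auto)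
  with AE_space show ?thesis
    by eventually_elim (use N(2) in \<open>auto simp: space_pair_measure\<close>)
qed

lemma rectangles_finite_unions_algebra:
  "algebra (space M1 \<times> space M2)
    {\<Union>C |C. finite C \<and> C \<subseteq> {a \<times> b | a b. a \<in> sets M1 \<and> b \<in> sets M2} \<and> disjoint C}"
proof (rule disjoint_finite_unions_algebra)
  let ?R = "{a \<times> b | a b. a \<in> sets M1 \<and> b \<in> sets M2}"
  show "Int_stable ?R" by (rule Int_stable_pair_measure_generator)
  show "{} \<in> ?R" by auto
  show "space M1 \<times> space M2 \<in> ?R" by auto
  show "?R \<subseteq> Pow (space M1 \<times> space M2)" by (rule pair_measure_closed)
  fix a assume "a \<in> ?R"
  then obtain A B where AB: "a = A \<times> B" "A \<in> sets M1" "B \<in> sets M2" by auto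
  have "A \<subseteq> space M1" "B \<subseteq> space M2" using AB sets.sets_into_space by auto
  then have "space M1 \<times> space M2 - a = \<Union>{(space M1 - A) \<times> space M2, A \<times> (space M2 - B)}"
    unfolding AB by auto
  then show "\<exists>C. finite C \<and> C \<subseteq> ?R \<and> disjoint C \<and> space M1 \<times> space M2 - a = \<Union>C"
    by (intro exI[of _ "{(space M1 - A) \<times> space M2, A \<times> (space M2 - B)}"])
      (use AB in \<open>auto simp: disjoint_def\<close>)
qed

text \<open>An inequality between measures does not survive proper differences, so a Dynkin class
  argument fails here. Instead it is added up over disjoint unions of rectangles and carried to all
  measurable sets by approximation; on the set where \<open>g < f\<close> it then forces
  \<open>f - g\<close> to have integral 0.\<close>

lemma AE_le_of_rectangles:
  fixes f g :: "'a \<times> 'b \<Rightarrow> ennreal"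
  assumes [measurable]: "f \<in> borel_measurable (M1 \<Otimes>\<^sub>M M2)" "g \<in> borel_measurable (M1 \<Otimes>\<^sub>M M2)"
    and X [measurable]: "X \<in> sets M1" "Y \<in> sets M2"
    and fin: "(\<integral>\<^sup>+z. f z * indicator (X \<times> Y) z \<partial>(M1 \<Otimes>\<^sub>M M2)) < \<infinity>"
      "(\<integral>\<^sup>+z. g z * indicator (X \<times> Y) z \<partial>(M1 \<Otimes>\<^sub>M M2)) < \<infinity>"
    and le: "\<And>A B. A \<in> sets M1 \<Longrightarrow> B \<in> sets M2 \<Longrightarrow> A \<subseteq> X \<Longrightarrow> B \<subseteq> Y \<Longrightarrow>
      (\<integral>\<^sup>+z. f z * indicator (A \<times> B) z \<partial>(M1 \<Otimes>\<^sub>M M2)) \<le> (\<integral>\<^sup>+z. g z * indicator (A \<times> B) z \<partial>(M1 \<Otimes>\<^sub>M M2))"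
  shows "AE z in M1 \<Otimes>\<^sub>M M2. z \<in> X \<times> Y \<longrightarrow> f z \<le> g z"
proof -
  let ?P = "M1 \<Otimes>\<^sub>M M2"
  define F where "F = density ?P (\<lambda>z. f z * indicator (X \<times> Y) z)"
  define H where "H = density ?P (\<lambda>z. g z * indicator (X \<times> Y) z)"
  \<comment> \<open>The sum of the two measures, so that one approximating set serves
    \<open>F\<close> and \<open>H\<close> at the same time.\<close>
  define N where "N = density ?P (\<lambda>z. (f z + g z) * indicator (X \<times> Y) z)"
  have eF: "emeasure F A = (\<integral>\<^sup>+z. f z * indicator (X \<times> Y) z * indicator A z \<partial>?P)"
    and eH: "emeasure H A = (\<integral>\<^sup>+z. g z * indicator (X \<times> Y) z * indicator A z \<partial>?P)"
    and eN: "emeasure N A = (\<integral>\<^sup>+z. (f z + g z) * indicator (X \<times> Y) z * indicator A z \<partial>?P)"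
    if [measurable]: "A \<in> sets ?P" for A
    unfolding F_def H_def N_def by (auto simp: emeasure_density)
  have [simp]: "sets F = sets ?P" "sets H = sets ?P" "sets N = sets ?P"
    "space F = space ?P" "space H = space ?P" "space N = space ?P"
    by (auto simp: F_def H_def N_def)
  have spc: "f z * indicator (X \<times> Y) z * indicator (space ?P) z = f z * indicator (X \<times> Y) z"
    "g z * indicator (X \<times> Y) z * indicator (space ?P) z = g z * indicator (X \<times> Y) z" for z
    using sets.sets_into_space[OF X(1)] sets.sets_into_space[OF X(2)]
    by (auto simp: indicator_def space_pair_measure)
  interpret F: finite_measure F by standard (use fin in \<open>simp add: eF spc\<close>)
  interpret H: finite_measure H by standard (use fin in \<open>simp add: eH spc\<close>)
  have N_add: "emeasure N A = emeasure F A + emeasure H A" if [measurable]: "A \<in> sets ?P" for A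
    using that by (simp add: eF eH eN distrib_right nn_integral_add)
  interpret N: finite_measure N
    by standard (simp add: N_add[OF sets.top, simplified] F.emeasure_eq_measure H.emeasure_eq_measure)
  have FN: "measure F A \<le> measure N A" and HN: "measure H A \<le> measure N A" if "A \<in> sets ?P" for A
    using N_add[OF that] measure_nonneg
    by (auto simp: F.emeasure_eq_measure H.emeasure_eq_measure N.emeasure_eq_measure simp flip: ennreal_plus)
  have rect: "emeasure F (A \<times> B) \<le> emeasure H (A \<times> B)" if "A \<in> sets M1" "B \<in> sets M2" for A B
  proof -
    have "indicator (X \<times> Y) z * indicator (A \<times> B) z = (indicator ((A \<inter> X) \<times> (B \<inter> Y)) z :: ennreal)" for z
      by (auto simp: indicator_def)
    then show ?thesis
      using le[of "A \<inter> X" "B \<inter> Y"] that by (simp add: eF eH mult.assoc)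
  qed
  let ?G = "{\<Union>C |C. finite C \<and> C \<subseteq> {a \<times> b | a b. a \<in> sets M1 \<and> b \<in> sets M2} \<and> disjoint C}"
  have G: "A \<in> sets ?P" if "A \<in> ?G" for A using that by (auto intro!: sets.finite_Union)
  have alg_le: "measure F A \<le> measure H A" if A: "A \<in> ?G" for A
  proof -
    obtain C where C: "finite C" "C \<subseteq> {a \<times> b | a b. a \<in> sets M1 \<and> b \<in> sets M2}" "disjoint C" "A = \<Union>C"
      using A by auto
    have Cs: "C \<subseteq> sets ?P" using C by auto
    have d: "disjoint_family_on (\<lambda>x. x) C" using C(3) by (auto simp: disjoint_def disjoint_family_on_def)
    have "emeasure F A = (\<Sum>a\<in>C. emeasure F a)"
      unfolding C(4) using sum_emeasure[of "\<lambda>x. x" C F] C Cs d by simp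
    also have "\<dots> \<le> (\<Sum>a\<in>C. emeasure H a)"
      using C rect by (intro sum_mono) auto
    also have "\<dots> = emeasure H A"
      unfolding C(4) using sum_emeasure[of "\<lambda>x. x" C H] C Cs d by simp
    finally show ?thesis by (simp add: F.emeasure_eq_measure H.emeasure_eq_measure)
  qed
  have sG: "sets N = sigma_sets (space M1 \<times> space M2) ?G"
  proof -
    have "sigma_sets (space M1 \<times> space M2) {a \<times> b | a b. a \<in> sets M1 \<and> b \<in> sets M2}
        \<subseteq> sigma_sets (space M1 \<times> space M2) ?G"
    proof (rule sigma_sets_mono', rule subsetI)
      fix a assume "a \<in> {a \<times> b | a b. a \<in> sets M1 \<and> b \<in> sets M2}"
      then show "a \<in> ?G" by (intro CollectI exI[of _ "{a}"]) auto
    qed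
    moreover have "sigma_sets (space M1 \<times> space M2) ?G \<subseteq> sets ?P"
      using sets.sigma_sets_subset[of ?G ?P, OF subsetI[OF G]] unfolding space_pair_measure .
    ultimately show ?thesis unfolding \<open>sets N = sets ?P\<close> sets_pair_measure by (rule subset_antisym)
  qed
  \<comment> \<open>Replacing \<open>A\<close> by \<open>B\<close> costs at most
    \<open>e / 2\<close> in \<open>F\<close>, and returning to \<open>A\<close> at most
    \<open>e / 2\<close> in \<open>H\<close>.\<close>
  have main: "measure F A \<le> measure H A" if A: "A \<in> sets ?P" for A
  proof (rule field_le_epsilon)
    fix e :: real assume "0 < e"
    then obtain B where B: "B \<in> ?G" "measure N ((A - B) \<union> (B - A)) < e / 2"
      using algebra_approximation[OF rectangles_finite_unions_algebra N.finite_measure_axioms sG, of A "e / 2"] A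
      by auto
    note Bs = G[OF B(1)]
    have "measure F A \<le> measure F (B \<union> ((A - B) \<union> (B - A)))"
      by (rule F.finite_measure_mono) (use A Bs in auto)
    also have "\<dots> \<le> measure F B + measure F ((A - B) \<union> (B - A))"
      by (rule measure_Un_le) (use A Bs in auto)
    also have "\<dots> \<le> measure F B + e / 2" using FN[of "(A - B) \<union> (B - A)"] A Bs B by auto
    also have "\<dots> \<le> measure H B + e / 2" using alg_le[OF B(1)] by simp
    also have "measure H B \<le> measure H (A \<union> ((A - B) \<union> (B - A)))"
      by (rule H.finite_measure_mono) (use A Bs in auto)
    also have "\<dots> \<le> measure H A + measure H ((A - B) \<union> (B - A))"
      by (rule measure_Un_le) (use A Bs in auto)
    also have "\<dots> \<le> measure H A + e / 2" using HN[of "(A - B) \<union> (B - A)"] A Bs B by auto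
    finally show "measure F A \<le> measure H A + e" by simp
  qed
  define E where "E = {z \<in> space ?P. z \<in> X \<times> Y \<and> g z < f z}"
  have E [measurable]: "E \<in> sets ?P" unfolding E_def by measurable
  have "(\<integral>\<^sup>+z. g z * indicator E z + (f z - g z) * indicator E z \<partial>?P) = emeasure F E"
    unfolding eF[OF E] by (intro nn_integral_cong) (auto simp: E_def indicator_def ennreal_minus_if diff_add_cancel_ennreal add.commute less_imp_le)
  also have "\<dots> \<le> emeasure H E"
    using main[OF E] by (simp add: F.emeasure_eq_measure H.emeasure_eq_measure)
  also have "\<dots> = (\<integral>\<^sup>+z. g z * indicator E z \<partial>?P)"
    unfolding eH[OF E] by (intro nn_integral_cong) (auto simp: E_def indicator_def)
  finally have le': "(\<integral>\<^sup>+z. (f z - g z) * indicator E z \<partial>?P) + (\<integral>\<^sup>+z. g z * indicator E z \<partial>?P) \<le> 0 + (\<integral>\<^sup>+z. g z * indicator E z \<partial>?P)"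
    by (subst (asm) nn_integral_add) (auto simp: add.commute)
  have "(\<integral>\<^sup>+z. g z * indicator E z \<partial>?P) \<le> (\<integral>\<^sup>+z. g z * indicator (X \<times> Y) z \<partial>?P)"
    by (intro nn_integral_mono) (auto simp: E_def indicator_def)
  \<comment> \<open>Finiteness of this integral permits its cancellation from both sides of
    \<open>le'\<close>.\<close>
  also have "\<dots> < \<infinity>" by fact
  finally have "(\<integral>\<^sup>+z. (f z - g z) * indicator E z \<partial>?P) = 0"
    using le' by (subst (asm) (1 2) add.commute, subst (asm) ennreal_add_left_cancel_le) auto
  then have "AE z in ?P. (f z - g z) * indicator E z = 0"
    by (subst (asm) nn_integral_0_iff_AE) auto
  with AE_space show ?thesis
  proof eventually_elim
    case (elim z)
    show ?case
    proof (rule ccontr)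
      assume "\<not> ?case"
      then have "z \<in> E" "g z < f z" using elim by (auto simp: E_def not_le)
      then show False using elim(2) diff_gr0_ennreal[of "g z" "f z"] by auto
    qed
  qed
qed

end

section \<open>An integrated form of a two-parameter inequality\<close>

lemma nn_integral_shift:
  fixes f :: "real \<Rightarrow> ennreal"
  assumes [measurable]: "f \<in> borel_measurable borel"
  shows "(\<integral>\<^sup>+x\<in>{a<..<b}. f (c + x) \<partial>lborel) = (\<integral>\<^sup>+x\<in>{c + a<..<c + b}. f x \<partial>lborel)"
  by (subst (2) nn_integral_real_affine[where c = 1 and t = c])
    (auto intro!: nn_integral_cong simp: indicator_def)

lemma nn_integral_split:
  fixes f :: "real \<Rightarrow> ennreal"
  assumes [measurable]: "f \<in> borel_measurable borel" and "a \<le> b" "b \<le> c"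
  shows "(\<integral>\<^sup>+x\<in>{a<..<c}. f x \<partial>lborel) = (\<integral>\<^sup>+x\<in>{a<..<b}. f x \<partial>lborel) + (\<integral>\<^sup>+x\<in>{b<..<c}. f x \<partial>lborel)"
proof -
  have "(\<integral>\<^sup>+x\<in>{a<..<c}. f x \<partial>lborel) = (\<integral>\<^sup>+x. f x * indicator {a<..<b} x + f x * indicator {b<..<c} x \<partial>lborel)"
    by (rule nn_integral_cong_AE, use AE_lborel_singleton[of b] in eventually_elim)
      (use assms in \<open>auto simp: indicator_def\<close>)
  then show ?thesis by (simp add: nn_integral_add)
qed

lemma nn_integral_interval_const:
  "a \<le> b \<Longrightarrow> (\<integral>\<^sup>+x\<in>{a<..<b}. c \<partial>lborel) = c * ennreal (b - a)"
  by (simp add: nn_integral_cmult)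

text \<open>Connects extended integrals to the gauge integral, in terms of which the differentiation
  theorem \<open>integrable_ccontinuous_explicit\<close> is stated.\<close>

lemma nn_integral_eq_HK_integral:
  fixes a :: "real \<Rightarrow> real"
  assumes [measurable]: "a \<in> borel_measurable borel" and nn: "\<And>x. 0 \<le> a x" and B: "\<And>x. a x \<le> B"
  shows "a integrable_on {u..v}" "(\<integral>\<^sup>+x\<in>{u<..<v}. ennreal (a x) \<partial>lborel) = ennreal (integral {u..v} a)"
proof -
  have si: "set_integrable lborel {u..v} a"
    unfolding set_integrable_def
    by (rule integrableI_bounded_set_indicator[where B = B])
      (use nn B in \<open>auto simp: emeasure_lborel_Icc_eq abs_of_nonneg\<close>)
  from set_borel_integral_eq_integral[OF si]
  show "a integrable_on {u..v}" by auto
  have "(\<integral>\<^sup>+x\<in>{u<..<v}. ennreal (a x) \<partial>lborel) = (\<integral>\<^sup>+x. ennreal (indicator {u..v} x * a x) \<partial>lborel)"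
    by (rule nn_integral_cong_AE, use AE_lborel_singleton[of u] AE_lborel_singleton[of v] in eventually_elim)
      (auto simp: indicator_def)
  also have "\<dots> = ennreal (LINT x:{u..v}|lborel. a x)"
    unfolding set_lebesgue_integral_def
    by (subst nn_integral_eq_integral) (use si nn in \<open>auto simp: set_integrable_def\<close>)
  also have "(LINT x:{u..v}|lborel. a x) = integral {u..v} a"
    using set_borel_integral_eq_integral[OF si] by auto
  finally show "(\<integral>\<^sup>+x\<in>{u<..<v}. ennreal (a x) \<partial>lborel) = ennreal (integral {u..v} a)" .
qed

text \<open>The differentiation theorem in dimension one, for cubes with the point at their lower
  corner: these are the intervals \<open>{s..s + h}\<close>.\<close>

lemma right_averages_tendsto_AE:
  fixes a :: "real \<Rightarrow> real"
  assumes [measurable]: "a \<in> borel_measurable borel" and nn: "\<And>x. 0 \<le> a x" and B: "\<And>x. a x \<le> B"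
  shows "AE s in lborel. ((\<lambda>h. (\<integral>\<^sup>+r\<in>{0<..<h}. ennreal (a (s + r)) \<partial>lborel) / ennreal h) \<longlongrightarrow> ennreal (a s)) (at_right 0)"
proof -
  have "a integrable_on cbox u v" for u v using nn_integral_eq_HK_integral(1)[OF assms] by simp
  from integrable_ccontinuous_explicit[OF this] obtain N where N: "negligible N"
    and lim: "\<And>x e. \<lbrakk>x \<notin> N; 0 < e\<rbrakk> \<Longrightarrow> \<exists>d>0. \<forall>h. 0 < h \<and> h < d \<longrightarrow>
        norm (integral (cbox x (x + h *\<^sub>R One)) a /\<^sub>R h ^ DIM(real) - a x) < e" by auto
  \<comment> \<open>A negligible set need not be Borel; it is a null set of the completion, and
    statements that hold almost everywhere are the same for \<open>lebesgue\<close> and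
    \<open>lborel\<close>.\<close>
  have "AE s in lebesgue. s \<notin> N"
    using N by (intro AE_not_in) (simp add: negligible_iff_null_sets)
  then have "AE s in lborel. s \<notin> N" by (simp add: AE_completion_iff)
  then show ?thesis
  proof eventually_elim
    case (elim s)
    have eq: "(\<integral>\<^sup>+r\<in>{0<..<h}. ennreal (a (s + r)) \<partial>lborel) / ennreal h = ennreal (integral {s..s + h} a / h)" if "0 < h" for h
    proof -
      have "(\<integral>\<^sup>+r\<in>{0<..<h}. ennreal (a (s + r)) \<partial>lborel) = (\<integral>\<^sup>+r\<in>{s<..<s + h}. ennreal (a r) \<partial>lborel)"
        using nn_integral_shift[of "\<lambda>r. ennreal (a r)", where a = 0 and b = h and c = s] by simp
      also have "\<dots> = ennreal (integral {s..s + h} a)" by (rule nn_integral_eq_HK_integral(2)[OF assms])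
      finally show ?thesis using that nn
        by (simp add: divide_ennreal integral_nonneg nn_integral_eq_HK_integral(1)[OF assms])
    qed
    have "((\<lambda>h. integral {s..s + h} a / h) \<longlongrightarrow> a s) (at_right 0)"
    proof (rule tendstoI)
      fix e :: real assume "0 < e"
      from lim[OF elim this] obtain d where d: "d > 0" "\<forall>h. 0 < h \<and> h < d \<longrightarrow>
        norm (integral (cbox s (s + h *\<^sub>R One)) a /\<^sub>R h ^ DIM(real) - a s) < e" by auto
      show "\<forall>\<^sub>F h in at_right 0. dist (integral {s..s + h} a / h) (a s) < e"
        unfolding eventually_at_right_field
        by (rule exI[of _ d]) (use d in \<open>auto simp: dist_real_def divide_inverse mult.commute\<close>)
    qed
    then have "((\<lambda>h. ennreal (integral {s..s + h} a / h)) \<longlongrightarrow> ennreal (a s)) (at_right 0)"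
      by (rule tendsto_ennrealI)
    then show ?case
      by (rule Lim_transform_eventually)
        (auto simp: eventually_at_right_field eq intro!: exI[of _ 1])
  qed
qed

text \<open>Dominated convergence: the averages converge almost everywhere by differentiation, and
  they inherit the constant bound \<open>B\<close> because an average that starts before
  \<open>t\<close> and has length below 1 only sees times below \<open>t + 1\<close>.\<close>

lemma convolution_of_averages_tendsto:
  fixes \<alpha> \<beta> :: "real \<Rightarrow> ennreal"
  assumes [measurable]: "\<alpha> \<in> borel_measurable borel" "\<beta> \<in> borel_measurable borel" and t: "0 < t"
    and B: "\<And>s. 0 < s \<Longrightarrow> s < t + 1 \<Longrightarrow> \<alpha> s \<le> ennreal B" "\<And>s. 0 < s \<Longrightarrow> s < t + 1 \<Longrightarrow> \<beta> s \<le> ennreal B"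
    and h: "\<And>n. 0 < h n" "\<And>n. h n < 1" "h \<longlonglongrightarrow> 0"
  shows "(\<lambda>n. \<integral>\<^sup>+s\<in>{0<..<t}. ((\<integral>\<^sup>+r\<in>{0<..<h n}. \<alpha> (s + r) \<partial>lborel) / ennreal (h n)) *
      ((\<integral>\<^sup>+r\<in>{0<..<h n}. \<beta> (t - s + r) \<partial>lborel) / ennreal (h n)) \<partial>lborel)
    \<longlonglongrightarrow> (\<integral>\<^sup>+s\<in>{0<..<t}. \<alpha> s * \<beta> (t - s) \<partial>lborel)"
proof -
  \<comment> \<open>The differentiation theorem is applied to bounded real functions on the whole
    line, whereas \<open>\<gamma>\<close> is known to be bounded, and so finite, only between 0 and
    \<open>t + 1\<close>; elsewhere the value is set to 0.\<close>
  define cut where "cut \<gamma> s = enn2real (\<gamma> s * indicator {0<..<t + 1} s)" for \<gamma> :: "real \<Rightarrow> ennreal" and s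
  have cut: "cut \<gamma> \<in> borel_measurable borel" "\<And>s. 0 \<le> cut \<gamma> s" "\<And>s. cut \<gamma> s \<le> max 0 B"
      "\<And>s. 0 < s \<Longrightarrow> s < t + 1 \<Longrightarrow> ennreal (cut \<gamma> s) = \<gamma> s"
    if [measurable]: "\<gamma> \<in> borel_measurable borel" and b: "\<And>s. 0 < s \<Longrightarrow> s < t + 1 \<Longrightarrow> \<gamma> s \<le> ennreal B" for \<gamma>
  proof -
    show "cut \<gamma> \<in> borel_measurable borel" unfolding cut_def[abs_def] by measurable
    show "0 \<le> cut \<gamma> s" for s by (simp add: cut_def)
    show "ennreal (cut \<gamma> s) = \<gamma> s" if "0 < s" "s < t + 1" for s
      using b[OF that] that le_less_trans[OF b[OF that] ennreal_less_top]
      by (simp add: cut_def)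
    show "cut \<gamma> s \<le> max 0 B" for s
      using b[of s] by (auto simp: cut_def indicator_def enn2real_leI max_def ennreal_neg
          intro!: enn2real_leI order.trans[OF b[of s]] ennreal_leI)
  qed
  have avg: "AE s in lborel. s \<in> {0<..<t} \<longrightarrow>
      (\<lambda>n. (\<integral>\<^sup>+r\<in>{0<..<h n}. \<gamma> (s + r) \<partial>lborel) / ennreal (h n)) \<longlonglongrightarrow> \<gamma> s"
    if m: "\<gamma> \<in> borel_measurable borel" and b: "\<And>s. 0 < s \<Longrightarrow> s < t + 1 \<Longrightarrow> \<gamma> s \<le> ennreal B" for \<gamma>
  proof -
    have "AE s in lborel. ((\<lambda>h. (\<integral>\<^sup>+r\<in>{0<..<h}. ennreal (cut \<gamma> (s + r)) \<partial>lborel) / ennreal h) \<longlongrightarrow> ennreal (cut \<gamma> s)) (at_right 0)"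
      using cut(1-3)[OF m b] by (intro right_averages_tendsto_AE[where B = "max 0 B"]) auto
    then show ?thesis
    proof eventually_elim
      case (elim s)
      show ?case
      proof
        assume s: "s \<in> {0<..<t}"
        have "filterlim h (at_right 0) sequentially"
          using h by (auto simp: filterlim_at less_imp_neq[OF h(1), symmetric] intro!: always_eventually)
        from filterlim_compose[OF elim this]
        have "(\<lambda>n. (\<integral>\<^sup>+r\<in>{0<..<h n}. ennreal (cut \<gamma> (s + r)) \<partial>lborel) / ennreal (h n)) \<longlonglongrightarrow> ennreal (cut \<gamma> s)" .
        moreover have "ennreal (cut \<gamma> s) = \<gamma> s" using cut(4)[OF m b] s by auto
        moreover have "(\<integral>\<^sup>+r\<in>{0<..<h n}. ennreal (cut \<gamma> (s + r)) \<partial>lborel) = (\<integral>\<^sup>+r\<in>{0<..<h n}. \<gamma> (s + r) \<partial>lborel)" for n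
        proof (rule nn_integral_cong)
          fix r
          show "ennreal (cut \<gamma> (s + r)) * indicator {0<..<h n} r = \<gamma> (s + r) * indicator {0<..<h n} r"
            using cut(4)[OF m b, of "s + r"] s h(2)[of n] by (cases "r \<in> {0<..<h n}") auto
        qed
        ultimately show "(\<lambda>n. (\<integral>\<^sup>+r\<in>{0<..<h n}. \<gamma> (s + r) \<partial>lborel) / ennreal (h n)) \<longlonglongrightarrow> \<gamma> s" by simp
      qed
    qed
  qed
  have avg_bd: "(\<integral>\<^sup>+r\<in>{0<..<h n}. \<gamma> (s + r) \<partial>lborel) / ennreal (h n) \<le> ennreal B"
    if b: "\<And>s. 0 < s \<Longrightarrow> s < t + 1 \<Longrightarrow> \<gamma> s \<le> ennreal B" and s: "s \<in> {0<..<t}" for \<gamma> s n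
  proof -
    have "(\<integral>\<^sup>+r\<in>{0<..<h n}. \<gamma> (s + r) \<partial>lborel) \<le> (\<integral>\<^sup>+r\<in>{0<..<h n}. ennreal B \<partial>lborel)"
    proof (rule nn_integral_mono)
      fix r
      show "\<gamma> (s + r) * indicator {0<..<h n} r \<le> ennreal B * indicator {0<..<h n} r"
        using b[of "s + r"] s h(2)[of n] by (cases "r \<in> {0<..<h n}") auto
    qed
    also have "\<dots> = ennreal B * ennreal (h n)"
      using h(1)[of n] by (subst nn_integral_interval_const) auto
    finally show ?thesis using h(1)[of n]
      by (intro divide_le_posI_ennreal) (auto simp: mult.commute)
  qed
  have \<beta>_avg: "AE s in lborel. s \<in> {0<..<t} \<longrightarrow>
      (\<lambda>n. (\<integral>\<^sup>+r\<in>{0<..<h n}. \<beta> (t - s + r) \<partial>lborel) / ennreal (h n)) \<longlonglongrightarrow> \<beta> (t - s)"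
  proof -
    have "AE s in lborel. s \<in> {0<..<t} \<longrightarrow>
      (\<lambda>n. (\<integral>\<^sup>+r\<in>{0<..<h n}. \<beta> (s + r) \<partial>lborel) / ennreal (h n)) \<longlonglongrightarrow> \<beta> s"
      by (rule avg) (use B in auto)
    then obtain N where N: "N \<in> null_sets lborel" and NN: "{s \<in> space lborel. \<not> (s \<in> {0<..<t} \<longrightarrow>
      (\<lambda>n. (\<integral>\<^sup>+r\<in>{0<..<h n}. \<beta> (s + r) \<partial>lborel) / ennreal (h n)) \<longlonglongrightarrow> \<beta> s)} \<subseteq> N"
      by (auto simp: eventually_ae_filter)
    have [measurable]: "N \<in> sets borel" using N by auto
    \<comment> \<open>The reflection \<open>s \<mapsto> t - s\<close> preserves null sets.\<close>
    have "AE s in lborel. t + (-1) * s \<notin> N"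
      by (rule AE_borel_affine) (use N in \<open>auto intro: AE_not_in\<close>)
    then show ?thesis
    proof eventually_elim
      case (elim s)
      then have "t - s \<notin> N" by simp
      then show ?case using NN by (auto dest!: subsetD[of _ _ "t - s"])
    qed
  qed
  have conv: "AE s in lborel. (\<lambda>n. ((\<integral>\<^sup>+r\<in>{0<..<h n}. \<alpha> (s + r) \<partial>lborel) / ennreal (h n)) *
      ((\<integral>\<^sup>+r\<in>{0<..<h n}. \<beta> (t - s + r) \<partial>lborel) / ennreal (h n)) * indicator {0<..<t} s)
      \<longlonglongrightarrow> \<alpha> s * \<beta> (t - s) * indicator {0<..<t} s"
  proof -
    have "AE s in lborel. s \<in> {0<..<t} \<longrightarrow>
      (\<lambda>n. (\<integral>\<^sup>+r\<in>{0<..<h n}. \<alpha> (s + r) \<partial>lborel) / ennreal (h n)) \<longlonglongrightarrow> \<alpha> s"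
      by (rule avg) (use B in auto)
    then show ?thesis using \<beta>_avg
    proof eventually_elim
      case (elim s)
      show ?case
      proof (cases "s \<in> {0<..<t}")
        case True
        have "\<alpha> s < top" "\<beta> (t - s) < top"
          using True B(1)[of s] B(2)[of "t - s"] by (auto intro: le_less_trans)
        then show ?thesis using elim True
          by (auto intro!: tendsto_mult_ennreal)
      qed auto
    qed
  qed
  show ?thesis
  proof (rule nn_integral_dominated_convergence[where w = "\<lambda>s. ennreal B * ennreal B * indicator {0<..<t} s"])
    show "AE s in lborel. ((\<integral>\<^sup>+r\<in>{0<..<h n}. \<alpha> (s + r) \<partial>lborel) / ennreal (h n)) *
      ((\<integral>\<^sup>+r\<in>{0<..<h n}. \<beta> (t - s + r) \<partial>lborel) / ennreal (h n)) * indicator {0<..<t} s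
      \<le> ennreal B * ennreal B * indicator {0<..<t} s" for n
    proof (rule AE_I2)
      fix s
      have "t - s \<in> {0<..<t}" if "s \<in> {0<..<t}" using that by auto
      then show "((\<integral>\<^sup>+r\<in>{0<..<h n}. \<alpha> (s + r) \<partial>lborel) / ennreal (h n)) *
      ((\<integral>\<^sup>+r\<in>{0<..<h n}. \<beta> (t - s + r) \<partial>lborel) / ennreal (h n)) * indicator {0<..<t} s
      \<le> ennreal B * ennreal B * indicator {0<..<t} s"
        using avg_bd[of \<alpha> s n, OF B(1)] avg_bd[of \<beta> "t - s" n, OF B(2)]
        by (cases "s \<in> {0<..<t}") (auto intro!: mult_mono)
    qed
    show "(\<integral>\<^sup>+s. ennreal B * ennreal B * indicator {0<..<t} s \<partial>lborel) < \<infinity>"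
      using t by (subst nn_integral_interval_const) (auto simp: ennreal_mult_less_top)
  qed (use conv in auto)
qed

text \<open>
  When \<open>step\<close> is integrated along \<open>a + b = t\<close>, its four terms become integrals of \<open>F\<close> over the
  same lines \<open>a + b = const\<close>. They cancel up to a piece of size \<open>h\<^sup>2\<close> near \<open>(t, 0)\<close> on the left
  and one near \<open>(0, t)\<close> on the right.
\<close>

lemma diagonal_step_integrated:
  fixes F :: "real \<Rightarrow> real \<Rightarrow> ennreal"
  assumes Fm: "(\<lambda>(a, b). F a b) \<in> borel_measurable (borel \<Otimes>\<^sub>M borel)"
    and [measurable]: "\<alpha> \<in> borel_measurable borel" "\<beta> \<in> borel_measurable borel"
    and t: "0 < t" and h: "0 < h" "h < 1"
    and B: "\<And>a b. 0 < a \<Longrightarrow> a < t + 2 \<Longrightarrow> 0 < b \<Longrightarrow> b < t + 2 \<Longrightarrow> F a b \<le> ennreal B"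
    and step: "\<And>a b. 0 < a \<Longrightarrow> a < t \<Longrightarrow> 0 < b \<Longrightarrow> b < t \<Longrightarrow>
       (\<integral>\<^sup>+r\<in>{0<..<h}. F (a + h) (b + r) \<partial>lborel) + (\<integral>\<^sup>+r\<in>{0<..<h}. F (a + r) b \<partial>lborel)
       \<le> (\<integral>\<^sup>+r\<in>{0<..<h}. F (a + r) (b + h) \<partial>lborel) + (\<integral>\<^sup>+r\<in>{0<..<h}. F a (b + r) \<partial>lborel)
         + C * (\<integral>\<^sup>+r\<in>{0<..<h}. \<alpha> (a + r) \<partial>lborel) * (\<integral>\<^sup>+r\<in>{0<..<h}. \<beta> (b + r) \<partial>lborel)"
    and lower: "\<And>a b. 0 < a \<Longrightarrow> a < h \<Longrightarrow> 0 < b \<Longrightarrow> b < h \<Longrightarrow> L \<le> F (t + a) b"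
    and upper: "\<And>a b. 0 < a \<Longrightarrow> a < h \<Longrightarrow> 0 < b \<Longrightarrow> b < h \<Longrightarrow> F a (t + b) \<le> U"
  shows "L * ennreal h * ennreal h \<le> C * (\<integral>\<^sup>+s\<in>{0<..<t}. (\<integral>\<^sup>+r\<in>{0<..<h}. \<alpha> (s + r) \<partial>lborel) *
      (\<integral>\<^sup>+r\<in>{0<..<h}. \<beta> (t - s + r) \<partial>lborel) \<partial>lborel) + U * ennreal h * ennreal h"
proof -
  have Fm' [measurable (raw)]: "(\<lambda>x. F (f x) (g x)) \<in> borel_measurable N"
    if "f \<in> borel_measurable N" "g \<in> borel_measurable N" for f g :: "'x \<Rightarrow> real" and N
    using measurable_compose[OF measurable_Pair[OF that] Fm] by simp
  \<comment> \<open>Coordinates adapted to the lines: \<open>\<Psi> c\<close> is \<open>F\<close> on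
    the line \<open>a + b = c\<close>, parametrised by \<open>a\<close>, and \<open>J c u v\<close>
    integrates it over the segment with \<open>u < a < v\<close>.\<close>
  define \<Psi> where "\<Psi> c \<sigma> = F \<sigma> (c - \<sigma>)" for c \<sigma>
  have \<Psi> [measurable (raw)]: "(\<lambda>x. \<Psi> (f x) (g x)) \<in> borel_measurable N"
    if [measurable]: "f \<in> borel_measurable N" "g \<in> borel_measurable N" for f g :: "'x \<Rightarrow> real" and N
    unfolding \<Psi>_def by measurable
  define J where "J c u v = (\<integral>\<^sup>+\<sigma>\<in>{u<..<v}. \<Psi> c \<sigma> \<partial>lborel)" for c u v
  have Jm [measurable (raw)]: "(\<lambda>x. J (f x) (g x) (k x)) \<in> borel_measurable N"
    if [measurable]: "f \<in> borel_measurable N" "g \<in> borel_measurable N" "k \<in> borel_measurable N"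
    for f g k :: "'x \<Rightarrow> real" and N
  proof -
    \<comment> \<open>The endpoints vary with the argument, so the indicator becomes a condition in
      which they occur as measurable functions.\<close>
    have "J c u v = (\<integral>\<^sup>+\<sigma>. \<Psi> c \<sigma> * (if u < \<sigma> \<and> \<sigma> < v then 1 else 0) \<partial>lborel)" for c u v
      unfolding J_def by (intro nn_integral_cong) (auto simp: indicator_def)
    then show ?thesis by simp
  qed
  have split: "J c u w = J c u v + J c v w" if "u \<le> v" "v \<le> w" for c u v w
    unfolding J_def using that by (intro nn_integral_split) auto
  have fub: "(\<integral>\<^sup>+s\<in>{0<..<t}. (\<integral>\<^sup>+r\<in>{0<..<h}. G s r \<partial>lborel) \<partial>lborel) = (\<integral>\<^sup>+r\<in>{0<..<h}. (\<integral>\<^sup>+s\<in>{0<..<t}. G s r \<partial>lborel) \<partial>lborel)"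
    if [measurable]: "(\<lambda>(s, r). G s r) \<in> borel_measurable (borel \<Otimes>\<^sub>M borel)" for G :: "real \<Rightarrow> real \<Rightarrow> ennreal"
  proof -
    have "(\<integral>\<^sup>+s\<in>{0<..<t}. (\<integral>\<^sup>+r\<in>{0<..<h}. G s r \<partial>lborel) \<partial>lborel)
       = (\<integral>\<^sup>+s. (\<integral>\<^sup>+r. G s r * indicator {0<..<h} r * indicator {0<..<t} s \<partial>lborel) \<partial>lborel)"
      by (intro nn_integral_cong nn_integral_multc[symmetric]) measurable
    also have "\<dots> = (\<integral>\<^sup>+r. (\<integral>\<^sup>+s. G s r * indicator {0<..<h} r * indicator {0<..<t} s \<partial>lborel) \<partial>lborel)"
      by (rule lborel_pair.Fubini') measurable
    also have "\<dots> = (\<integral>\<^sup>+r. (\<integral>\<^sup>+s. G s r * indicator {0<..<t} s * indicator {0<..<h} r \<partial>lborel) \<partial>lborel)"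
      by (simp add: ac_simps)
    also have "\<dots> = (\<integral>\<^sup>+r\<in>{0<..<h}. (\<integral>\<^sup>+s\<in>{0<..<t}. G s r \<partial>lborel) \<partial>lborel)"
      by (intro nn_integral_cong nn_integral_multc) measurable
    finally show ?thesis .
  qed
  \<comment> \<open>For fixed \<open>r\<close>, integration over \<open>s\<close> sweeps out a
    segment: the terms with a shift by \<open>h\<close> lie on the line
    \<open>a + b = t + h + r\<close>, the others on \<open>a + b = t + r\<close>.\<close>
  have I1: "(\<integral>\<^sup>+s\<in>{0<..<t}. F (s + h) (t - s + r) \<partial>lborel) = J (t + h + r) h (t + h)" for r
    using nn_integral_shift[of "\<Psi> (t + h + r)" h 0 t] by (simp add: J_def \<Psi>_def algebra_simps)
  have I2: "(\<integral>\<^sup>+s\<in>{0<..<t}. F (s + r) (t - s) \<partial>lborel) = J (t + r) r (t + r)" for r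
    using nn_integral_shift[of "\<Psi> (t + r)" r 0 t] by (simp add: J_def \<Psi>_def algebra_simps)
  have I3: "(\<integral>\<^sup>+s\<in>{0<..<t}. F (s + r) (t - s + h) \<partial>lborel) = J (t + h + r) r (t + r)" for r
    using nn_integral_shift[of "\<Psi> (t + h + r)" r 0 t] by (simp add: J_def \<Psi>_def algebra_simps)
  have I4: "(\<integral>\<^sup>+s\<in>{0<..<t}. F s (t - s + r) \<partial>lborel) = J (t + r) 0 t" for r
    by (simp add: J_def \<Psi>_def algebra_simps)
  define D where "D = (\<integral>\<^sup>+s\<in>{0<..<t}. (\<integral>\<^sup>+r\<in>{0<..<h}. \<alpha> (s + r) \<partial>lborel) *
      (\<integral>\<^sup>+r\<in>{0<..<h}. \<beta> (t - s + r) \<partial>lborel) \<partial>lborel)"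
  have "(\<integral>\<^sup>+s\<in>{0<..<t}. ((\<integral>\<^sup>+r\<in>{0<..<h}. F (s + h) (t - s + r) \<partial>lborel) + (\<integral>\<^sup>+r\<in>{0<..<h}. F (s + r) (t - s) \<partial>lborel)) \<partial>lborel)
    \<le> (\<integral>\<^sup>+s\<in>{0<..<t}. ((\<integral>\<^sup>+r\<in>{0<..<h}. F (s + r) (t - s + h) \<partial>lborel) + (\<integral>\<^sup>+r\<in>{0<..<h}. F s (t - s + r) \<partial>lborel)
       + C * ((\<integral>\<^sup>+r\<in>{0<..<h}. \<alpha> (s + r) \<partial>lborel) * (\<integral>\<^sup>+r\<in>{0<..<h}. \<beta> (t - s + r) \<partial>lborel))) \<partial>lborel)"
  proof (rule nn_integral_mono)
    fix s
    show "((\<integral>\<^sup>+r\<in>{0<..<h}. F (s + h) (t - s + r) \<partial>lborel) + (\<integral>\<^sup>+r\<in>{0<..<h}. F (s + r) (t - s) \<partial>lborel)) * indicator {0<..<t} s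
     \<le> ((\<integral>\<^sup>+r\<in>{0<..<h}. F (s + r) (t - s + h) \<partial>lborel) + (\<integral>\<^sup>+r\<in>{0<..<h}. F s (t - s + r) \<partial>lborel)
       + C * ((\<integral>\<^sup>+r\<in>{0<..<h}. \<alpha> (s + r) \<partial>lborel) * (\<integral>\<^sup>+r\<in>{0<..<h}. \<beta> (t - s + r) \<partial>lborel))) * indicator {0<..<t} s"
      using step[of s "t - s"] by (cases "s \<in> {0<..<t}") (auto simp: mult.assoc)
  qed
  also have "\<dots> = (\<integral>\<^sup>+s\<in>{0<..<t}. (\<integral>\<^sup>+r\<in>{0<..<h}. F (s + r) (t - s + h) \<partial>lborel) \<partial>lborel)
      + (\<integral>\<^sup>+s\<in>{0<..<t}. (\<integral>\<^sup>+r\<in>{0<..<h}. F s (t - s + r) \<partial>lborel) \<partial>lborel) + C * D"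
    unfolding D_def by (simp add: distrib_right nn_integral_add nn_integral_cmult mult.assoc)
  also have "(\<integral>\<^sup>+s\<in>{0<..<t}. (\<integral>\<^sup>+r\<in>{0<..<h}. F (s + r) (t - s + h) \<partial>lborel) \<partial>lborel)
      = (\<integral>\<^sup>+r\<in>{0<..<h}. J (t + h + r) r (t + r) \<partial>lborel)"
    by (subst fub) (auto simp: I3)
  also have "(\<integral>\<^sup>+s\<in>{0<..<t}. (\<integral>\<^sup>+r\<in>{0<..<h}. F s (t - s + r) \<partial>lborel) \<partial>lborel)
      = (\<integral>\<^sup>+r\<in>{0<..<h}. J (t + r) 0 t \<partial>lborel)"
    by (subst fub) (auto simp: I4)
  also have "(\<integral>\<^sup>+s\<in>{0<..<t}. ((\<integral>\<^sup>+r\<in>{0<..<h}. F (s + h) (t - s + r) \<partial>lborel) + (\<integral>\<^sup>+r\<in>{0<..<h}. F (s + r) (t - s) \<partial>lborel)) \<partial>lborel)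
    = (\<integral>\<^sup>+s\<in>{0<..<t}. (\<integral>\<^sup>+r\<in>{0<..<h}. F (s + h) (t - s + r) \<partial>lborel) \<partial>lborel)
      + (\<integral>\<^sup>+s\<in>{0<..<t}. (\<integral>\<^sup>+r\<in>{0<..<h}. F (s + r) (t - s) \<partial>lborel) \<partial>lborel)"
    by (simp add: distrib_right nn_integral_add)
  also have "(\<integral>\<^sup>+s\<in>{0<..<t}. (\<integral>\<^sup>+r\<in>{0<..<h}. F (s + h) (t - s + r) \<partial>lborel) \<partial>lborel)
      = (\<integral>\<^sup>+r\<in>{0<..<h}. J (t + h + r) h (t + h) \<partial>lborel)"
    by (subst fub) (auto simp: I1)
  also have "(\<integral>\<^sup>+s\<in>{0<..<t}. (\<integral>\<^sup>+r\<in>{0<..<h}. F (s + r) (t - s) \<partial>lborel) \<partial>lborel)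
      = (\<integral>\<^sup>+r\<in>{0<..<h}. J (t + r) r (t + r) \<partial>lborel)"
    by (subst fub) (auto simp: I2)
  finally have ineq: "(\<integral>\<^sup>+r\<in>{0<..<h}. J (t + h + r) h (t + h) \<partial>lborel) + (\<integral>\<^sup>+r\<in>{0<..<h}. J (t + r) r (t + r) \<partial>lborel)
     \<le> (\<integral>\<^sup>+r\<in>{0<..<h}. J (t + h + r) r (t + r) \<partial>lborel) + (\<integral>\<^sup>+r\<in>{0<..<h}. J (t + r) 0 t \<partial>lborel) + C * D" .
  \<comment> \<open>\<open>X\<close> and \<open>Y\<close> collect the segments of the left and the
    right side. On each of the two lines these are translates of one another, so completing both to
    their union adds \<open>Q\<close> to \<open>X\<close> near \<open>(0, t)\<close> and
    \<open>P\<close> to \<open>Y\<close> near \<open>(t, 0)\<close>. Writing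
    \<open>X r + Q r = Y r + P r\<close> avoids differences of possibly infinite quantities.\<close>
  define X where "X r = J (t + h + r) h (t + h) + J (t + r) r (t + r)" for r
  define Y where "Y r = J (t + h + r) r (t + r) + J (t + r) 0 t" for r
  define P where "P r = J (t + h + r) (t + r) (t + h) + J (t + r) t (t + r)" for r
  define Q where "Q r = J (t + h + r) r h + J (t + r) 0 r" for r
  have [measurable]: "X \<in> borel_measurable borel" "Y \<in> borel_measurable borel" "P \<in> borel_measurable borel" "Q \<in> borel_measurable borel"
    unfolding X_def[abs_def] Y_def[abs_def] P_def[abs_def] Q_def[abs_def] by measurable
  have XQ: "X r + Q r = Y r + P r" if "0 < r" "r < h" for r
  proof -
    have "J (t + h + r) r h + J (t + h + r) h (t + h) = J (t + h + r) r (t + r) + J (t + h + r) (t + r) (t + h)"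
      using split[of r h "t + h" "t + h + r"] split[of r "t + r" "t + h" "t + h + r"] that t h by simp
    moreover have "J (t + r) 0 r + J (t + r) r (t + r) = J (t + r) 0 t + J (t + r) t (t + r)"
      using split[of 0 r "t + r" "t + r"] split[of 0 t "t + r" "t + r"] that t by simp
    moreover have "X r + Q r = (J (t + h + r) r h + J (t + h + r) h (t + h)) + (J (t + r) 0 r + J (t + r) r (t + r))"
      unfolding X_def Q_def by (simp add: ac_simps)
    moreover have "Y r + P r = (J (t + h + r) r (t + r) + J (t + h + r) (t + r) (t + h)) + (J (t + r) 0 t + J (t + r) t (t + r))"
      unfolding Y_def P_def by (simp add: ac_simps)
    ultimately show ?thesis by (simp only:)
  qed
  have J_le: "J c u v \<le> K * ennreal (v - u)" if "u \<le> v" "\<And>\<sigma>. u < \<sigma> \<Longrightarrow> \<sigma> < v \<Longrightarrow> \<Psi> c \<sigma> \<le> K" for c u v K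
  proof -
    have "J c u v \<le> (\<integral>\<^sup>+\<sigma>\<in>{u<..<v}. K \<partial>lborel)"
      unfolding J_def using that by (intro nn_integral_mono) (auto simp: indicator_def)
    then show ?thesis using that by (simp only: nn_integral_interval_const)
  qed
  have J_ge: "K * ennreal (v - u) \<le> J c u v" if "u \<le> v" "\<And>\<sigma>. u < \<sigma> \<Longrightarrow> \<sigma> < v \<Longrightarrow> K \<le> \<Psi> c \<sigma>" for c u v K
  proof -
    have "(\<integral>\<^sup>+\<sigma>\<in>{u<..<v}. K \<partial>lborel) \<le> J c u v"
      unfolding J_def using that by (intro nn_integral_mono) (auto simp: indicator_def)
    then show ?thesis using that by (simp only: nn_integral_interval_const)
  qed
  \<comment> \<open>The two end pieces have lengths \<open>h - r\<close> and \<open>r\<close>,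
    together \<open>h\<close> for every \<open>r\<close>; integrating over \<open>r\<close> then
    yields the factor \<open>h\<^sup>2\<close>.\<close>
  have comb: "K * ennreal (h - r) + K * ennreal r = K * ennreal h" if "0 < r" "r < h" for r K
    using that by (simp flip: distrib_left ennreal_plus)
  have P_ge: "L * ennreal h \<le> P r" if r: "0 < r" "r < h" for r
  proof -
    have "L * ennreal ((t + h) - (t + r)) \<le> J (t + h + r) (t + r) (t + h)"
    proof (rule J_ge)
      fix \<sigma> assume "t + r < \<sigma>" "\<sigma> < t + h"
      then show "L \<le> \<Psi> (t + h + r) \<sigma>" using lower[of "\<sigma> - t" "t + h + r - \<sigma>"] r by (simp add: \<Psi>_def)
    qed (use r in auto)
    moreover have "L * ennreal ((t + r) - t) \<le> J (t + r) t (t + r)"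
    proof (rule J_ge)
      fix \<sigma> assume "t < \<sigma>" "\<sigma> < t + r"
      then show "L \<le> \<Psi> (t + r) \<sigma>" using lower[of "\<sigma> - t" "t + r - \<sigma>"] r by (simp add: \<Psi>_def)
    qed (use r in auto)
    ultimately have "L * ennreal (h - r) + L * ennreal r \<le> P r" unfolding P_def by (intro add_mono) simp_all
    then show ?thesis using comb[OF r] by simp
  qed
  have Q_le: "Q r \<le> U * ennreal h" if r: "0 < r" "r < h" for r
  proof -
    have "J (t + h + r) r h \<le> U * ennreal (h - r)"
    proof (rule J_le)
      fix \<sigma> assume "r < \<sigma>" "\<sigma> < h"
      then show "\<Psi> (t + h + r) \<sigma> \<le> U" using upper[of \<sigma> "h + r - \<sigma>"] r by (simp add: \<Psi>_def algebra_simps)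
    qed (use r in auto)
    moreover have "J (t + r) 0 r \<le> U * ennreal (r - 0)"
    proof (rule J_le)
      fix \<sigma> assume "0 < \<sigma>" "\<sigma> < r"
      then show "\<Psi> (t + r) \<sigma> \<le> U" using upper[of \<sigma> "r - \<sigma>"] r by (simp add: \<Psi>_def algebra_simps)
    qed (use r in auto)
    ultimately have "Q r \<le> U * ennreal (h - r) + U * ennreal r" unfolding Q_def by (intro add_mono) simp_all
    then show ?thesis using comb[OF r] by simp
  qed
  \<comment> \<open>A crude bound, wanted for the finiteness that lets \<open>?I Y\<close> be
    cancelled.\<close>
  have Y_le: "Y r \<le> 2 * ennreal B * ennreal t" if r: "0 < r" "r < h" for r
  proof -
    have "J (t + h + r) r (t + r) \<le> ennreal B * ennreal (t + r - r)"
    proof (rule J_le)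
      fix \<sigma> assume "r < \<sigma>" "\<sigma> < t + r"
      then show "\<Psi> (t + h + r) \<sigma> \<le> ennreal B" using B[of \<sigma> "t + h + r - \<sigma>"] r h by (simp add: \<Psi>_def)
    qed (use t in auto)
    moreover have "J (t + r) 0 t \<le> ennreal B * ennreal (t - 0)"
    proof (rule J_le)
      fix \<sigma> assume "0 < \<sigma>" "\<sigma> < t"
      then show "\<Psi> (t + r) \<sigma> \<le> ennreal B" using B[of \<sigma> "t + r - \<sigma>"] r h by (simp add: \<Psi>_def)
    qed (use t in auto)
    ultimately have "Y r \<le> ennreal B * ennreal t + ennreal B * ennreal t" unfolding Y_def by (intro add_mono) simp_all
    then show ?thesis by (simp add: mult_2 distrib_right)
  qed
  let ?I = "\<lambda>G. \<integral>\<^sup>+r\<in>{0<..<h}. G r \<partial>lborel"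
  have add: "?I G + ?I H = (\<integral>\<^sup>+r\<in>{0<..<h}. (G r + H r) \<partial>lborel)"
    if [measurable]: "G \<in> borel_measurable borel" "H \<in> borel_measurable borel" for G H
    by (simp add: distrib_right nn_integral_add)
  have mono: "?I G \<le> ?I H" if "\<And>r. 0 < r \<Longrightarrow> r < h \<Longrightarrow> G r \<le> H r" for G H
    using that by (intro nn_integral_mono) (auto simp: indicator_def)
  have const: "?I (\<lambda>r. K) = K * ennreal h" for K using nn_integral_interval_const[of 0 h K] h by simp
  have XY: "?I X \<le> ?I Y + C * D"
    using ineq unfolding X_def Y_def by (simp add: add)
  have "?I Y + ?I P = ?I (\<lambda>r. Y r + P r)" by (rule add) auto
  also have "\<dots> \<le> ?I (\<lambda>r. X r + Q r)" using XQ by (intro mono) auto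
  also have "\<dots> = ?I X + ?I Q" by (rule add[symmetric]) auto
  also have "\<dots> \<le> ?I Y + C * D + ?I Q" using XY by (rule add_right_mono)
  finally have "?I Y + ?I P \<le> ?I Y + (C * D + ?I Q)" by (simp add: add.assoc)
  moreover have "?I Y \<noteq> \<infinity>"
  proof -
    have "?I Y \<le> ?I (\<lambda>r. 2 * ennreal B * ennreal t)" using Y_le by (intro mono) auto
    also have "\<dots> = 2 * ennreal B * ennreal t * ennreal h" by (rule const)
    also have "\<dots> < \<infinity>" by (auto simp: ennreal_mult_less_top)
    finally show ?thesis by simp
  qed
  ultimately have PQ: "?I P \<le> C * D + ?I Q" by (simp add: ennreal_add_left_cancel_le)
  have "L * ennreal h * ennreal h = ?I (\<lambda>r. L * ennreal h)" by (rule const[symmetric])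
  also have "\<dots> \<le> ?I P" using P_ge by (intro mono) auto
  also note PQ
  also have "?I Q \<le> ?I (\<lambda>r. U * ennreal h)" using Q_le by (intro mono) auto
  also have "\<dots> = U * ennreal h * ennreal h" by (rule const)
  finally show ?thesis by (simp add: D_def add_left_mono)
qed

lemma ennreal_mult_right_le_cancel:
  fixes x y :: ennreal
  assumes "x * ennreal h \<le> y * ennreal h" "0 < h"
  shows "x \<le> y"
  using divide_right_mono_ennreal[OF assms(1), of "ennreal h"] assms(2)
  by (simp add: ennreal_mult_divide_eq)

text \<open>Division of the integrated step by \<open>h\<^sup>2\<close> turns the double integral
  into a convolution of averages, whose limit is known. \<open>F0\<close> and \<open>F1\<close>
  stand for the boundary values of \<open>F\<close> at \<open>(t, 0)\<close> and
  \<open>(0, t)\<close>; they enter through one-sided estimates because \<open>F\<close> is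
  controlled for positive arguments only.\<close>

lemma diagonal_inequality:
  fixes F :: "real \<Rightarrow> real \<Rightarrow> ennreal" and C F0 F1 B :: real
  assumes Fm: "(\<lambda>(a, b). F a b) \<in> borel_measurable (borel \<Otimes>\<^sub>M borel)"
    and [measurable]: "\<alpha> \<in> borel_measurable borel" "\<beta> \<in> borel_measurable borel"
    and t: "0 < t" and nn: "0 \<le> F1" "0 \<le> C"
    and B: "\<And>a b. 0 < a \<Longrightarrow> a < t + 2 \<Longrightarrow> 0 < b \<Longrightarrow> b < t + 2 \<Longrightarrow> F a b \<le> ennreal B"
      "\<And>s. 0 < s \<Longrightarrow> s < t + 1 \<Longrightarrow> \<alpha> s \<le> ennreal B" "\<And>s. 0 < s \<Longrightarrow> s < t + 1 \<Longrightarrow> \<beta> s \<le> ennreal B"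
    and step: "\<And>a b h. 0 < a \<Longrightarrow> a < t \<Longrightarrow> 0 < b \<Longrightarrow> b < t \<Longrightarrow> 0 < h \<Longrightarrow> h < 1 \<Longrightarrow>
       (\<integral>\<^sup>+r\<in>{0<..<h}. F (a + h) (b + r) \<partial>lborel) + (\<integral>\<^sup>+r\<in>{0<..<h}. F (a + r) b \<partial>lborel)
       \<le> (\<integral>\<^sup>+r\<in>{0<..<h}. F (a + r) (b + h) \<partial>lborel) + (\<integral>\<^sup>+r\<in>{0<..<h}. F a (b + r) \<partial>lborel)
         + ennreal C * (\<integral>\<^sup>+r\<in>{0<..<h}. \<alpha> (a + r) \<partial>lborel) * (\<integral>\<^sup>+r\<in>{0<..<h}. \<beta> (b + r) \<partial>lborel)"
    and lower: "\<And>e. 0 < e \<Longrightarrow> \<exists>d>0. \<forall>a b. 0 < a \<and> a < d \<and> 0 < b \<and> b < d \<longrightarrow> ennreal (F0 - e) \<le> F (t + a) b"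
    and upper: "\<And>e. 0 < e \<Longrightarrow> \<exists>d>0. \<forall>a b. 0 < a \<and> a < d \<and> 0 < b \<and> b < d \<longrightarrow> F a (t + b) \<le> ennreal (F1 + e)"
  shows "ennreal F0 \<le> ennreal F1 + ennreal C * (\<integral>\<^sup>+s\<in>{0<..<t}. \<alpha> s * \<beta> (t - s) \<partial>lborel)"
proof -
  define I where "I = (\<integral>\<^sup>+s\<in>{0<..<t}. \<alpha> s * \<beta> (t - s) \<partial>lborel)"
  have "I \<le> (\<integral>\<^sup>+s\<in>{0<..<t}. ennreal B * ennreal B \<partial>lborel)"
    unfolding I_def
  proof (rule nn_integral_mono)
    fix s show "\<alpha> s * \<beta> (t - s) * indicator {0<..<t} s \<le> ennreal B * ennreal B * indicator {0<..<t} s"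
      using B(2)[of s] B(3)[of "t - s"] by (cases "s \<in> {0<..<t}") (auto intro!: mult_mono)
  qed
  also have "\<dots> = ennreal B * ennreal B * ennreal t"
    using t nn_integral_interval_const[of 0 t] by simp
  also have "\<dots> < \<infinity>" by (auto simp: ennreal_mult_less_top)
  finally obtain i where i: "I = ennreal i" "0 \<le> i" by (cases I rule: ennreal_cases) auto
  have main: "ennreal (F0 - e) \<le> ennreal C * I + ennreal (F1 + e)" if e: "0 < e" for e
  proof -
    obtain d1 where d1: "d1 > 0" "\<forall>a b. 0 < a \<and> a < d1 \<and> 0 < b \<and> b < d1 \<longrightarrow> ennreal (F0 - e) \<le> F (t + a) b"
      using lower[OF e] by blast
    obtain d2 where d2: "d2 > 0" "\<forall>a b. 0 < a \<and> a < d2 \<and> 0 < b \<and> b < d2 \<longrightarrow> F a (t + b) \<le> ennreal (F1 + e)"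
      using upper[OF e] by blast
    define d where "d = min 1 (min d1 d2)"
    have d: "0 < d" "d \<le> 1" "d \<le> d1" "d \<le> d2" using d1 d2 by (auto simp: d_def)
    \<comment> \<open>With \<open>n + 2\<close> in the denominator every \<open>h n\<close> is
      strictly below \<open>d\<close>, hence below 1 and inside both neighbourhoods.\<close>
    define h where "h n = d * inverse (real (Suc (Suc n)))" for n
    have hd: "h n < d" for n
      using d mult_strict_left_mono[of "inverse (real (Suc (Suc n)))" 1 d] by (simp add: h_def inverse_less_1_iff)
    have h: "0 < h n" "h n < 1" for n using d hd[of n] by (simp add: h_def, linarith)
    have h0: "h \<longlonglongrightarrow> 0"
      unfolding h_def[abs_def]
      by (rule tendsto_mult_right_zero) (rule LIMSEQ_Suc[OF LIMSEQ_inverse_real_of_nat])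
    define A where "A n = (\<integral>\<^sup>+s\<in>{0<..<t}. ((\<integral>\<^sup>+r\<in>{0<..<h n}. \<alpha> (s + r) \<partial>lborel) / ennreal (h n)) *
      ((\<integral>\<^sup>+r\<in>{0<..<h n}. \<beta> (t - s + r) \<partial>lborel) / ennreal (h n)) \<partial>lborel)" for n
    have A: "A \<longlonglongrightarrow> I"
      unfolding A_def[abs_def] I_def
      by (rule convolution_of_averages_tendsto[where B = B]) (use t B h h0 in auto)
    have "ennreal (F0 - e) \<le> ennreal C * A n + ennreal (F1 + e)" for n
    proof -
      have div: "x / ennreal (h n) * ennreal (h n) = x" for x
        using h[of n] by (simp add: ennreal_divide_times mult_divide_eq_ennreal)
      have "(\<integral>\<^sup>+s\<in>{0<..<t}. (\<integral>\<^sup>+r\<in>{0<..<h n}. \<alpha> (s + r) \<partial>lborel) *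
         (\<integral>\<^sup>+r\<in>{0<..<h n}. \<beta> (t - s + r) \<partial>lborel) \<partial>lborel) =
         (\<integral>\<^sup>+s. ((\<integral>\<^sup>+r\<in>{0<..<h n}. \<alpha> (s + r) \<partial>lborel) / ennreal (h n)) *
      ((\<integral>\<^sup>+r\<in>{0<..<h n}. \<beta> (t - s + r) \<partial>lborel) / ennreal (h n)) * indicator {0<..<t} s * (ennreal (h n) * ennreal (h n)) \<partial>lborel)"
      proof (rule nn_integral_cong)
        fix s
        have "x / ennreal (h n) * (y / ennreal (h n)) * z * (ennreal (h n) * ennreal (h n)) = x * y * z" for x y z
          using div[of x] div[of y] by (metis (no_types, lifting) mult.assoc mult.commute)
        then show "(\<integral>\<^sup>+r\<in>{0<..<h n}. \<alpha> (s + r) \<partial>lborel) * (\<integral>\<^sup>+r\<in>{0<..<h n}. \<beta> (t - s + r) \<partial>lborel) * indicator {0<..<t} s =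
         ((\<integral>\<^sup>+r\<in>{0<..<h n}. \<alpha> (s + r) \<partial>lborel) / ennreal (h n)) *
      ((\<integral>\<^sup>+r\<in>{0<..<h n}. \<beta> (t - s + r) \<partial>lborel) / ennreal (h n)) * indicator {0<..<t} s * (ennreal (h n) * ennreal (h n))" by simp
      qed
      also have "\<dots> = A n * (ennreal (h n) * ennreal (h n))"
        unfolding A_def by (rule nn_integral_multc) measurable
      finally have D: "(\<integral>\<^sup>+s\<in>{0<..<t}. (\<integral>\<^sup>+r\<in>{0<..<h n}. \<alpha> (s + r) \<partial>lborel) *
         (\<integral>\<^sup>+r\<in>{0<..<h n}. \<beta> (t - s + r) \<partial>lborel) \<partial>lborel) = A n * (ennreal (h n) * ennreal (h n))" .
      have "ennreal (F0 - e) * ennreal (h n) * ennreal (h n) \<le>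
          ennreal C * (A n * (ennreal (h n) * ennreal (h n))) + ennreal (F1 + e) * ennreal (h n) * ennreal (h n)"
        unfolding D[symmetric]
      proof (rule diagonal_step_integrated[OF Fm _ _ t h B(1)])
        fix a b assume ab: "0 < a" "a < h n" "0 < b" "b < h n"
        have lt: "a < d1" "b < d1" "a < d2" "b < d2" using ab hd[of n] d by auto
        show "ennreal (F0 - e) \<le> F (t + a) b" using d1(2) ab lt by blast
        show "F a (t + b) \<le> ennreal (F1 + e)" using d2(2) ab lt by blast
      qed (use step h in auto)
      then have "ennreal (F0 - e) * ennreal (h n) * ennreal (h n) \<le> (ennreal C * A n + ennreal (F1 + e)) * ennreal (h n) * ennreal (h n)"
        by (simp add: distrib_right mult.assoc)
      then have "ennreal (F0 - e) * ennreal (h n) \<le> (ennreal C * A n + ennreal (F1 + e)) * ennreal (h n)"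
        by (rule ennreal_mult_right_le_cancel) (rule h)
      then show ?thesis by (rule ennreal_mult_right_le_cancel) (rule h)
    qed
    moreover have "(\<lambda>n. ennreal C * A n + ennreal (F1 + e)) \<longlonglongrightarrow> ennreal C * I + ennreal (F1 + e)"
      by (intro tendsto_add ennreal_tendsto_cmult A tendsto_const) auto
    ultimately show ?thesis by (intro LIMSEQ_le_const) auto
  qed
  \<comment> \<open>The error \<open>e\<close> is removed among the real numbers, which is possible
    because the limit \<open>I\<close> is the finite number \<open>i\<close>.\<close>
  have "F0 \<le> F1 + C * i"
  proof (rule field_le_epsilon)
    fix e :: real assume e: "0 < e"
    have "ennreal (F0 - e / 2) \<le> ennreal (C * i + (F1 + e / 2))"
      using main[of "e / 2"] e nn i by (simp add: ennreal_mult ennreal_plus)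
    moreover have "0 \<le> C * i + (F1 + e / 2)" using nn i e by auto
    ultimately have "F0 - e / 2 \<le> C * i + (F1 + e / 2)" by (simp add: ennreal_le_iff)
    then show "F0 \<le> F1 + C * i + e" by simp
  qed
  then have "ennreal F0 \<le> ennreal (F1 + C * i)" by (rule ennreal_leI)
  then show ?thesis using nn i by (simp add: I_def[symmetric] ennreal_mult ennreal_plus)
qed

section \<open>Positive semigroups on the space of square integrable functions\<close>

lemma Lp2_abs:
  assumes "u \<in> Lp M 2"
  shows "(\<lambda>x. \<bar>u x\<bar>) \<in> Lp M 2" "Lp_norm M 2 (\<lambda>x. \<bar>u x\<bar>) = Lp_norm M 2 u"
proof -
  have [measurable]: "u \<in> borel_measurable M" using assms by (rule Lp_measurable)
  show "(\<lambda>x. \<bar>u x\<bar>) \<in> Lp M 2" using assms by (auto simp: Lp2_iff)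
  show "Lp_norm M 2 (\<lambda>x. \<bar>u x\<bar>) = Lp_norm M 2 u" by (simp add: Lp_norm_def)
qed

text \<open>The majorant is the square root of the sum of the squares of the \<open>w n\<close>: its
  square has integral equal to the sum of the squared norms, so monotone convergence alone shows
  that it lies in \<open>L\<^sub>2\<close>.\<close>

lemma Lp2_suminf_bound:
  fixes w :: "nat \<Rightarrow> 'a \<Rightarrow> real"
  assumes w: "\<And>n. w n \<in> Lp M 2" "\<And>n. Lp_norm M 2 (w n) \<le> (1 / 2) ^ n"
  obtains v where "v \<in> Lp M 2" "\<And>x. 0 \<le> v x" "\<And>n. AE x in M. w n x \<le> v x"
proof -
  have [measurable]: "w n \<in> borel_measurable M" for n using w(1) by (rule Lp_measurable)
  define V where "V x = (\<Sum>n. ennreal ((w n x)\<^sup>2))" for x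
  have [measurable]: "V \<in> borel_measurable M" unfolding V_def[abs_def] by measurable
  have "(\<integral>\<^sup>+x. V x \<partial>M) = (\<Sum>n. \<integral>\<^sup>+x. ennreal ((w n x)\<^sup>2) \<partial>M)"
    unfolding V_def by (rule nn_integral_suminf) measurable
  also have "\<dots> \<le> (\<Sum>n. ennreal ((1 / 2) ^ n))"
  proof (rule suminf_le)
    fix n
    have "(Lp_norm M 2 (w n))\<^sup>2 \<le> ((1 / 2) ^ n)\<^sup>2" using w(2)[of n] Lp_norm_nonneg[OF w(1)[of n]] by (rule power_mono)
    also have "\<dots> = (1 / 4) ^ n" by (simp add: power2_eq_square flip: power_mult_distrib)
    also have "\<dots> \<le> (1 / 2) ^ n" by (rule power_mono) auto
    finally show "(\<integral>\<^sup>+x. ennreal ((w n x)\<^sup>2) \<partial>M) \<le> ennreal ((1 / 2) ^ n)"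
      using w by (simp add: nn_integral_square_Lp2 ennreal_leI)
  qed auto
  also have "\<dots> = ennreal (\<Sum>n. (1 / 2) ^ n)" by (intro suminf_ennreal2) (auto intro!: summable_geometric)
  also have "\<dots> < \<infinity>" by simp
  finally have fin: "(\<integral>\<^sup>+x. V x \<partial>M) < \<infinity>" .
  then have AE_fin: "AE x in M. V x \<noteq> \<infinity>" by (intro nn_integral_PInf_AE) auto
  define v where "v x = sqrt (enn2real (V x))" for x
  have [measurable]: "v \<in> borel_measurable M" unfolding v_def[abs_def] by measurable
  have "(\<integral>\<^sup>+x. ennreal ((v x)\<^sup>2) \<partial>M) = (\<integral>\<^sup>+x. V x \<partial>M)"
    by (rule nn_integral_cong_AE, use AE_fin in eventually_elim) (auto simp: v_def less_top)
  then have "v \<in> Lp M 2" using fin by (simp add: Lp2_iff)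
  moreover have "AE x in M. w n x \<le> v x" for n
    using AE_fin
  proof eventually_elim
    case (elim x)
    have "ennreal ((w n x)\<^sup>2) \<le> (\<Sum>i\<in>{n}. ennreal ((w i x)\<^sup>2))" by simp
    also have "\<dots> \<le> V x" unfolding V_def by (rule sum_le_suminf) auto
    finally have "(w n x)\<^sup>2 \<le> enn2real (V x)"
      using elim by (metis enn2real_ennreal enn2real_mono infinity_ennreal_def less_top zero_le_power2)
    then show "w n x \<le> v x" unfolding v_def by (rule real_le_rsqrt)
  qed
  ultimately show thesis by (intro that[of v]) (auto simp: v_def)
qed

locale positive_L2_semigroup = sigma_finite_measure M for M :: "'a measure" +
  fixes W :: "real \<Rightarrow> ('a \<Rightarrow> real) \<Rightarrow> 'a \<Rightarrow> real"
  assumes C0: "C0_semigroup_on_Lp M 2 W" and positive: "positive_semigroup_on_Lp M 2 W"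
begin

abbreviation "L2 \<equiv> Lp M 2"
abbreviation "nrm \<equiv> Lp_norm M 2"

lemma W_L2: "0 \<le> t \<Longrightarrow> u \<in> L2 \<Longrightarrow> W t u \<in> L2"
  using C0 unfolding C0_semigroup_on_Lp_def bounded_operator_on_Lp_def by blast

lemma W_add: "0 \<le> t \<Longrightarrow> u \<in> L2 \<Longrightarrow> v \<in> L2 \<Longrightarrow> AE x in M. W t (\<lambda>y. u y + v y) x = W t u x + W t v x"
  using C0 unfolding C0_semigroup_on_Lp_def bounded_operator_on_Lp_def by blast

lemma W_cmult: "0 \<le> t \<Longrightarrow> u \<in> L2 \<Longrightarrow> AE x in M. W t (\<lambda>y. c * u y) x = c * W t u x"
  using C0 unfolding C0_semigroup_on_Lp_def bounded_operator_on_Lp_def by blast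

lemma W_0: "u \<in> L2 \<Longrightarrow> AE x in M. W 0 u x = u x"
  using C0 unfolding C0_semigroup_on_Lp_def by blast

lemma W_semigroup: "0 \<le> s \<Longrightarrow> 0 \<le> t \<Longrightarrow> u \<in> L2 \<Longrightarrow> AE x in M. W (s + t) u x = W s (W t u) x"
  using C0 unfolding C0_semigroup_on_Lp_def by blast

lemma W_tendsto: "u \<in> L2 \<Longrightarrow> ((\<lambda>t. nrm (\<lambda>x. W t u x - u x)) \<longlongrightarrow> 0) (at_right 0)"
  using C0 unfolding C0_semigroup_on_Lp_def by blast

lemma W_nonneg: "0 \<le> t \<Longrightarrow> u \<in> L2 \<Longrightarrow> AE x in M. 0 \<le> u x \<Longrightarrow> AE x in M. 0 \<le> W t u x"
  using positive unfolding positive_semigroup_on_Lp_def by blast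

lemma W_bound:
  assumes "0 \<le> t"
  obtains K where "0 \<le> K" "\<And>u. u \<in> L2 \<Longrightarrow> nrm (W t u) \<le> K * nrm u"
proof -
  have "bounded_operator_on_Lp M 2 (W t)"
    using C0 assms unfolding C0_semigroup_on_Lp_def by blast
  then have "\<exists>K. \<forall>u\<in>L2. nrm (W t u) \<le> K * nrm u"
    unfolding bounded_operator_on_Lp_def by (elim conjE)
  then obtain K where K: "\<And>u. u \<in> L2 \<Longrightarrow> nrm (W t u) \<le> K * nrm u"
    by auto
  show thesis
  proof (rule that[of "max 0 K"])
    fix u assume u: "u \<in> L2"
    have "K * nrm u \<le> max 0 K * nrm u" using Lp_norm_nonneg[OF u] by (intro mult_right_mono) auto
    then show "nrm (W t u) \<le> max 0 K * nrm u" using K[OF u] by simp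
  qed simp
qed

lemma W_diff:
  assumes "0 \<le> t" "u \<in> L2" "v \<in> L2"
  shows "AE x in M. W t (\<lambda>y. u y - v y) x = W t u x - W t v x"
proof -
  have "AE x in M. W t (\<lambda>y. u y + - 1 * v y) x = W t u x + W t (\<lambda>y. - 1 * v y) x"
    using assms by (intro W_add Lp2_cmult)
  moreover have "AE x in M. W t (\<lambda>y. - 1 * v y) x = - 1 * W t v x"
    using assms by (intro W_cmult)
  ultimately show ?thesis by eventually_elim simp
qed

lemma W_mono:
  assumes "0 \<le> t" "u \<in> L2" "v \<in> L2" "AE x in M. u x \<le> v x"
  shows "AE x in M. W t u x \<le> W t v x"
proof -
  have "AE x in M. 0 \<le> W t (\<lambda>y. v y - u y) x"
    using assms by (intro W_nonneg Lp2_diff) auto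
  with W_diff[OF assms(1,3,2)] show ?thesis by eventually_elim simp
qed

lemma W_abs_le:
  assumes "0 \<le> t" "u \<in> L2"
  shows "AE x in M. \<bar>W t u x\<bar> \<le> W t (\<lambda>y. \<bar>u y\<bar>) x"
proof -
  note a = Lp2_abs(1)[OF assms(2)]
  have "AE x in M. W t u x \<le> W t (\<lambda>y. \<bar>u y\<bar>) x"
    by (rule W_mono[OF assms a]) auto
  moreover have "AE x in M. W t (\<lambda>y. - 1 * u y) x \<le> W t (\<lambda>y. \<bar>u y\<bar>) x"
    by (rule W_mono[OF assms(1) Lp2_cmult(1)[OF assms(2)] a]) auto
  moreover note W_cmult[OF assms, of "- 1"]
  ultimately show ?thesis by eventually_elim auto
qed

lemma nrm_cong: "u \<in> L2 \<Longrightarrow> v \<in> L2 \<Longrightarrow> AE x in M. u x = v x \<Longrightarrow> nrm u = nrm v"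
  by (intro antisym Lp_mono(2)) auto

lemma W_cmult_nrm:
  assumes "0 \<le> t" "u \<in> L2"
  shows "nrm (W t (\<lambda>y. c * u y)) = \<bar>c\<bar> * nrm (W t u)"
proof -
  have "nrm (W t (\<lambda>y. c * u y)) = nrm (\<lambda>x. c * W t u x)"
    using assms by (intro nrm_cong W_L2 Lp2_cmult W_cmult)
  then show ?thesis using assms by (simp add: Lp2_cmult W_L2)
qed

text \<open>The filter \<open>at_right 0\<close> leaves out \<open>t = 0\<close>, which is added
  here so that time increments may vanish.\<close>

lemma W_near_0:
  assumes "u \<in> L2" "0 < e"
  obtains d where "0 < d" "\<And>t. 0 \<le> t \<Longrightarrow> t < d \<Longrightarrow> nrm (\<lambda>x. W t u x - u x) < e"
proof -
  have "\<forall>\<^sub>F t in at_right 0. nrm (\<lambda>x. W t u x - u x) < e"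
    using order_tendstoD(2)[OF W_tendsto[OF assms(1)] assms(2)] .
  then obtain d where d: "0 < d" "\<And>t. 0 < t \<Longrightarrow> t < d \<Longrightarrow> nrm (\<lambda>x. W t u x - u x) < e"
    by (auto simp: eventually_at_right_field)
  have "nrm (\<lambda>x. W 0 u x - u x) = nrm (\<lambda>x. 0 * u x)"
    using W_0[OF assms(1)] by (intro nrm_cong Lp2_diff W_L2 assms Lp2_cmult) auto
  also have "\<dots> = 0" using Lp2_cmult(2)[OF assms(1), of 0] by simp
  finally have "nrm (\<lambda>x. W 0 u x - u x) < e" using assms by simp
  with d show thesis by (intro that[of d]) (auto simp: le_less)
qed

text \<open>A gliding hump argument: by positivity, a function that dominates all the humps is bad
  at all the exceptional times.\<close>

lemma W_bounded_near_0:
  "\<exists>d>0. \<exists>K\<ge>0. \<forall>t u. 0 \<le> t \<longrightarrow> t \<le> d \<longrightarrow> u \<in> L2 \<longrightarrow> nrm (W t u) \<le> K * nrm u"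
proof (rule ccontr)
  assume contr: "\<not> ?thesis"
  then have ex: "\<exists>t u. 0 \<le> t \<and> t \<le> d \<and> u \<in> L2 \<and> K * nrm u < nrm (W t u)" if "0 < d" "0 \<le> K" for d K
    using contr that by (meson linorder_not_le)
  \<comment> \<open>The factor \<open>2 ^ n\<close> is used up when the hump is scaled to norm
    \<open>(1 / 2) ^ n\<close>; the factor \<open>n + 1\<close> remains and makes the norms of the
    images unbounded.\<close>
  define K where "K n = real (Suc n) * 2 ^ n" for n
  have "\<forall>n. \<exists>t u. 0 \<le> t \<and> t \<le> inverse (real (Suc n)) \<and> u \<in> L2 \<and> K n * nrm u < nrm (W t u)"
    by (intro allI ex) (auto simp: K_def)
  then obtain t u where tu: "\<And>n. 0 \<le> t n" "\<And>n. t n \<le> inverse (real (Suc n))" "\<And>n. u n \<in> L2" "\<And>n. K n * nrm (u n) < nrm (W (t n) (u n))"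
    by metis
  \<comment> \<open>Each single operator is bounded, so a hump of norm 0 would have an image of norm
    0.\<close>
  have pos: "0 < nrm (u n)" for n
  proof (rule ccontr)
    assume "\<not> 0 < nrm (u n)"
    then have "nrm (u n) = 0" using Lp_norm_nonneg[OF tu(3)[of n]] by auto
    moreover obtain K' where "nrm (W (t n) (u n)) \<le> K' * nrm (u n)"
      using W_bound[OF tu(1)[of n]] tu(3)[of n] by metis
    ultimately show False using tu(4)[of n] by simp
  qed
  define c where "c n = (1 / 2) ^ n / nrm (u n)" for n
  have c: "0 < c n" for n using pos by (simp add: c_def)
  define w where "w n x = c n * \<bar>u n x\<bar>" for n x
  have wL: "w n \<in> L2" for n unfolding w_def by (intro Lp2_cmult Lp2_abs tu)
  have wn: "nrm (w n) = (1 / 2) ^ n" for n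
  proof -
    have "nrm (w n) = \<bar>c n\<bar> * nrm (u n)"
      unfolding w_def using Lp2_cmult(2)[OF Lp2_abs(1)[OF tu(3)[of n]]] Lp2_abs(2)[OF tu(3)[of n]] by simp
    then show ?thesis using c[of n] pos[of n] by (simp add: c_def)
  qed
  \<comment> \<open>One majorant of all humps. By positivity \<open>W (t n) v\<close> dominates
    \<open>W (t n) (w n)\<close>, which in turn dominates the image of the scaled
    \<open>u n\<close>, so the single orbit of \<open>v\<close> is large at every
    \<open>t n\<close>.\<close>
  obtain v where v: "v \<in> L2" "\<And>x. 0 \<le> v x" "\<And>n. AE x in M. w n x \<le> v x"
    using Lp2_suminf_bound[of w M] wL wn by (metis order_refl)
  have big: "real (Suc n) < nrm (W (t n) v)" for n
  proof -
    have "real (Suc n) = c n * (K n * nrm (u n))"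
      using pos[of n] by (simp add: c_def K_def field_simps power_divide)
    also have "\<dots> < c n * nrm (W (t n) (u n))" using c tu(4) by (intro mult_strict_left_mono)
    also have "\<dots> \<le> c n * nrm (W (t n) (\<lambda>x. \<bar>u n x\<bar>))"
    proof (rule mult_left_mono)
      have L: "W (t n) (\<lambda>x. \<bar>u n x\<bar>) \<in> L2" using tu(1) Lp2_abs(1)[OF tu(3)] by (rule W_L2)
      have m: "W (t n) (u n) \<in> borel_measurable M" using W_L2[OF tu(1) tu(3)] by (rule Lp_measurable)
      have "AE x in M. \<bar>W (t n) (u n) x\<bar> \<le> \<bar>W (t n) (\<lambda>x. \<bar>u n x\<bar>) x\<bar>"
        using W_abs_le[OF tu(1)[of n] tu(3)[of n]] by eventually_elim simp
      then show "nrm (W (t n) (u n)) \<le> nrm (W (t n) (\<lambda>x. \<bar>u n x\<bar>))"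
        by (rule Lp_mono(2)[OF _ _ L m, rotated 2]) auto
    qed (use c[of n] in simp)
    also have "\<dots> = nrm (W (t n) (w n))"
      unfolding w_def using W_cmult_nrm[OF tu(1) Lp2_abs(1)[OF tu(3)]] c[of n] by simp
    also have "\<dots> \<le> nrm (W (t n) v)"
    proof -
      have L: "W (t n) v \<in> L2" using tu(1) v(1) by (rule W_L2)
      have m: "W (t n) (w n) \<in> borel_measurable M" using W_L2[OF tu(1) wL] by (rule Lp_measurable)
      have "AE x in M. 0 \<le> W (t n) (w n) x"
        using c by (intro W_nonneg tu wL) (auto simp: w_def less_imp_le)
      with W_mono[OF tu(1)[of n] wL[of n] v(1) v(3)[of n]]
      have "AE x in M. \<bar>W (t n) (w n) x\<bar> \<le> \<bar>W (t n) v x\<bar>" by eventually_elim simp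
      then show ?thesis by (rule Lp_mono(2)[OF _ _ L m, rotated 2]) auto
    qed
    finally show ?thesis .
  qed
  obtain d where d: "0 < d" "\<And>t. 0 \<le> t \<Longrightarrow> t < d \<Longrightarrow> nrm (\<lambda>x. W t v x - v x) < 1"
    using W_near_0[OF v(1), of 1] by auto
  obtain m where m: "inverse (real (Suc m)) < d" using reals_Archimedean[OF d(1)] by auto
  obtain l where l: "2 + 2 * (nrm v)\<^sup>2 \<le> real l" using real_arch_simple by blast
  \<comment> \<open>\<open>m\<close> brings \<open>t n\<close> into the range where
    \<open>W (t n) v\<close> is within 1 of \<open>v\<close>, which bounds the square of its norm by
    \<open>2 + 2 * (nrm v)\<^sup>2\<close>, and \<open>l\<close> makes this at most
    \<open>n\<close>. But that square exceeds \<open>(n + 1)\<^sup>2\<close>.\<close>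
  define n where "n = max m l"
  have "inverse (real (Suc n)) \<le> inverse (real (Suc m))" by (simp add: n_def)
  then have "t n < d" using tu(2)[of n] m by linarith
  then have near: "nrm (\<lambda>x. W (t n) v x - v x) < 1" using d(2) tu(1) by auto
  have "(nrm (W (t n) v))\<^sup>2 = (nrm (\<lambda>x. (W (t n) v x - v x) + v x))\<^sup>2" by simp
  also have "\<dots> \<le> 2 * (nrm (\<lambda>x. W (t n) v x - v x))\<^sup>2 + 2 * (nrm v)\<^sup>2"
    using tu v by (intro Lp2_add Lp2_diff W_L2)
  also have "(nrm (\<lambda>x. W (t n) v x - v x))\<^sup>2 \<le> 1"
    using near Lp_norm_nonneg[OF Lp2_diff(1)[OF W_L2[OF tu(1) v(1)] v(1)]] by (simp add: power_le_one)
  finally have "(nrm (W (t n) v))\<^sup>2 \<le> 2 + 2 * (nrm v)\<^sup>2" by simp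
  also have "\<dots> \<le> real n" using l by (simp add: n_def)
  also have "\<dots> < real (Suc n) * 1" by simp
  also have "\<dots> \<le> (real (Suc n))\<^sup>2" unfolding power2_eq_square by (rule mult_left_mono) auto
  also have "\<dots> < (nrm (W (t n) v))\<^sup>2" using big[of n] by (intro power_strict_mono) auto
  finally have "(nrm (W (t n) v))\<^sup>2 < (nrm (W (t n) v))\<^sup>2" .
  then show False by simp
qed

text \<open>The semigroup law carries the bound near 0 to longer intervals, one step of length
  \<open>d\<close> at a time.\<close>

lemma W_locally_bounded:
  obtains K where "0 \<le> K" "\<And>t u. 0 \<le> t \<Longrightarrow> t \<le> \<tau> \<Longrightarrow> u \<in> L2 \<Longrightarrow> nrm (W t u) \<le> K * nrm u"
proof -
  obtain d K where d: "0 < d" and K: "0 \<le> K" "\<And>t u. 0 \<le> t \<Longrightarrow> t \<le> d \<Longrightarrow> u \<in> L2 \<Longrightarrow> nrm (W t u) \<le> K * nrm u"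
    using W_bounded_near_0 by blast
  have ind: "\<exists>B\<ge>0. \<forall>t u. 0 \<le> t \<longrightarrow> t \<le> real (Suc n) * d \<longrightarrow> u \<in> L2 \<longrightarrow> nrm (W t u) \<le> B * nrm u" for n
  proof (induction n)
    case 0
    show ?case using K by (intro exI[of _ K]) auto
  next
    case (Suc n)
    then obtain B where B: "0 \<le> B" "\<And>t u. 0 \<le> t \<Longrightarrow> t \<le> real (Suc n) * d \<Longrightarrow> u \<in> L2 \<Longrightarrow> nrm (W t u) \<le> B * nrm u"
      by blast
    \<comment> \<open>\<open>K\<close> may be below 1, so the new constant has to cover the old
      range as well as the prolonged one.\<close>
    show ?case
    proof (intro exI[of _ "max B (B * K)"] conjI allI impI)
      fix t u assume t: "0 \<le> t" "t \<le> real (Suc (Suc n)) * d" and u: "u \<in> L2"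
      show "nrm (W t u) \<le> max B (B * K) * nrm u"
      proof (cases "t \<le> d")
        case True
        then have "t \<le> real (Suc n) * d" using d by (simp add: algebra_simps add_increasing2)
        then have "nrm (W t u) \<le> B * nrm u" using B t u by auto
        also have "\<dots> \<le> max B (B * K) * nrm u" using Lp_norm_nonneg[OF u] by (intro mult_right_mono) auto
        finally show ?thesis .
      next
        case False
        have "AE x in M. W ((t - d) + d) u x = W (t - d) (W d u) x"
          using False d u by (intro W_semigroup) auto
        then have "nrm (W t u) = nrm (W (t - d) (W d u))"
          using False d u t by (intro nrm_cong W_L2) auto
        also have "\<dots> \<le> B * nrm (W d u)" using False t d u by (intro B W_L2) (auto simp: algebra_simps)
        also have "\<dots> \<le> B * (K * nrm u)" using d u B by (intro mult_left_mono K) auto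
        also have "\<dots> \<le> max B (B * K) * nrm u"
          using Lp_norm_nonneg[OF u] by (simp add: mult.assoc[symmetric] mult_right_mono)
        finally show ?thesis .
      qed
    qed (use B in auto)
  qed
  obtain n where "\<tau> / d \<le> real n" using real_arch_simple by blast
  then have "\<tau> \<le> real (Suc n) * d" using d by (simp add: field_simps)
  moreover obtain B where "B \<ge> 0" "\<forall>t u. 0 \<le> t \<longrightarrow> t \<le> real (Suc n) * d \<longrightarrow> u \<in> L2 \<longrightarrow> nrm (W t u) \<le> B * nrm u"
    using ind[of n] by blast
  ultimately show thesis by (intro that[of B]) auto
qed

lemma W_right_continuous:
  assumes "0 \<le> c" "u \<in> L2" "0 < e"
  obtains d where "0 < d" "\<And>s. 0 \<le> s \<Longrightarrow> s < d \<Longrightarrow> nrm (\<lambda>x. W (c + s) u x - W c u x) < e"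
proof -
  obtain K where K: "0 \<le> K" "\<And>u. u \<in> L2 \<Longrightarrow> nrm (W c u) \<le> K * nrm u" using W_bound[OF assms(1)] by metis
  \<comment> \<open>\<open>K\<close> may be 0, hence the shift by 1.\<close>
  have "0 < e / (K + 1)" using K assms by auto
  from W_near_0[OF assms(2) this] obtain d where d: "0 < d" "\<And>t. 0 \<le> t \<Longrightarrow> t < d \<Longrightarrow> nrm (\<lambda>x. W t u x - u x) < e / (K + 1)"
    by metis
  have "nrm (\<lambda>x. W (c + s) u x - W c u x) < e" if s: "0 \<le> s" "s < d" for s
  proof -
    have WL: "W s u \<in> L2" using s assms by (intro W_L2)
    have "AE x in M. W (c + s) u x - W c u x = W c (\<lambda>y. W s u y - u y) x"
      using W_semigroup[OF assms(1) s(1) assms(2)] W_diff[OF assms(1) WL assms(2)]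
      by eventually_elim simp
    then have "nrm (\<lambda>x. W (c + s) u x - W c u x) = nrm (W c (\<lambda>y. W s u y - u y))"
      using assms s WL by (intro nrm_cong W_L2 Lp2_diff) auto
    also have "\<dots> \<le> K * nrm (\<lambda>y. W s u y - u y)" using WL assms by (intro K Lp2_diff)
    also have "\<dots> \<le> K * (e / (K + 1))" using d(2)[OF s] K by (intro mult_left_mono) auto
    also have "\<dots> < e" using K assms by (simp add: field_simps)
    finally show ?thesis .
  qed
  with d(1) show thesis by (rule that)
qed

end

section \<open>Semigroups with a kernel\<close>

locale kernel_semigroup = positive_L2_semigroup M W
  for M :: "'a measure" and W :: "real \<Rightarrow> ('a \<Rightarrow> real) \<Rightarrow> 'a \<Rightarrow> real" +
  fixes p p' :: ennreal and k :: "real \<Rightarrow> 'a \<Rightarrow> 'a \<Rightarrow> real"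
  assumes p: "1 \<le> p" "p < \<infinity>" "1 / p + 1 / p' = 1"
    and acts: "acts_on_Lp M p W" and has_kernel: "has_kernel_on_Lp M p W k"
begin

sublocale MM: pair_sigma_finite M M ..

text \<open>Extending by 0 to \<open>t \<le> 0\<close> gives a function that is measurable in all
  real times. Passing to \<open>ennreal\<close> discards the negative part, which for each
  \<open>t > 0\<close> vanishes almost everywhere by \<open>kernel_nonneg\<close>.\<close>

definition K :: "real \<Rightarrow> 'a \<Rightarrow> 'a \<Rightarrow> ennreal" where
  "K t x y = (if 0 < t then ennreal (k t x y) else 0)"

lemma k_measurable:
  assumes f: "f \<in> borel_measurable N" and g: "g \<in> N \<rightarrow>\<^sub>M M" and h: "h \<in> N \<rightarrow>\<^sub>M M"
  shows "(\<lambda>x. if 0 < f x then k (f x) (g x) (h x) else 0) \<in> borel_measurable N"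
proof -
  have m: "(\<lambda>(t, x, y). k t x y) \<in> borel_measurable (restrict_space borel {0<..} \<Otimes>\<^sub>M (M \<Otimes>\<^sub>M M))"
    using has_kernel unfolding has_kernel_on_Lp_def by blast
  \<comment> \<open>Joint measurability of \<open>k\<close> is available for positive times only.
    The value 1 is an arbitrary positive substitute; the result is overwritten by 0
    afterwards.\<close>
  have "(\<lambda>x. if 0 < f x then f x else 1) \<in> N \<rightarrow>\<^sub>M restrict_space borel {0<..}"
    using f by (intro measurable_restrict_space2) auto
  then have "(\<lambda>x. (if 0 < f x then f x else 1, g x, h x)) \<in> N \<rightarrow>\<^sub>M restrict_space borel {0<..} \<Otimes>\<^sub>M (M \<Otimes>\<^sub>M M)"
    by (intro measurable_Pair g h)
  from measurable_compose[OF this m]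
  have [measurable]: "(\<lambda>x. k (if 0 < f x then f x else 1) (g x) (h x)) \<in> borel_measurable N" by simp
  note f[measurable]
  have "(\<lambda>x. if 0 < f x then k (if 0 < f x then f x else 1) (g x) (h x) else 0) \<in> borel_measurable N"
    by measurable
  moreover have "(\<lambda>x. if 0 < f x then k (if 0 < f x then f x else 1) (g x) (h x) else 0)
      = (\<lambda>x. if 0 < f x then k (f x) (g x) (h x) else 0)" by auto
  ultimately show ?thesis by simp
qed

lemma K_measurable [measurable (raw)]:
  assumes "f \<in> borel_measurable N" "g \<in> N \<rightarrow>\<^sub>M M" "h \<in> N \<rightarrow>\<^sub>M M"
  shows "(\<lambda>x. K (f x) (g x) (h x)) \<in> borel_measurable N"
proof -
  have "(\<lambda>x. ennreal (if 0 < f x then k (f x) (g x) (h x) else 0)) \<in> borel_measurable N"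
    using k_measurable[OF assms] by measurable
  moreover have "ennreal (if 0 < f x then k (f x) (g x) (h x) else 0) = K (f x) (g x) (h x)" for x
    by (simp add: K_def)
  ultimately show ?thesis by simp
qed

lemma kernel_representation:
  assumes "0 < t" "u \<in> L2" "u \<in> Lp M p"
  shows "AE x in M. integrable M (\<lambda>y. k t x y * u y) \<and> W t u x = (LINT y|M. k t x y * u y)"
  using has_kernel assms unfolding has_kernel_on_Lp_def by blast

text \<open>Positivity is given for the operators and has to be derived for the kernel. Applied to
  an indicator it says that the integral of the negative part of \<open>k t x\<close> over
  \<open>B\<close> is at most that of the positive part, for all \<open>x\<close> outside a null set
  that depends on \<open>B\<close>. Integrated over \<open>x \<in> A\<close> this becomes an
  inequality on rectangles, where the dependence on \<open>B\<close> does no harm.\<close>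

lemma kernel_nonneg:
  assumes t: "0 < t"
  shows "AE z in M \<Otimes>\<^sub>M M. 0 \<le> k t (fst z) (snd z)"
proof -
  have [measurable]: "(\<lambda>x. k t (g x) (h x)) \<in> borel_measurable N"
    if "g \<in> N \<rightarrow>\<^sub>M M" "h \<in> N \<rightarrow>\<^sub>M M" for g h and N :: "'x measure"
    using k_measurable[of "\<lambda>_. t" N g h] that t by simp
  obtain E :: "nat \<Rightarrow> 'a set" where E [measurable]: "\<And>n. E n \<in> sets M" and fin: "\<And>n. emeasure M (E n) < \<infinity>"
    and inc: "incseq E" "(\<Union>n. E n) = space M"
    using truncation_sets[of "\<lambda>_. 0"] by auto
  have ind: "(\<lambda>x. indicator A x :: real) \<in> Lp M s" if "A \<in> sets M" "emeasure M A < \<infinity>" "1 \<le> s" for A s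
    by (rule bounded_finite_support_Lp[of _ _ A 1]) (use that in auto)
  define g where "g m x = (\<integral>\<^sup>+y. ennreal \<bar>k t x y\<bar> * indicator (E m) y \<partial>M)" for m x
  have [measurable]: "g m \<in> borel_measurable M" for m unfolding g_def[abs_def] using t by measurable
  \<comment> \<open>The rectangle lemma needs finite integrals. On \<open>X n m \<times> E m\<close>
    the absolute value of the kernel has integral at most \<open>n\<close> times the measure of
    \<open>E n\<close>.\<close>
  define X where "X n m = {x \<in> space M. x \<in> E n \<and> g m x \<le> ennreal (real n)}" for n m
  have X [measurable]: "X n m \<in> sets M" for n m unfolding X_def by measurable
  have loc: "AE z in M \<Otimes>\<^sub>M M. z \<in> X n m \<times> E m \<longrightarrow> ennreal (- k t (fst z) (snd z)) \<le> ennreal (k t (fst z) (snd z))" for n m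
  proof (rule MM.AE_le_of_rectangles)
    have bd: "(\<integral>\<^sup>+z. G z * indicator (X n m \<times> E m) z \<partial>(M \<Otimes>\<^sub>M M)) < \<infinity>"
      if [measurable]: "G \<in> borel_measurable (M \<Otimes>\<^sub>M M)" and G: "\<And>z. G z \<le> ennreal \<bar>k t (fst z) (snd z)\<bar>" for G
    proof -
      have "(\<integral>\<^sup>+z. G z * indicator (X n m \<times> E m) z \<partial>(M \<Otimes>\<^sub>M M))
        = (\<integral>\<^sup>+x. \<integral>\<^sup>+y. G (x, y) * indicator (X n m \<times> E m) (x, y) \<partial>M \<partial>M)"
        by (subst nn_integral_fst[symmetric]) auto
      also have "\<dots> \<le> (\<integral>\<^sup>+x. ennreal (real n) * indicator (E n) x \<partial>M)"
      proof (rule nn_integral_mono)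
        fix x
        show "(\<integral>\<^sup>+y. G (x, y) * indicator (X n m \<times> E m) (x, y) \<partial>M) \<le> ennreal (real n) * indicator (E n) x"
        proof (cases "x \<in> X n m")
          case True
          have "(\<integral>\<^sup>+y. G (x, y) * indicator (X n m \<times> E m) (x, y) \<partial>M) \<le> g m x"
            unfolding g_def using G[of "(x, _)"] by (intro nn_integral_mono) (auto simp: indicator_def)
          with True show ?thesis by (auto simp: X_def)
        qed (simp add: indicator_def)
      qed
      also have "\<dots> < \<infinity>" using fin by (simp add: nn_integral_cmult ennreal_mult_less_top)
      finally show ?thesis .
    qed
    show "(\<integral>\<^sup>+z. ennreal (- k t (fst z) (snd z)) * indicator (X n m \<times> E m) z \<partial>(M \<Otimes>\<^sub>M M)) < \<infinity>"
      by (rule bd) (use t in \<open>auto intro!: ennreal_leI\<close>)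
    show "(\<integral>\<^sup>+z. ennreal (k t (fst z) (snd z)) * indicator (X n m \<times> E m) z \<partial>(M \<Otimes>\<^sub>M M)) < \<infinity>"
      by (rule bd) (use t in \<open>auto intro!: ennreal_leI\<close>)
    fix A B assume [measurable]: "A \<in> sets M" "B \<in> sets M" and sub: "A \<subseteq> X n m" "B \<subseteq> E m"
    have "emeasure M B \<le> emeasure M (E m)" using sub by (intro emeasure_mono) auto
    then have Bfin: "emeasure M B < \<infinity>" using fin[of m] by (rule le_less_trans)
    have B: "indicator B \<in> L2" "indicator B \<in> Lp M p" using ind[of B] Bfin p by auto
    have rect: "(\<integral>\<^sup>+z. H z * indicator (A \<times> B) z \<partial>(M \<Otimes>\<^sub>M M)) = (\<integral>\<^sup>+x. (\<integral>\<^sup>+y. H (x, y) * indicator B y \<partial>M) * indicator A x \<partial>M)"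
      if [measurable]: "H \<in> borel_measurable (M \<Otimes>\<^sub>M M)" for H :: "_ \<Rightarrow> ennreal"
    proof -
      have "(\<integral>\<^sup>+z. H z * indicator (A \<times> B) z \<partial>(M \<Otimes>\<^sub>M M)) = (\<integral>\<^sup>+x. \<integral>\<^sup>+y. H (x, y) * indicator (A \<times> B) (x, y) \<partial>M \<partial>M)"
        by (subst nn_integral_fst[symmetric]) auto
      also have "\<dots> = (\<integral>\<^sup>+x. \<integral>\<^sup>+y. H (x, y) * indicator B y * indicator A x \<partial>M \<partial>M)"
        by (intro nn_integral_cong) (auto simp: indicator_def)
      also have "\<dots> = (\<integral>\<^sup>+x. (\<integral>\<^sup>+y. H (x, y) * indicator B y \<partial>M) * indicator A x \<partial>M)"
        by (intro nn_integral_cong nn_integral_multc) measurable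
      finally show ?thesis .
    qed
    have "AE x in M. (\<integral>\<^sup>+y. ennreal (- k t x y) * indicator B y \<partial>M) \<le> (\<integral>\<^sup>+y. ennreal (k t x y) * indicator B y \<partial>M)"
    proof -
      have "AE x in M. 0 \<le> W t (indicator B) x" using t B by (intro W_nonneg) auto
      with kernel_representation[OF t B] show ?thesis
      proof eventually_elim
        case (elim x)
        let ?h = "\<lambda>y. k t x y * indicator B y"
        have fin: "(\<integral>\<^sup>+y. ennreal (?h y) \<partial>M) \<noteq> \<infinity>" "(\<integral>\<^sup>+y. ennreal (- ?h y) \<partial>M) \<noteq> \<infinity>"
          and eq: "(LINT y|M. ?h y) = enn2real (\<integral>\<^sup>+y. ennreal (?h y) \<partial>M) - enn2real (\<integral>\<^sup>+y. ennreal (- ?h y) \<partial>M)"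
          using elim(1) by (auto simp: real_integrable_def real_lebesgue_integral_def)
        have "enn2real (\<integral>\<^sup>+y. ennreal (- ?h y) \<partial>M) \<le> enn2real (\<integral>\<^sup>+y. ennreal (?h y) \<partial>M)"
          using elim eq by auto
        then have "(\<integral>\<^sup>+y. ennreal (- ?h y) \<partial>M) \<le> (\<integral>\<^sup>+y. ennreal (?h y) \<partial>M)"
          using fin by (metis ennreal_enn2real ennreal_leI infinity_ennreal_def less_top)
        moreover have "(\<integral>\<^sup>+y. ennreal (- ?h y) \<partial>M) = (\<integral>\<^sup>+y. ennreal (- k t x y) * indicator B y \<partial>M)"
          "(\<integral>\<^sup>+y. ennreal (?h y) \<partial>M) = (\<integral>\<^sup>+y. ennreal (k t x y) * indicator B y \<partial>M)"
          by (auto intro!: nn_integral_cong simp: indicator_def)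
        ultimately show ?case by simp
      qed
    qed
    then have "(\<integral>\<^sup>+x. (\<integral>\<^sup>+y. ennreal (- k t x y) * indicator B y \<partial>M) * indicator A x \<partial>M)
      \<le> (\<integral>\<^sup>+x. (\<integral>\<^sup>+y. ennreal (k t x y) * indicator B y \<partial>M) * indicator A x \<partial>M)"
      by (intro nn_integral_mono_AE, eventually_elim) (rule mult_right_mono, auto)
    then show "(\<integral>\<^sup>+z. ennreal (- k t (fst z) (snd z)) * indicator (A \<times> B) z \<partial>(M \<Otimes>\<^sub>M M))
       \<le> (\<integral>\<^sup>+z. ennreal (k t (fst z) (snd z)) * indicator (A \<times> B) z \<partial>(M \<Otimes>\<^sub>M M))"
      using t by (subst (1 2) rect) auto
  qed (use t X E in auto)
  have "AE x in M. \<forall>m. g m x \<noteq> \<infinity>"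
  proof (subst AE_all_countable, intro allI)
    fix m
    have i: "indicator (E m) \<in> L2" "indicator (E m) \<in> Lp M p" using ind[OF E fin] p by auto
    show "AE x in M. g m x \<noteq> \<infinity>"
      using kernel_representation[OF t i]
    proof eventually_elim
      case (elim x)
      then have "(\<integral>\<^sup>+y. ennreal (norm (k t x y * indicator (E m) y)) \<partial>M) < \<infinity>"
        by (simp add: integrable_iff_bounded)
      also have "(\<integral>\<^sup>+y. ennreal (norm (k t x y * indicator (E m) y)) \<partial>M) = g m x"
        unfolding g_def by (intro nn_integral_cong) (auto simp: indicator_def)
      finally show ?case by simp
    qed
  qed
  \<comment> \<open>Integrability of the kernel over \<open>E m\<close> makes \<open>g m x\<close>
    finite, so almost every \<open>x\<close> lies in some \<open>X n m\<close>.\<close>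
  with AE_space have cover: "AE x in M. \<forall>m. \<exists>n. x \<in> X n m"
  proof eventually_elim
    case (elim x)
    show ?case
    proof
      fix m
      obtain i where i: "x \<in> E i" using elim inc by blast
      obtain j where j: "enn2real (g m x) \<le> real j" using real_arch_simple by blast
      define n where "n = max i j"
      have "E i \<subseteq> E n" using inc(1) by (simp add: n_def incseqD)
      then have "x \<in> E n" using i by blast
      moreover have "g m x \<le> ennreal (real n)"
      proof -
        have "g m x = ennreal (enn2real (g m x))" using elim by (simp add: less_top)
        also have "\<dots> \<le> ennreal (real n)" using j by (intro ennreal_leI) (simp add: n_def)
        finally show ?thesis .
      qed
      ultimately show "\<exists>n. x \<in> X n m" using elim by (auto simp: X_def)
    qed
  qed
  have "AE z in M \<Otimes>\<^sub>M M. \<forall>m. \<exists>n. fst z \<in> X n m"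
    by (rule MM.AE_pair_measure) (use cover in auto)
  moreover have "AE z in M \<Otimes>\<^sub>M M. \<forall>n m. z \<in> X n m \<times> E m \<longrightarrow> ennreal (- k t (fst z) (snd z)) \<le> ennreal (k t (fst z) (snd z))"
    by (subst AE_all_countable, intro allI, subst AE_all_countable, intro allI loc)
  ultimately show ?thesis using AE_space
  proof eventually_elim
    case (elim z)
    have "snd z \<in> space M" using elim(3) by (auto simp: space_pair_measure)
    then obtain m where m: "snd z \<in> E m" using inc(2) by blast
    obtain n where n: "fst z \<in> X n m" using elim(1) by blast
    have "z \<in> X n m \<times> E m" using m n by (cases z) auto
    then have "ennreal (- k t (fst z) (snd z)) \<le> ennreal (k t (fst z) (snd z))" using elim(2) by blast
    \<comment> \<open>At a point where the kernel is negative the right-hand side would be 0 and the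
      left-hand side positive.\<close>
    then show ?case by (cases "0 \<le> k t (fst z) (snd z)") (auto simp: ennreal_neg)
  qed
qed

lemma kernel_nonneg_AE_AE:
  assumes "0 < t"
  shows "AE x in M. AE y in M. 0 \<le> k t x y"
  using MM.AE_pair[OF kernel_nonneg[OF assms]] by simp


text \<open>
  Versions of \<open>t \<mapsto> W t u\<close> and of the dual orbit that are jointly measurable in time and space, so
  that they can be integrated over time pointwise.
\<close>

definition orb :: "('a \<Rightarrow> real) \<Rightarrow> real \<Rightarrow> 'a \<Rightarrow> ennreal" where
  "orb u t x = (\<integral>\<^sup>+y. K t x y * ennreal (u y) \<partial>M)"

definition dual_orb :: "('a \<Rightarrow> real) \<Rightarrow> real \<Rightarrow> 'a \<Rightarrow> ennreal" where
  "dual_orb v t y = (\<integral>\<^sup>+x. K t x y * ennreal (v x) \<partial>M)"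

lemma orb_measurable [measurable (raw)]:
  assumes [measurable]: "u \<in> borel_measurable M" "f \<in> borel_measurable N" "g \<in> N \<rightarrow>\<^sub>M M"
  shows "(\<lambda>x. orb u (f x) (g x)) \<in> borel_measurable N"
  unfolding orb_def by measurable

lemma dual_orb_measurable [measurable (raw)]:
  assumes [measurable]: "v \<in> borel_measurable M" "f \<in> borel_measurable N" "g \<in> N \<rightarrow>\<^sub>M M"
  shows "(\<lambda>x. dual_orb v (f x) (g x)) \<in> borel_measurable N"
  unfolding dual_orb_def by measurable

text \<open>Tonelli's theorem. All values lie in \<open>[0, \<infinity>]\<close>, so the adjoint
  relation also covers functions outside \<open>L\<^sub>2\<close>, such as \<open>f\<close> and
  \<open>g'\<close> later on.\<close>

lemma orb_dual_orb:
  assumes [measurable]: "u \<in> borel_measurable M" "v \<in> borel_measurable M"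
  shows "(\<integral>\<^sup>+x. orb u t x * ennreal (v x) \<partial>M) = (\<integral>\<^sup>+y. ennreal (u y) * dual_orb v t y \<partial>M)"
proof -
  have "(\<integral>\<^sup>+x. orb u t x * ennreal (v x) \<partial>M) = (\<integral>\<^sup>+x. (\<integral>\<^sup>+y. K t x y * ennreal (u y) * ennreal (v x) \<partial>M) \<partial>M)"
    unfolding orb_def by (intro nn_integral_cong nn_integral_multc[symmetric]) measurable
  also have "\<dots> = (\<integral>\<^sup>+y. (\<integral>\<^sup>+x. K t x y * ennreal (u y) * ennreal (v x) \<partial>M) \<partial>M)"
    by (rule MM.Fubini'[symmetric]) measurable
  also have "\<dots> = (\<integral>\<^sup>+y. (\<integral>\<^sup>+x. ennreal (u y) * (K t x y * ennreal (v x)) \<partial>M) \<partial>M)"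
    by (simp add: ac_simps)
  also have "\<dots> = (\<integral>\<^sup>+y. ennreal (u y) * dual_orb v t y \<partial>M)"
    unfolding dual_orb_def by (intro nn_integral_cong nn_integral_cmult) measurable
  finally show ?thesis .
qed

lemma orb_eq_W_Lp:
  assumes t: "0 < t" and u: "u \<in> L2" "u \<in> Lp M p" "AE x in M. 0 \<le> u x"
  shows "AE x in M. orb u t x = ennreal (W t u x)"
  using kernel_representation[OF t u(1,2)] kernel_nonneg_AE_AE[OF t]
proof eventually_elim
  case (elim x)
  have "orb u t x = (\<integral>\<^sup>+y. ennreal (k t x y * u y) \<partial>M)"
    unfolding orb_def using t
    by (intro nn_integral_cong_AE, use elim(2) u(3) in eventually_elim) (auto simp: K_def ennreal_mult)
  also have "\<dots> = ennreal (LINT y|M. k t x y * u y)"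
    by (rule nn_integral_eq_integral) (use elim(1) in simp, use elim(2) u(3) in eventually_elim, simp)
  finally show ?case using elim(1) by simp
qed

text \<open>Both modes of convergence are used: equality from some index on for dominated
  convergence in \<open>L\<^sub>2\<close>, and monotonicity in \<open>ennreal\<close> for monotone
  convergence of \<open>orb\<close>. Being in every \<open>L\<^sub>s\<close> at once, the
  \<open>w n\<close> admit the kernel representation.\<close>

lemma truncation:
  fixes u :: "'a \<Rightarrow> real"
  assumes "u \<in> borel_measurable M"
  obtains w :: "nat \<Rightarrow> 'a \<Rightarrow> real"
  where "\<And>n s. 1 \<le> s \<Longrightarrow> w n \<in> Lp M s" "\<And>n x. \<bar>w n x\<bar> \<le> \<bar>u x\<bar>" "\<And>n x. 0 \<le> u x \<Longrightarrow> 0 \<le> w n x"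
    "\<And>x. x \<in> space M \<Longrightarrow> \<forall>\<^sub>F n in sequentially. w n x = u x" "\<And>x. incseq (\<lambda>n. ennreal (w n x))"
    "\<And>x. x \<in> space M \<Longrightarrow> (SUP n. ennreal (w n x)) = ennreal (u x)"
proof -
  note [measurable] = assms
  obtain E :: "nat \<Rightarrow> 'a set" where E [measurable]: "\<And>n. E n \<in> sets M" and fin: "\<And>n. emeasure M (E n) < \<infinity>"
    and bd: "\<And>n x. x \<in> E n \<Longrightarrow> \<bar>u x\<bar> \<le> real n" and inc: "incseq E" "(\<Union>n. E n) = space M"
    using truncation_sets[OF assms] by metis
  define w where "w n x = u x * indicator (E n) x" for n x
  have ev: "\<forall>\<^sub>F n in sequentially. w n x = u x" if x: "x \<in> space M" for x
  proof -
    obtain i where i: "x \<in> E i" using x inc(2) by blast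
    have "w n x = u x" if "i \<le> n" for n
    proof -
      have "x \<in> E n" using i incseqD[OF inc(1) that] by blast
      then show ?thesis by (simp add: w_def)
    qed
    then show ?thesis unfolding eventually_sequentially by blast
  qed
  have incw: "incseq (\<lambda>n. ennreal (w n x))" for x
  proof (rule incseq_SucI)
    fix n
    have "E n \<subseteq> E (Suc n)" using inc(1) by (simp add: incseq_SucD)
    then show "ennreal (w n x) \<le> ennreal (w (Suc n) x)" by (auto simp: w_def indicator_def)
  qed
  show thesis
  proof (rule that[of w])
    show "w n \<in> Lp M s" if "1 \<le> s" for n s
      by (rule bounded_finite_support_Lp[OF _ E[of n] fin _ that, of _ "real n"])
        (use bd[of _ n] in \<open>auto simp: w_def[abs_def] indicator_def\<close>)
    show "(SUP n. ennreal (w n x)) = ennreal (u x)" if "x \<in> space M" for x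
    proof (rule LIMSEQ_unique[OF LIMSEQ_SUP[OF incw]])
      show "(\<lambda>n. ennreal (w n x)) \<longlonglongrightarrow> ennreal (u x)"
        by (rule tendsto_eventually) (use ev[OF that] in eventually_elim, simp)
    qed
  qed (use ev incw in \<open>auto simp: w_def indicator_def\<close>)
qed

lemma orb_truncation_SUP:
  assumes [measurable]: "\<And>n. w n \<in> borel_measurable M" and inc: "\<And>x. incseq (\<lambda>n. ennreal (w n x))"
    and S: "\<And>x. x \<in> space M \<Longrightarrow> (SUP n. ennreal (w n x)) = ennreal (u x)" and x: "x \<in> space M"
  shows "orb u t x = (SUP n. orb (w n) t x)"
proof -
  have "orb u t x = (\<integral>\<^sup>+y. (SUP n. K t x y * ennreal (w n y)) \<partial>M)"
    unfolding orb_def by (intro nn_integral_cong) (simp add: SUP_mult_left_ennreal[symmetric] S)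
  also have "\<dots> = (SUP n. orb (w n) t x)"
    unfolding orb_def
    by (intro nn_integral_monotone_convergence_SUP)
      (use inc x in \<open>auto simp: incseq_def le_fun_def intro!: mult_left_mono\<close>)
  finally show ?thesis .
qed

text \<open>The kernel is known to represent \<open>W t\<close> on
  \<open>L\<^sub>2 \<inter> L\<^sub>p\<close> only. Along truncations \<open>orb\<close> increases
  to \<open>orb u\<close>, and positivity keeps it below \<open>W t u\<close>. The gap is at most
  the image of the truncation error, which tends to 0 in \<open>L\<^sub>2\<close>.\<close>

lemma orb_eq_W:
  assumes t: "0 < t" and u: "u \<in> L2" "AE x in M. 0 \<le> u x"
  shows "AE x in M. orb u t x = ennreal (W t u x)"
proof -
  have [measurable]: "u \<in> borel_measurable M" using u(1) by (rule Lp_measurable)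
  obtain w :: "nat \<Rightarrow> 'a \<Rightarrow> real" where w: "\<And>n s. 1 \<le> s \<Longrightarrow> w n \<in> Lp M s" "\<And>n x. \<bar>w n x\<bar> \<le> \<bar>u x\<bar>" "\<And>n x. 0 \<le> u x \<Longrightarrow> 0 \<le> w n x"
    "\<And>x. x \<in> space M \<Longrightarrow> \<forall>\<^sub>F n in sequentially. w n x = u x" "\<And>x. incseq (\<lambda>n. ennreal (w n x))"
    "\<And>x. x \<in> space M \<Longrightarrow> (SUP n. ennreal (w n x)) = ennreal (u x)"
    using truncation[OF \<open>u \<in> borel_measurable M\<close>] by blast
  have wL: "w n \<in> L2" "w n \<in> Lp M p" for n using w(1) p by auto
  have wm [measurable]: "w n \<in> borel_measurable M" for n using wL(1) by (rule Lp_measurable)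
  have w_nn: "AE x in M. 0 \<le> w n x" for n using u(2) by eventually_elim (rule w(3))
  have W_nn: "AE x in M. 0 \<le> W t u x" using t u by (intro W_nonneg) auto
  have pt: "AE x in M. \<forall>n. orb (w n) t x = ennreal (W t (w n) x) \<and> 0 \<le> W t (w n) x \<and> W t (w n) x \<le> W t u x"
  proof (subst AE_all_countable, intro allI)
    fix n
    have "AE x in M. w n x \<le> u x" using u(2)
    proof eventually_elim
      case (elim x)
      then show ?case using w(2)[of n x] by linarith
    qed
    then have "AE x in M. W t (w n) x \<le> W t u x" using t by (intro W_mono wL u) auto
    moreover have "AE x in M. 0 \<le> W t (w n) x" using t by (intro W_nonneg wL w_nn) auto
    moreover note orb_eq_W_Lp[OF t wL w_nn]
    ultimately show "AE x in M. orb (w n) t x = ennreal (W t (w n) x) \<and> 0 \<le> W t (w n) x \<and> W t (w n) x \<le> W t u x"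
      by eventually_elim auto
  qed
  have bounds: "AE x in M. orb u t x \<le> ennreal (W t u x) \<and> (\<forall>n. W t (w n) x \<le> enn2real (orb u t x))"
    using pt AE_space
  proof eventually_elim
    case (elim x)
    have S: "orb u t x = (SUP n. orb (w n) t x)"
      using orb_truncation_SUP[OF wm w(5,6) elim(2)] by simp
    have le: "orb u t x \<le> ennreal (W t u x)"
      unfolding S using elim by (intro SUP_least) (auto intro: ennreal_leI)
    have "W t (w n) x \<le> enn2real (orb u t x)" for n
    proof -
      have "ennreal (W t (w n) x) \<le> orb u t x" unfolding S using elim by (metis SUP_upper UNIV_I)
      moreover have "orb u t x < \<infinity>" using le by (rule le_less_trans) simp
      ultimately show ?thesis using elim(1) by (metis enn2real_ennreal enn2real_mono infinity_ennreal_def)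
    qed
    with le show ?case by blast
  qed
  obtain B where B: "0 \<le> B" "\<And>u. u \<in> L2 \<Longrightarrow> nrm (W t u) \<le> B * nrm u" using W_bound[of t] t by (metis less_imp_le)
  \<comment> \<open>The gap does not depend on \<open>n\<close>, but it is bounded by
    \<open>W t\<close> applied to \<open>u - w n\<close> for every \<open>n\<close>.\<close>
  define g where "g x = W t u x - enn2real (orb u t x)" for x
  have [measurable]: "W t u \<in> borel_measurable M" using W_L2[of t u] t u Lp_measurable by auto
  have [measurable]: "g \<in> borel_measurable M" unfolding g_def[abs_def] by measurable
  have gn: "(\<integral>\<^sup>+x. ennreal ((g x)\<^sup>2) \<partial>M) \<le> ennreal (B\<^sup>2) * (\<integral>\<^sup>+x. ennreal ((u x - w n x)\<^sup>2) \<partial>M)" for n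
  proof -
    have dL: "(\<lambda>x. u x - w n x) \<in> L2" using u wL by (intro Lp2_diff)
    have "(\<integral>\<^sup>+x. ennreal ((g x)\<^sup>2) \<partial>M) \<le> (\<integral>\<^sup>+x. ennreal ((W t (\<lambda>x. u x - w n x) x)\<^sup>2) \<partial>M)"
    proof (rule nn_integral_mono_AE)
      have "AE x in M. W t (\<lambda>x. u x - w n x) x = W t u x - W t (w n) x"
        using t u wL by (intro W_diff) auto
      with bounds W_nn show "AE x in M. ennreal ((g x)\<^sup>2) \<le> ennreal ((W t (\<lambda>x. u x - w n x) x)\<^sup>2)"
      proof eventually_elim
        case (elim x)
        have "enn2real (orb u t x) \<le> W t u x" using elim by (simp add: enn2real_leI)
        then have "0 \<le> g x" unfolding g_def by simp
        moreover have "g x \<le> W t (\<lambda>x. u x - w n x) x" using elim by (simp add: g_def)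
        ultimately show ?case by (intro ennreal_leI power_mono)
      qed
    qed
    also have "\<dots> = ennreal ((nrm (W t (\<lambda>x. u x - w n x)))\<^sup>2)" using t dL by (intro nn_integral_square_Lp2 W_L2) auto
    also have "\<dots> \<le> ennreal ((B * nrm (\<lambda>x. u x - w n x))\<^sup>2)"
      by (intro ennreal_leI power_mono B dL Lp_norm_nonneg W_L2) (use t in auto)
    also have "\<dots> = ennreal (B\<^sup>2) * ennreal ((nrm (\<lambda>x. u x - w n x))\<^sup>2)"
      by (simp add: power_mult_distrib ennreal_mult)
    also have "ennreal ((nrm (\<lambda>x. u x - w n x))\<^sup>2) = (\<integral>\<^sup>+x. ennreal ((u x - w n x)\<^sup>2) \<partial>M)"
      using dL by (rule nn_integral_square_Lp2[symmetric])
    finally show ?thesis .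
  qed
  have "(\<lambda>n. \<integral>\<^sup>+x. ennreal ((u x - w n x)\<^sup>2) \<partial>M) \<longlonglongrightarrow> (\<integral>\<^sup>+x. 0 \<partial>M)"
  proof (rule nn_integral_dominated_convergence[where w = "\<lambda>x. ennreal (4 * (u x)\<^sup>2)"])
    show "AE x in M. ennreal ((u x - w n x)\<^sup>2) \<le> ennreal (4 * (u x)\<^sup>2)" for n
    proof (rule AE_I2, rule ennreal_leI)
      fix x
      have "\<bar>u x - w n x\<bar> \<le> \<bar>2 * u x\<bar>" using w(2)[of n x] by linarith
      then have "(u x - w n x)\<^sup>2 \<le> (2 * u x)\<^sup>2" by (simp only: abs_le_square_iff)
      then show "(u x - w n x)\<^sup>2 \<le> 4 * (u x)\<^sup>2" by (simp add: power_mult_distrib)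
    qed
    show "(\<integral>\<^sup>+x. ennreal (4 * (u x)\<^sup>2) \<partial>M) < \<infinity>"
      using u(1) by (simp add: ennreal_mult nn_integral_cmult nn_integral_square_Lp2 ennreal_mult_less_top)
    show "AE x in M. (\<lambda>n. ennreal ((u x - w n x)\<^sup>2)) \<longlonglongrightarrow> 0"
    proof (rule AE_I2)
      fix x assume "x \<in> space M"
      from w(4)[OF this] show "(\<lambda>n. ennreal ((u x - w n x)\<^sup>2)) \<longlonglongrightarrow> 0"
        by (intro tendsto_eventually, eventually_elim) simp
    qed
  qed auto
  then have "(\<lambda>n. ennreal (B\<^sup>2) * (\<integral>\<^sup>+x. ennreal ((u x - w n x)\<^sup>2) \<partial>M)) \<longlonglongrightarrow> ennreal (B\<^sup>2) * 0"
    by (intro ennreal_tendsto_cmult) auto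
  then have "(\<integral>\<^sup>+x. ennreal ((g x)\<^sup>2) \<partial>M) \<le> 0"
    using gn by (intro LIMSEQ_le_const[where X = "\<lambda>n. ennreal (B\<^sup>2) * (\<integral>\<^sup>+x. ennreal ((u x - w n x)\<^sup>2) \<partial>M)"]) auto
  then have "AE x in M. ennreal ((g x)\<^sup>2) = 0"
    by (subst (asm) le_zero_eq, subst (asm) nn_integral_0_iff_AE) auto
  then have "AE x in M. g x = 0" by eventually_elim (simp add: ennreal_eq_0_iff power2_less_eq_zero_iff)
  with bounds show ?thesis
  proof eventually_elim
    case (elim x)
    have "orb u t x < \<infinity>" using elim by (auto intro: le_less_trans)
    then show ?case using elim(2) by (simp add: g_def less_top)
  qed
qed

lemma nn_integral_orb_pairing:
  assumes "0 < t" "u \<in> L2" "AE x in M. 0 \<le> u x" "v \<in> L2" "AE x in M. 0 \<le> v x"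
  shows "(\<integral>\<^sup>+x. orb u t x * ennreal (v x) \<partial>M) = ennreal (pairing M (W t u) v)"
proof -
  have nn: "AE x in M. 0 \<le> W t u x" using assms by (intro W_nonneg) auto
  have "(\<integral>\<^sup>+x. orb u t x * ennreal (v x) \<partial>M) = (\<integral>\<^sup>+x. ennreal (W t u x * v x) \<partial>M)"
    by (rule nn_integral_cong_AE, use orb_eq_W[OF assms(1-3)] nn assms(5) in eventually_elim)
      (simp add: ennreal_mult)
  also have "\<dots> = ennreal (pairing M (W t u) v)"
    unfolding pairing_def
    by (rule nn_integral_eq_integral) (use assms in \<open>intro integrable_mult_Lp2 W_L2, auto\<close>,
        use nn assms(5) in eventually_elim, simp)
  finally show ?thesis .
qed

lemma orb_L2_bound:
  obtains B where "0 \<le> B" "\<And>t u v. 0 < t \<Longrightarrow> t \<le> \<tau> \<Longrightarrow> u \<in> L2 \<Longrightarrow> AE x in M. 0 \<le> u x \<Longrightarrow> v \<in> L2 \<Longrightarrow> AE x in M. 0 \<le> v x \<Longrightarrow>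
    (\<integral>\<^sup>+x. orb u t x * ennreal (v x) \<partial>M) \<le> ennreal (B * nrm u * nrm v)"
proof -
  obtain B where B: "0 \<le> B" "\<And>t u. 0 \<le> t \<Longrightarrow> t \<le> \<tau> \<Longrightarrow> u \<in> L2 \<Longrightarrow> nrm (W t u) \<le> B * nrm u"
    using W_locally_bounded by metis
  show thesis
  proof (rule that[OF B(1)])
    fix t u v assume *: "0 < t" "t \<le> \<tau>" "u \<in> L2" "AE x in M. 0 \<le> u x" "v \<in> L2" "AE x in M. 0 \<le> v x"
    have "pairing M (W t u) v \<le> nrm (W t u) * nrm v"
      using pairing_bound_Lp2[of "W t u" M v] * W_L2[of t u] by auto
    also have "\<dots> \<le> B * nrm u * nrm v" using * by (intro mult_right_mono B Lp_norm_nonneg) auto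
    finally show "(\<integral>\<^sup>+x. orb u t x * ennreal (v x) \<partial>M) \<le> ennreal (B * nrm u * nrm v)"
      using * by (subst nn_integral_orb_pairing) (auto intro: ennreal_leI)
  qed
qed

text \<open>For \<open>u\<close> outside \<open>L\<^sub>2\<close> nothing is known of
  \<open>W t u\<close>, and \<open>orb u\<close> takes the role of the extended semigroup on
  \<open>L\<^sub>p\<close>. Its bound comes from truncations and is stated through pairings with
  \<open>L\<^sub>p\<^sub>'\<close>, since it serves orbits and dual orbits alike.\<close>

lemma orb_Lp_bound:
  obtains B where "0 \<le> B" "\<And>t u v. 0 < t \<Longrightarrow> t \<le> \<tau> \<Longrightarrow> u \<in> Lp M p \<Longrightarrow> AE x in M. 0 \<le> u x \<Longrightarrow> v \<in> Lp M p' \<Longrightarrow>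
    (\<integral>\<^sup>+x. orb u t x * ennreal (v x) \<partial>M) \<le> ennreal (B * Lp_norm M p u * Lp_norm M p' v)"
proof -
  obtain C \<omega> where C: "1 \<le> C" and bd: "\<And>u t. u \<in> L2 \<Longrightarrow> u \<in> Lp M p \<Longrightarrow> 0 \<le> t \<Longrightarrow>
       W t u \<in> Lp M p \<and> Lp_norm M p (W t u) \<le> C * exp (\<omega> * t) * Lp_norm M p u"
    using acts unfolding acts_on_Lp_def by blast
  \<comment> \<open>The absolute values give an upper bound for either sign of
    \<open>\<omega>\<close>.\<close>
  define B where "B = C * exp (\<bar>\<omega>\<bar> * \<bar>\<tau>\<bar>)"
  have B: "0 \<le> B" using C by (simp add: B_def)
  show thesis
  proof (rule that[OF B])
    fix t u v assume t: "0 < t" "t \<le> \<tau>" and u: "u \<in> Lp M p" "AE x in M. 0 \<le> u x" and v: "v \<in> Lp M p'"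
    have [measurable]: "u \<in> borel_measurable M" "v \<in> borel_measurable M" using u v Lp_measurable by auto
    obtain w :: "nat \<Rightarrow> 'a \<Rightarrow> real" where w: "\<And>n s. 1 \<le> s \<Longrightarrow> w n \<in> Lp M s" "\<And>n x. \<bar>w n x\<bar> \<le> \<bar>u x\<bar>" "\<And>n x. 0 \<le> u x \<Longrightarrow> 0 \<le> w n x"
      "\<And>x. x \<in> space M \<Longrightarrow> \<forall>\<^sub>F n in sequentially. w n x = u x" "\<And>x. incseq (\<lambda>n. ennreal (w n x))"
      "\<And>x. x \<in> space M \<Longrightarrow> (SUP n. ennreal (w n x)) = ennreal (u x)"
      using truncation[OF \<open>u \<in> borel_measurable M\<close>] by blast
    have wL: "w n \<in> L2" "w n \<in> Lp M p" for n using w(1) p by auto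
    have wm [measurable]: "w n \<in> borel_measurable M" for n using wL(1) by (rule Lp_measurable)
    have w_nn: "AE x in M. 0 \<le> w n x" for n using u(2) by eventually_elim (rule w(3))
    have "(\<integral>\<^sup>+x. orb u t x * ennreal (v x) \<partial>M) = (\<integral>\<^sup>+x. (SUP n. orb (w n) t x * ennreal (v x)) \<partial>M)"
      by (intro nn_integral_cong) (simp add: orb_truncation_SUP[OF wm w(5,6)] SUP_mult_right_ennreal)
    also have "\<dots> = (SUP n. \<integral>\<^sup>+x. orb (w n) t x * ennreal (v x) \<partial>M)"
    proof (rule nn_integral_monotone_convergence_SUP)
      show "incseq (\<lambda>n x. orb (w n) t x * ennreal (v x))"
        using w(5) unfolding incseq_def le_fun_def orb_def
        by (intro allI impI mult_right_mono nn_integral_mono mult_left_mono) auto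
    qed measurable
    also have "\<dots> \<le> ennreal (B * Lp_norm M p u * Lp_norm M p' v)"
    proof (rule SUP_least)
      fix n
      have WL: "W t (w n) \<in> Lp M p" "Lp_norm M p (W t (w n)) \<le> C * exp (\<omega> * t) * Lp_norm M p (w n)"
        using bd[OF wL] t by auto
      have "(\<integral>\<^sup>+x. orb (w n) t x * ennreal (v x) \<partial>M) \<le> (\<integral>\<^sup>+x. ennreal \<bar>W t (w n) x * v x\<bar> \<partial>M)"
      proof (rule nn_integral_mono_AE, use orb_eq_W[OF t(1) wL(1) w_nn, of n] in eventually_elim)
        fix x assume "orb (w n) t x = ennreal (W t (w n) x)"
        moreover have "ennreal (W t (w n) x) * ennreal (v x) \<le> ennreal \<bar>W t (w n) x\<bar> * ennreal \<bar>v x\<bar>"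
          by (intro mult_mono ennreal_leI) auto
        ultimately show "orb (w n) t x * ennreal (v x) \<le> ennreal \<bar>W t (w n) x * v x\<bar>"
          by (simp add: abs_mult ennreal_mult)
      qed
      also have "\<dots> \<le> ennreal (Lp_norm M p (W t (w n)) * Lp_norm M p' v)"
        using p WL v by (intro Hoelder) auto
      also have "\<dots> \<le> ennreal (B * Lp_norm M p u * Lp_norm M p' v)"
      proof (intro ennreal_leI mult_right_mono Lp_norm_nonneg v)
        have "\<omega> * t \<le> \<bar>\<omega>\<bar> * t" using t by (intro mult_right_mono) auto
        also have "\<dots> \<le> \<bar>\<omega>\<bar> * \<bar>\<tau>\<bar>" using t by (intro mult_left_mono) auto
        finally have "\<omega> * t \<le> \<bar>\<omega>\<bar> * \<bar>\<tau>\<bar>" .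
        then have "C * exp (\<omega> * t) \<le> B" using C by (simp add: B_def)
        moreover have "Lp_norm M p (w n) \<le> Lp_norm M p u"
          using w(2)[of n] by (intro Lp_mono(2)[OF p(1,2) u(1)]) auto
        ultimately have "C * exp (\<omega> * t) * Lp_norm M p (w n) \<le> B * Lp_norm M p u"
          using B by (intro mult_mono Lp_norm_nonneg wL) auto
        then show "Lp_norm M p (W t (w n)) \<le> B * Lp_norm M p u" using WL by linarith
      qed
      finally show "(\<integral>\<^sup>+x. orb (w n) t x * ennreal (v x) \<partial>M) \<le> ennreal (B * Lp_norm M p u * Lp_norm M p' v)" .
    qed
    finally show "(\<integral>\<^sup>+x. orb u t x * ennreal (v x) \<partial>M) \<le> ennreal (B * Lp_norm M p u * Lp_norm M p' v)" .
  qed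
qed

end

section \<open>Time averages of orbits\<close>

lemma averages_tendsto_of_right_continuous:
  fixes \<phi> :: "real \<Rightarrow> ennreal" and l :: real
  assumes [measurable]: "\<phi> \<in> borel_measurable borel" and l: "0 \<le> l"
    and cont: "\<And>e. 0 < e \<Longrightarrow> \<exists>d>0. \<forall>s. 0 < s \<and> s < d \<longrightarrow> ennreal (l - e) \<le> \<phi> (c + s) \<and> \<phi> (c + s) \<le> ennreal (l + e)"
  shows "((\<lambda>t. enn2real (\<integral>\<^sup>+r\<in>{c<..<c + t}. \<phi> r \<partial>lborel) / t) \<longlongrightarrow> l) (at_right 0)"
proof (rule tendstoI)
  fix e :: real assume e: "0 < e"
  obtain d where d: "0 < d" "\<And>s. 0 < s \<Longrightarrow> s < d \<Longrightarrow> ennreal (l - e / 2) \<le> \<phi> (c + s) \<and> \<phi> (c + s) \<le> ennreal (l + e / 2)"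
    using cont[of "e / 2"] e by auto
  have "dist (enn2real (\<integral>\<^sup>+r\<in>{c<..<c + t}. \<phi> r \<partial>lborel) / t) l < e" if t: "0 < t" "t < d" for t
  proof -
    let ?I = "\<integral>\<^sup>+r\<in>{c<..<c + t}. \<phi> r \<partial>lborel"
    have "?I \<le> (\<integral>\<^sup>+r\<in>{c<..<c + t}. ennreal (l + e / 2) \<partial>lborel)"
    proof (rule nn_integral_mono)
      fix r show "\<phi> r * indicator {c<..<c + t} r \<le> ennreal (l + e / 2) * indicator {c<..<c + t} r"
        using d(2)[of "r - c"] t by (cases "r \<in> {c<..<c + t}") auto
    qed
    also have "\<dots> = ennreal ((l + e / 2) * t)"
      using t l e by (subst nn_integral_interval_const) (auto simp: ennreal_mult)
    finally have up: "?I \<le> ennreal ((l + e / 2) * t)" .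
    have "ennreal ((l - e / 2) * t) = (\<integral>\<^sup>+r\<in>{c<..<c + t}. ennreal (l - e / 2) \<partial>lborel)"
      using t by (subst nn_integral_interval_const) (auto simp: ennreal_mult'')
    also have "\<dots> \<le> ?I"
    proof (rule nn_integral_mono)
      fix r show "ennreal (l - e / 2) * indicator {c<..<c + t} r \<le> \<phi> r * indicator {c<..<c + t} r"
        using d(2)[of "r - c"] t by (cases "r \<in> {c<..<c + t}") auto
    qed
    finally have low: "ennreal ((l - e / 2) * t) \<le> ?I" .
    have "?I < \<infinity>" using up by (rule le_less_trans) simp
    then obtain i where i: "?I = ennreal i" "0 \<le> i" by (cases ?I rule: ennreal_cases) auto
    have "i \<le> (l + e / 2) * t" using up i l e t by (simp add: ennreal_le_iff)
    \<comment> \<open>For a negative left-hand side \<open>ennreal\<close> gives 0 and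
      \<open>low\<close> carries no information; the claim then follows from
      \<open>0 \<le> i\<close>.\<close>
    moreover have "(l - e / 2) * t \<le> i"
      using low i by (cases "0 \<le> (l - e / 2) * t") (auto simp: ennreal_le_iff)
    ultimately have "i / t \<le> l + e / 2" "l - e / 2 \<le> i / t" using t by (auto simp: field_simps)
    then show ?thesis using e i by (simp add: dist_real_def abs_if)
  qed
  then show "\<forall>\<^sub>F t in at_right 0. dist (enn2real (\<integral>\<^sup>+r\<in>{c<..<c + t}. \<phi> r \<partial>lborel) / t) l < e"
    unfolding eventually_at_right_field using d(1) by blast
qed

context kernel_semigroup
begin

sublocale TM: pair_sigma_finite lborel M ..

lemma nn_integral_interval_swap:
  fixes G :: "real \<Rightarrow> 'a \<Rightarrow> ennreal"
  assumes [measurable]: "case_prod G \<in> borel_measurable (borel \<Otimes>\<^sub>M M)" "h \<in> borel_measurable M"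
  shows "(\<integral>\<^sup>+x. (\<integral>\<^sup>+r\<in>{a<..<b}. G r x \<partial>lborel) * h x \<partial>M) = (\<integral>\<^sup>+r\<in>{a<..<b}. (\<integral>\<^sup>+x. G r x * h x \<partial>M) \<partial>lborel)"
proof -
  have "(\<integral>\<^sup>+x. (\<integral>\<^sup>+r\<in>{a<..<b}. G r x \<partial>lborel) * h x \<partial>M) = (\<integral>\<^sup>+x. (\<integral>\<^sup>+r. G r x * indicator {a<..<b} r * h x \<partial>lborel) \<partial>M)"
    by (intro nn_integral_cong nn_integral_multc[symmetric]) measurable
  also have "\<dots> = (\<integral>\<^sup>+r. (\<integral>\<^sup>+x. G r x * indicator {a<..<b} r * h x \<partial>M) \<partial>lborel)"
    by (rule TM.Fubini') measurable
  also have "\<dots> = (\<integral>\<^sup>+r. (\<integral>\<^sup>+x. G r x * h x * indicator {a<..<b} r \<partial>M) \<partial>lborel)"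
    by (simp add: ac_simps)
  also have "\<dots> = (\<integral>\<^sup>+r\<in>{a<..<b}. (\<integral>\<^sup>+x. G r x * h x \<partial>M) \<partial>lborel)"
    by (intro nn_integral_cong nn_integral_multc) measurable
  finally show ?thesis .
qed

definition orb_int :: "('a \<Rightarrow> real) \<Rightarrow> real \<Rightarrow> real \<Rightarrow> 'a \<Rightarrow> ennreal" where
  "orb_int u a h x = (\<integral>\<^sup>+r\<in>{a<..<a + h}. orb u r x \<partial>lborel)"

definition dual_orb_int :: "('a \<Rightarrow> real) \<Rightarrow> real \<Rightarrow> real \<Rightarrow> 'a \<Rightarrow> ennreal" where
  "dual_orb_int v b h y = (\<integral>\<^sup>+r\<in>{b<..<b + h}. dual_orb v r y \<partial>lborel)"

lemma orb_int_measurable [measurable]: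
  assumes [measurable]: "u \<in> borel_measurable M"
  shows "orb_int u a h \<in> borel_measurable M"
  unfolding orb_int_def[abs_def] by measurable

lemma dual_orb_int_measurable [measurable]:
  assumes [measurable]: "v \<in> borel_measurable M"
  shows "dual_orb_int v b h \<in> borel_measurable M"
  unfolding dual_orb_int_def[abs_def] by measurable

lemma nn_integral_orb_int:
  assumes [measurable]: "u \<in> borel_measurable M" "g \<in> borel_measurable M"
  shows "(\<integral>\<^sup>+x. orb_int u a h x * g x \<partial>M) = (\<integral>\<^sup>+r\<in>{a<..<a + h}. (\<integral>\<^sup>+x. orb u r x * g x \<partial>M) \<partial>lborel)"
  unfolding orb_int_def by (rule nn_integral_interval_swap) measurable

lemma nn_integral_dual_orb_int:
  assumes [measurable]: "v \<in> borel_measurable M" "g \<in> borel_measurable M"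
  shows "(\<integral>\<^sup>+y. dual_orb_int v b h y * g y \<partial>M) = (\<integral>\<^sup>+r\<in>{b<..<b + h}. (\<integral>\<^sup>+y. dual_orb v r y * g y \<partial>M) \<partial>lborel)"
  unfolding dual_orb_int_def by (rule nn_integral_interval_swap) measurable

lemma interval_bound:
  assumes "0 < a" "0 \<le> h" "0 \<le> c" "\<And>r. a < r \<Longrightarrow> r < a + h \<Longrightarrow> G r \<le> ennreal c"
  shows "(\<integral>\<^sup>+r\<in>{a<..<a + h}. G r \<partial>lborel) \<le> ennreal (c * h)"
proof -
  have "(\<integral>\<^sup>+r\<in>{a<..<a + h}. G r \<partial>lborel) \<le> (\<integral>\<^sup>+r\<in>{a<..<a + h}. ennreal c \<partial>lborel)"
    using assms by (intro nn_integral_mono) (auto simp: indicator_def)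
  also have "\<dots> = ennreal (c * h)" using assms by (subst nn_integral_interval_const) (auto simp: ennreal_mult)
  finally show ?thesis .
qed

text \<open>The pairing with a test function is the time integral of the pairings of the orbit,
  hence bounded; duality then plays the part of Minkowski's integral inequality.\<close>

lemma orb_int_L2:
  assumes "0 < a" "0 < h" and u: "u \<in> L2" "AE x in M. 0 \<le> u x"
  shows "AE x in M. orb_int u a h x < \<infinity>" "(\<lambda>x. enn2real (orb_int u a h x)) \<in> L2"
proof -
  have [measurable]: "u \<in> borel_measurable M" using u(1) by (rule Lp_measurable)
  obtain B where B: "0 \<le> B" "\<And>t u v. 0 < t \<Longrightarrow> t \<le> a + h \<Longrightarrow> u \<in> L2 \<Longrightarrow> AE x in M. 0 \<le> u x \<Longrightarrow> v \<in> L2 \<Longrightarrow> AE x in M. 0 \<le> v x \<Longrightarrow>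
    (\<integral>\<^sup>+x. orb u t x * ennreal (v x) \<partial>M) \<le> ennreal (B * nrm u * nrm v)"
    using orb_L2_bound[of "a + h"] by blast
  have le: "(\<integral>\<^sup>+x. orb_int u a h x * ennreal (w x) \<partial>M) \<le> ennreal (B * nrm u * h * nrm w)"
    if w: "w \<in> L2" "\<And>x. 0 \<le> w x" for w
  proof -
    have [measurable]: "w \<in> borel_measurable M" using w(1) by (rule Lp_measurable)
    have "(\<integral>\<^sup>+x. orb_int u a h x * ennreal (w x) \<partial>M) \<le> ennreal (B * nrm u * nrm w * h)"
      by (subst nn_integral_orb_int, measurable, rule interval_bound)
        (use assms w B in \<open>auto intro!: B(2) mult_nonneg_nonneg Lp_norm_nonneg\<close>)
    then show ?thesis by (simp add: ac_simps)
  qed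
  have c: "0 \<le> B * nrm u * h" using B u assms by (intro mult_nonneg_nonneg Lp_norm_nonneg) auto
  have dm: "orb_int u a h \<in> borel_measurable M" by measurable
  show "AE x in M. orb_int u a h x < \<infinity>"
    by (rule Lp_by_duality(1)[OF one_le_numeral two_dual dm c]) (rule le, assumption+)
  show "(\<lambda>x. enn2real (orb_int u a h x)) \<in> L2"
    by (rule Lp_by_duality(2)[OF one_le_numeral two_dual dm c]) (rule le, assumption+)
qed

text \<open>Applied to \<open>T\<close> with exponent \<open>q\<close>, this supplies the membership
  in \<open>L\<^sub>q\<close> that the form inequality demands besides the domain.\<close>

lemma orb_int_Lp:
  assumes "0 < a" "0 < h" and u: "u \<in> Lp M p" "AE x in M. 0 \<le> u x"
  shows "(\<lambda>x. enn2real (orb_int u a h x)) \<in> Lp M p"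
proof -
  have [measurable]: "u \<in> borel_measurable M" using u(1) by (rule Lp_measurable)
  obtain B where B: "0 \<le> B" "\<And>t u v. 0 < t \<Longrightarrow> t \<le> a + h \<Longrightarrow> u \<in> Lp M p \<Longrightarrow> AE x in M. 0 \<le> u x \<Longrightarrow> v \<in> Lp M p' \<Longrightarrow>
    (\<integral>\<^sup>+x. orb u t x * ennreal (v x) \<partial>M) \<le> ennreal (B * Lp_norm M p u * Lp_norm M p' v)"
    using orb_Lp_bound[of "a + h"] by blast
  have le: "(\<integral>\<^sup>+x. orb_int u a h x * ennreal (w x) \<partial>M) \<le> ennreal (B * Lp_norm M p u * h * Lp_norm M p' w)"
    if w: "w \<in> Lp M p'" "\<And>x. 0 \<le> w x" for w
  proof -
    have [measurable]: "w \<in> borel_measurable M" using w(1) by (rule Lp_measurable)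
    have "(\<integral>\<^sup>+x. orb_int u a h x * ennreal (w x) \<partial>M) \<le> ennreal (B * Lp_norm M p u * Lp_norm M p' w * h)"
      by (subst nn_integral_orb_int, measurable, rule interval_bound)
        (use assms w B in \<open>auto intro!: B(2) mult_nonneg_nonneg Lp_norm_nonneg\<close>)
    then show ?thesis by (simp add: ac_simps)
  qed
  have c: "0 \<le> B * Lp_norm M p u * h" using B u assms by (intro mult_nonneg_nonneg Lp_norm_nonneg) auto
  have dm: "orb_int u a h \<in> borel_measurable M" by measurable
  show ?thesis
    by (rule Lp_by_duality(2)[OF p(1,3) dm c]) (rule le, assumption+)
qed

lemma dual_orb_int_L2:
  assumes "0 < b" "0 < h" and v: "v \<in> L2" "AE x in M. 0 \<le> v x"
  shows "AE x in M. dual_orb_int v b h x < \<infinity>" "(\<lambda>x. enn2real (dual_orb_int v b h x)) \<in> L2"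
proof -
  have [measurable]: "v \<in> borel_measurable M" using v(1) by (rule Lp_measurable)
  obtain B where B: "0 \<le> B" "\<And>t u v. 0 < t \<Longrightarrow> t \<le> b + h \<Longrightarrow> u \<in> L2 \<Longrightarrow> AE x in M. 0 \<le> u x \<Longrightarrow> v \<in> L2 \<Longrightarrow> AE x in M. 0 \<le> v x \<Longrightarrow>
    (\<integral>\<^sup>+x. orb u t x * ennreal (v x) \<partial>M) \<le> ennreal (B * nrm u * nrm v)"
    using orb_L2_bound[of "b + h"] by blast
  have le: "(\<integral>\<^sup>+x. dual_orb_int v b h x * ennreal (w x) \<partial>M) \<le> ennreal (B * nrm v * h * nrm w)"
    if w: "w \<in> L2" "\<And>x. 0 \<le> w x" for w
  proof -
    have [measurable]: "w \<in> borel_measurable M" using w(1) by (rule Lp_measurable)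
    have "(\<integral>\<^sup>+x. dual_orb_int v b h x * ennreal (w x) \<partial>M) \<le> ennreal (B * nrm w * nrm v * h)"
      by (subst nn_integral_dual_orb_int, measurable, rule interval_bound)
        (use assms w B in \<open>auto intro!: B(2) mult_nonneg_nonneg Lp_norm_nonneg simp: mult.commute[of "dual_orb _ _ _"] orb_dual_orb[symmetric]\<close>)
    then show ?thesis by (simp add: ac_simps)
  qed
  have c: "0 \<le> B * nrm v * h" using B v assms by (intro mult_nonneg_nonneg Lp_norm_nonneg) auto
  have dm: "dual_orb_int v b h \<in> borel_measurable M" by measurable
  show "AE x in M. dual_orb_int v b h x < \<infinity>"
    by (rule Lp_by_duality(1)[OF one_le_numeral two_dual dm c]) (rule le, assumption+)
  show "(\<lambda>x. enn2real (dual_orb_int v b h x)) \<in> L2"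
    by (rule Lp_by_duality(2)[OF one_le_numeral two_dual dm c]) (rule le, assumption+)
qed

lemma dual_orb_L2:
  assumes "0 < b" and v: "v \<in> L2" "AE x in M. 0 \<le> v x"
  shows "AE x in M. dual_orb v b x < \<infinity>" "(\<lambda>x. enn2real (dual_orb v b x)) \<in> L2"
proof -
  have [measurable]: "v \<in> borel_measurable M" using v(1) by (rule Lp_measurable)
  obtain B where B: "0 \<le> B" "\<And>t u v. 0 < t \<Longrightarrow> t \<le> b \<Longrightarrow> u \<in> L2 \<Longrightarrow> AE x in M. 0 \<le> u x \<Longrightarrow> v \<in> L2 \<Longrightarrow> AE x in M. 0 \<le> v x \<Longrightarrow>
    (\<integral>\<^sup>+x. orb u t x * ennreal (v x) \<partial>M) \<le> ennreal (B * nrm u * nrm v)"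
    using orb_L2_bound[of b] by blast
  have le: "(\<integral>\<^sup>+x. dual_orb v b x * ennreal (w x) \<partial>M) \<le> ennreal (B * nrm v * nrm w)"
    if w: "w \<in> L2" "\<And>x. 0 \<le> w x" for w
  proof -
    have [measurable]: "w \<in> borel_measurable M" using w(1) by (rule Lp_measurable)
    have "(\<integral>\<^sup>+x. dual_orb v b x * ennreal (w x) \<partial>M) = (\<integral>\<^sup>+x. orb w b x * ennreal (v x) \<partial>M)"
      by (subst orb_dual_orb) (auto simp: mult.commute)
    also have "\<dots> \<le> ennreal (B * nrm w * nrm v)" using assms w by (intro B) auto
    finally show ?thesis by (simp add: ac_simps)
  qed
  have c: "0 \<le> B * nrm v" using B v assms by (intro mult_nonneg_nonneg Lp_norm_nonneg) auto
  have dm: "dual_orb v b \<in> borel_measurable M" by measurable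
  show "AE x in M. dual_orb v b x < \<infinity>"
    by (rule Lp_by_duality(1)[OF one_le_numeral two_dual dm c]) (rule le, assumption+)
  show "(\<lambda>x. enn2real (dual_orb v b x)) \<in> L2"
    by (rule Lp_by_duality(2)[OF one_le_numeral two_dual dm c]) (rule le, assumption+)
qed

text \<open>Duality with the exponents exchanged. For \<open>p = 1\<close> this is membership in
  \<open>L\<^sub>\<infinity>\<close>, obtained from a bound in \<open>L\<^sub>1\<close>.\<close>

lemma dual_orb_int_Lp':
  assumes "0 < b" "0 < h" and v: "v \<in> Lp M p'" "AE x in M. 0 \<le> v x"
  shows "(\<lambda>x. enn2real (dual_orb_int v b h x)) \<in> Lp M p'"
proof -
  have [measurable]: "v \<in> borel_measurable M" using v(1) by (rule Lp_measurable)
  obtain B where B: "0 \<le> B" "\<And>t u v. 0 < t \<Longrightarrow> t \<le> b + h \<Longrightarrow> u \<in> Lp M p \<Longrightarrow> AE x in M. 0 \<le> u x \<Longrightarrow> v \<in> Lp M p' \<Longrightarrow>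
    (\<integral>\<^sup>+x. orb u t x * ennreal (v x) \<partial>M) \<le> ennreal (B * Lp_norm M p u * Lp_norm M p' v)"
    using orb_Lp_bound[of "b + h"] by blast
  have le: "(\<integral>\<^sup>+x. dual_orb_int v b h x * ennreal (w x) \<partial>M) \<le> ennreal (B * Lp_norm M p' v * h * Lp_norm M p w)"
    if w: "w \<in> Lp M p" "\<And>x. 0 \<le> w x" for w
  proof -
    have [measurable]: "w \<in> borel_measurable M" using w(1) by (rule Lp_measurable)
    have "(\<integral>\<^sup>+x. dual_orb_int v b h x * ennreal (w x) \<partial>M) \<le> ennreal (B * Lp_norm M p w * Lp_norm M p' v * h)"
      by (subst nn_integral_dual_orb_int, measurable, rule interval_bound)
        (use assms w B in \<open>auto intro!: B(2) mult_nonneg_nonneg Lp_norm_nonneg simp: mult.commute[of "dual_orb _ _ _"] orb_dual_orb[symmetric]\<close>)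
    then show ?thesis by (simp add: ac_simps)
  qed
  have c: "0 \<le> B * Lp_norm M p' v * h" using B v assms by (intro mult_nonneg_nonneg Lp_norm_nonneg) auto
  have p'1: "1 \<le> p'" "1 / p' + 1 / p = 1" using one_le_dual_exponent[OF p(1,3)] p(3) by (auto simp: add.commute)
  have dm: "dual_orb_int v b h \<in> borel_measurable M" by measurable
  show ?thesis
    by (rule Lp_by_duality(2)[OF p'1 dm c]) (rule le, assumption+)
qed


text \<open>Interchange of \<open>W t\<close> with the time integral. With the kernel written out it
  is Tonelli's theorem followed by the semigroup law at each time \<open>r\<close>.\<close>

lemma W_orb_int:
  assumes a: "0 < a" "0 < h" "0 < t" and u: "u \<in> L2" "AE x in M. 0 \<le> u x"
  shows "AE x in M. W t (\<lambda>x. enn2real (orb_int u a h x)) x = enn2real (orb_int u (a + t) h x)"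
proof -
  have [measurable]: "u \<in> borel_measurable M" using u(1) by (rule Lp_measurable)
  define U where "U x = enn2real (orb_int u a h x)" for x
  have UL: "U \<in> L2" unfolding U_def[abs_def] using a u by (intro orb_int_L2)
  have U: "AE x in M. ennreal (U x) = orb_int u a h x"
    using orb_int_L2(1)[OF a(1,2) u] by eventually_elim (simp add: U_def less_top)
  have swap: "orb U t x = (\<integral>\<^sup>+r\<in>{a<..<a + h}. (\<integral>\<^sup>+y. orb u r y * K t x y \<partial>M) \<partial>lborel)" if [measurable]: "x \<in> space M" for x
  proof -
    have "orb U t x = (\<integral>\<^sup>+y. orb_int u a h y * K t x y \<partial>M)"
      unfolding orb_def
      by (rule nn_integral_cong_AE, use U in eventually_elim) (simp add: mult.commute)
    also have "\<dots> = (\<integral>\<^sup>+r\<in>{a<..<a + h}. (\<integral>\<^sup>+y. orb u r y * K t x y \<partial>M) \<partial>lborel)"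
      by (rule nn_integral_orb_int) measurable
    finally show ?thesis .
  qed
  \<comment> \<open>The semigroup law has an exceptional set of points \<open>x\<close> for each
    \<open>r\<close>, while the time integral at a fixed \<open>x\<close> needs it for almost all
    \<open>r\<close>. As \<open>P\<close> is jointly measurable, the two quantifiers may be
    exchanged.\<close>
  define P where "P r x \<longleftrightarrow> (a < r \<longrightarrow> (\<integral>\<^sup>+y. orb u r y * K t x y \<partial>M) = orb u (t + r) x)" for r x
  have Pm: "{z \<in> space (lborel \<Otimes>\<^sub>M M). P (fst z) (snd z)} \<in> sets (lborel \<Otimes>\<^sub>M M)"
    unfolding P_def by measurable
  have "AE r in lborel. AE x in M. a < r \<longrightarrow> (\<integral>\<^sup>+y. orb u r y * K t x y \<partial>M) = orb u (t + r) x"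
  proof (rule AE_I2)
    fix r :: real
    show "AE x in M. a < r \<longrightarrow> (\<integral>\<^sup>+y. orb u r y * K t x y \<partial>M) = orb u (t + r) x"
    proof (cases "a < r")
      case True
      then have r: "0 < r" using a by simp
      have eq: "(\<integral>\<^sup>+y. orb u r y * K t x y \<partial>M) = orb (W r u) t x" for x
        unfolding orb_def[of "W r u"]
        by (rule nn_integral_cong_AE, use orb_eq_W[OF r u] in eventually_elim) (simp add: mult.commute)
      have WL: "W r u \<in> L2" "AE x in M. 0 \<le> W r u x" using W_L2[of r u] W_nonneg[of r u] r u by auto
      have sg: "AE x in M. W (t + r) u x = W t (W r u) x" using a r u by (intro W_semigroup) auto
      have tr: "0 < t + r" using a r by simp
      have "AE x in M. orb (W r u) t x = orb u (t + r) x"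
        using orb_eq_W[OF a(3) WL] orb_eq_W[OF tr u] sg by eventually_elim simp
      then show ?thesis by (simp add: eq)
    qed simp
  qed
  then have "AE r in lborel. AE x in M. P r x" unfolding P_def .
  then have "AE x in M. AE r in lborel. P r x" by (rule TM.AE_commute[OF Pm, THEN iffD1])
  moreover have "AE x in M. orb U t x = ennreal (W t U x)"
    using a UL by (intro orb_eq_W) (auto simp: U_def)
  moreover have "AE x in M. 0 \<le> W t U x" using a UL by (intro W_nonneg) (auto simp: U_def)
  ultimately have "AE x in M. W t U x = enn2real (orb_int u (a + t) h x)"
    using AE_space
  proof eventually_elim
    case (elim x)
    have [measurable]: "x \<in> space M" using elim by simp
    note el = elim(1)[unfolded P_def]
    have "ennreal (W t U x) = (\<integral>\<^sup>+r\<in>{a<..<a + h}. (\<integral>\<^sup>+y. orb u r y * K t x y \<partial>M) \<partial>lborel)"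
      using elim swap by simp
    also have "\<dots> = (\<integral>\<^sup>+r\<in>{a<..<a + h}. orb u (t + r) x \<partial>lborel)"
      by (rule nn_integral_cong_AE, use el in eventually_elim) (auto simp: indicator_def)
    also have "\<dots> = (\<integral>\<^sup>+r\<in>{t + a<..<t + (a + h)}. orb u r x \<partial>lborel)"
      by (rule nn_integral_shift) measurable
    also have "\<dots> = orb_int u (a + t) h x" by (simp add: orb_int_def ac_simps)
    finally show ?case using elim(3) by (metis enn2real_ennreal)
  qed
  then show ?thesis by (simp add: U_def[abs_def])
qed

text \<open>Jensen's inequality for the average over an interval of length \<open>t\<close>, derived
  from the Cauchy-Schwarz inequality against the indicator of the interval. It is used at a single
  point \<open>x\<close> of the space; integration over \<open>x\<close> follows in
  \<open>orb_int_average_tendsto\<close>.\<close>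

lemma square_of_average_le:
  fixes \<phi> :: "real \<Rightarrow> ennreal" and w :: real
  assumes [measurable]: "\<phi> \<in> borel_measurable borel" and t: "0 < t"
    and fin: "(\<integral>\<^sup>+r\<in>{c<..<c + t}. \<phi> r \<partial>lborel) < \<infinity>"
  shows "ennreal ((enn2real (\<integral>\<^sup>+r\<in>{c<..<c + t}. \<phi> r \<partial>lborel) / t - w)\<^sup>2)
    \<le> ennreal (1 / t) * (\<integral>\<^sup>+r\<in>{c<..<c + t}. ennreal ((enn2real (\<phi> r) - w)\<^sup>2) \<partial>lborel)"
proof -
  let ?I = "{c<..<c + t}"
  have em: "emeasure lborel ?I = ennreal t" using t by simp
  define g where "g r = indicator ?I r * enn2real (\<phi> r)" for r
  have [measurable]: "g \<in> borel_measurable borel" unfolding g_def[abs_def] by measurable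
  have "AE r in lborel. \<phi> r * indicator ?I r \<noteq> \<infinity>"
    using fin by (intro nn_integral_PInf_AE) auto
  then have g: "(\<integral>\<^sup>+r. ennreal (g r) \<partial>lborel) = (\<integral>\<^sup>+r\<in>?I. \<phi> r \<partial>lborel)"
    by (intro nn_integral_cong_AE, eventually_elim) (auto simp: g_def indicator_def less_top)
  have gi: "integrable lborel g"
    using fin g by (intro integrableI_nonneg) (auto simp: g_def)
  have gI: "(LINT r|lborel. g r) = enn2real (\<integral>\<^sup>+r\<in>?I. \<phi> r \<partial>lborel)"
    unfolding g[symmetric] by (rule integral_eq_nn_integral) (auto simp: g_def)
  have wi: "integrable lborel (\<lambda>r. w * indicator ?I r)" using t by (intro integrable_mult_right) simp
  have wI: "(LINT r|lborel. w * indicator ?I r) = w * t"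
  proof -
    have "measure lborel ?I = t" unfolding measure_def em using t by simp
    then show ?thesis by simp
  qed
  define \<Delta> where "\<Delta> = enn2real (\<integral>\<^sup>+r\<in>?I. \<phi> r \<partial>lborel) - w * t"
  have \<Delta>: "\<Delta> = (LINT r|lborel. g r - w * indicator ?I r)"
    unfolding \<Delta>_def Bochner_Integration.integral_diff[OF gi wi] gI wI ..
  have "ennreal \<bar>\<Delta>\<bar> \<le> (\<integral>\<^sup>+r. ennreal \<bar>g r - w * indicator ?I r\<bar> \<partial>lborel)"
    unfolding \<Delta> using integral_norm_bound_ennreal[OF Bochner_Integration.integrable_diff[OF gi wi]] by simp
  also have "\<dots> = (\<integral>\<^sup>+r. ennreal \<bar>g r - w * indicator ?I r\<bar> * indicator ?I r \<partial>lborel)"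
    by (intro nn_integral_cong) (auto simp: g_def indicator_def)
  finally have "(ennreal \<bar>\<Delta>\<bar>)\<^sup>2 \<le> (\<integral>\<^sup>+r. ennreal \<bar>g r - w * indicator ?I r\<bar> * indicator ?I r \<partial>lborel)\<^sup>2"
    by (rule power_mono) simp
  also have "\<dots> \<le> (\<integral>\<^sup>+r. (ennreal \<bar>g r - w * indicator ?I r\<bar>)\<^sup>2 \<partial>lborel) * (\<integral>\<^sup>+r. (indicator ?I r)\<^sup>2 \<partial>lborel)"
    by (rule Cauchy_Schwarz_nn_integral) measurable
  also have "(\<integral>\<^sup>+r. (indicator ?I r :: ennreal)\<^sup>2 \<partial>lborel) = ennreal t"
  proof -
    have "(\<integral>\<^sup>+r. (indicator ?I r :: ennreal)\<^sup>2 \<partial>lborel) = (\<integral>\<^sup>+r. indicator ?I r \<partial>lborel)"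
      by (intro nn_integral_cong) (simp split: split_indicator)
    also have "\<dots> = emeasure lborel ?I" by (rule nn_integral_indicator) simp
    finally show ?thesis unfolding em .
  qed
  also have "(\<integral>\<^sup>+r. (ennreal \<bar>g r - w * indicator ?I r\<bar>)\<^sup>2 \<partial>lborel) = (\<integral>\<^sup>+r\<in>?I. ennreal ((enn2real (\<phi> r) - w)\<^sup>2) \<partial>lborel)"
    by (intro nn_integral_cong) (simp add: g_def ennreal_power split: split_indicator)
  finally have le: "ennreal (\<Delta>\<^sup>2) \<le> (\<integral>\<^sup>+r\<in>?I. ennreal ((enn2real (\<phi> r) - w)\<^sup>2) \<partial>lborel) * ennreal t"
    by (simp add: ennreal_power)
  have "(enn2real (\<integral>\<^sup>+r\<in>?I. \<phi> r \<partial>lborel) / t - w)\<^sup>2 = (1 / t)\<^sup>2 * \<Delta>\<^sup>2"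
    using t by (simp add: \<Delta>_def power_mult_distrib[symmetric] field_simps)
  then have "ennreal ((enn2real (\<integral>\<^sup>+r\<in>?I. \<phi> r \<partial>lborel) / t - w)\<^sup>2) = ennreal ((1 / t)\<^sup>2) * ennreal (\<Delta>\<^sup>2)"
    by (simp add: ennreal_mult)
  also have "\<dots> \<le> ennreal ((1 / t)\<^sup>2) * ((\<integral>\<^sup>+r\<in>?I. ennreal ((enn2real (\<phi> r) - w)\<^sup>2) \<partial>lborel) * ennreal t)"
    using le by (rule mult_left_mono) simp
  also have "\<dots> = (ennreal ((1 / t)\<^sup>2) * ennreal t) * (\<integral>\<^sup>+r\<in>?I. ennreal ((enn2real (\<phi> r) - w)\<^sup>2) \<partial>lborel)"
    by (simp add: ac_simps)
  also have "ennreal ((1 / t)\<^sup>2) * ennreal t = ennreal (1 / t)"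
    using t by (subst ennreal_mult[symmetric]) (auto simp: power2_eq_square)
  finally show ?thesis .
qed

text \<open>After Jensen's inequality at each point and Tonelli's theorem, the squared distance is
  at most the average of \<open>(nrm (\<lambda>x. W r u x - W c u x))\<^sup>2\<close> over
  \<open>r\<close>, which is small by right continuity.\<close>

lemma orb_int_average_tendsto:
  assumes c: "0 < c" and u: "u \<in> L2" "AE x in M. 0 \<le> u x"
  shows "((\<lambda>t. nrm (\<lambda>x. enn2real (orb_int u c t x) / t - W c u x)) \<longlongrightarrow> 0) (at_right 0)"
proof (rule tendstoI)
  fix e :: real assume e: "0 < e"
  have [measurable]: "u \<in> borel_measurable M" using u(1) by (rule Lp_measurable)
  have WcL: "W c u \<in> L2" using c u by (intro W_L2) auto
  have [measurable]: "W c u \<in> borel_measurable M" using WcL by (rule Lp_measurable)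
  obtain d where d: "0 < d" "\<And>s. 0 \<le> s \<Longrightarrow> s < d \<Longrightarrow> nrm (\<lambda>x. W (c + s) u x - W c u x) < e / 2"
    using W_right_continuous[of c u "e / 2"] c u e by (metis half_gt_zero less_imp_le)
  have "nrm (\<lambda>x. enn2real (orb_int u c t x) / t - W c u x) < e \<and> 0 \<le> nrm (\<lambda>x. enn2real (orb_int u c t x) / t - W c u x)"
    if t: "0 < t" "t < d" for t
  proof -
    define g where "g x = enn2real (orb_int u c t x) / t - W c u x" for x
    have gL: "g \<in> L2"
      using Lp2_diff(1)[OF Lp2_cmult(1)[OF orb_int_L2(2)[OF c t(1) u], of "1 / t"] WcL]
      by (simp add: g_def[abs_def])
    have "(\<integral>\<^sup>+x. ennreal ((g x)\<^sup>2) \<partial>M) \<le> (\<integral>\<^sup>+x. ennreal (1 / t) * (\<integral>\<^sup>+r\<in>{c<..<c + t}. ennreal ((enn2real (orb u r x) - W c u x)\<^sup>2) \<partial>lborel) \<partial>M)"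
    proof (rule nn_integral_mono_AE)
      show "AE x in M. ennreal ((g x)\<^sup>2) \<le> ennreal (1 / t) * (\<integral>\<^sup>+r\<in>{c<..<c + t}. ennreal ((enn2real (orb u r x) - W c u x)\<^sup>2) \<partial>lborel)"
        using orb_int_L2(1)[OF c t(1) u] AE_space
      proof eventually_elim
        case (elim x)
        then have [measurable]: "x \<in> space M" by simp
        show ?case
          unfolding g_def orb_int_def
          by (rule square_of_average_le) (use t elim in \<open>auto simp: orb_int_def\<close>)
      qed
    qed
    also have "\<dots> = ennreal (1 / t) * (\<integral>\<^sup>+x. (\<integral>\<^sup>+r\<in>{c<..<c + t}. ennreal ((enn2real (orb u r x) - W c u x)\<^sup>2) \<partial>lborel) * 1 \<partial>M)"
      by (subst nn_integral_cmult) auto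
    also have "(\<integral>\<^sup>+x. (\<integral>\<^sup>+r\<in>{c<..<c + t}. ennreal ((enn2real (orb u r x) - W c u x)\<^sup>2) \<partial>lborel) * 1 \<partial>M)
        = (\<integral>\<^sup>+r\<in>{c<..<c + t}. (\<integral>\<^sup>+x. ennreal ((enn2real (orb u r x) - W c u x)\<^sup>2) * 1 \<partial>M) \<partial>lborel)"
      by (rule nn_integral_interval_swap) measurable
    also have "\<dots> \<le> ennreal ((e / 2)\<^sup>2 * t)"
    proof (rule interval_bound[OF c])
      fix r assume r: "c < r" "r < c + t"
      have "0 < r" using r c by simp
      have WrL: "W r u \<in> L2" using \<open>0 < r\<close> u by (intro W_L2) auto
      have "(\<integral>\<^sup>+x. ennreal ((enn2real (orb u r x) - W c u x)\<^sup>2) * 1 \<partial>M) = (\<integral>\<^sup>+x. ennreal ((W r u x - W c u x)\<^sup>2) \<partial>M)"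
        by (rule nn_integral_cong_AE, use orb_eq_W[OF \<open>0 < r\<close> u] W_nonneg[OF less_imp_le[OF \<open>0 < r\<close>] u] in eventually_elim) simp
      also have "\<dots> = ennreal ((nrm (\<lambda>x. W r u x - W c u x))\<^sup>2)"
        using WrL WcL by (intro nn_integral_square_Lp2 Lp2_diff)
      also have "\<dots> \<le> ennreal ((e / 2)\<^sup>2)"
        using d(2)[of "r - c"] r t Lp_norm_nonneg[OF Lp2_diff(1)[OF WrL WcL]] by (intro ennreal_leI power_mono) auto
      finally show "(\<integral>\<^sup>+x. ennreal ((enn2real (orb u r x) - W c u x)\<^sup>2) * 1 \<partial>M) \<le> ennreal ((e / 2)\<^sup>2)" .
    qed (use t in auto)
    also have "ennreal (1 / t) * ennreal ((e / 2)\<^sup>2 * t) = ennreal ((e / 2)\<^sup>2)"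
      using t by (subst ennreal_mult[symmetric]) auto
    finally have "ennreal ((nrm g)\<^sup>2) \<le> ennreal ((e / 2)\<^sup>2)"
      using gL by (simp add: nn_integral_square_Lp2 mult_left_mono)
    then have sq: "(nrm g)\<^sup>2 \<le> (e / 2)\<^sup>2" by (subst (asm) ennreal_le_iff) auto
    have "0 \<le> e / 2" using e by simp
    with sq have "nrm g \<le> e / 2" by (rule power2_le_imp_le)
    then show ?thesis using e Lp_norm_nonneg[OF gL] by (simp add: g_def[abs_def])
  qed
  then have "dist (nrm (\<lambda>x. enn2real (orb_int u c t x) / t - W c u x)) 0 < e" if "0 < t" "t < d" for t
    using that by (simp add: dist_real_def)
  then show "\<forall>\<^sub>F t in at_right 0. dist (nrm (\<lambda>x. enn2real (orb_int u c t x) / t - W c u x)) 0 < e"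
    unfolding eventually_at_right_field using d(1) by blast
qed

text \<open>Both sides are the integral over the interval from \<open>a\<close> to
  \<open>a + h + t\<close>, cut at different points; the additive form suits \<open>ennreal\<close>,
  where differences are truncated.\<close>

lemma orb_int_shift:
  assumes "0 < a" "0 < h" "0 < t" and x: "x \<in> space M" and [measurable]: "u \<in> borel_measurable M"
  shows "orb_int u a t x + orb_int u (a + t) h x = orb_int u a h x + orb_int u (a + h) t x"
proof -
  have m [measurable]: "(\<lambda>r. orb u r x) \<in> borel_measurable borel" using x by measurable
  have "(\<integral>\<^sup>+r\<in>{a<..<a + h + t}. orb u r x \<partial>lborel) = orb_int u a h x + orb_int u (a + h) t x"
    unfolding orb_int_def using assms by (intro nn_integral_split m) auto
  moreover have "(\<integral>\<^sup>+r\<in>{a<..<a + t + h}. orb u r x \<partial>lborel) = orb_int u a t x + orb_int u (a + t) h x"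
    unfolding orb_int_def using assms by (intro nn_integral_split m) auto
  moreover have "a + h + t = a + t + h" by simp
  ultimately show ?thesis by simp
qed

text \<open>The integral telescopes: the difference quotient at \<open>t\<close> equals the average
  over the interval of length \<open>t\<close> after \<open>a + h\<close> minus the one after
  \<open>a\<close>, and both converge in norm by right continuity.\<close>

lemma orb_int_generator:
  assumes a: "0 < a" "0 < h" and u: "u \<in> L2" "AE x in M. 0 \<le> u x"
  shows "(\<lambda>x. enn2real (orb_int u a h x), \<lambda>x. W (a + h) u x - W a u x) \<in> generator M 2 W"
proof -
  have um: "u \<in> borel_measurable M" using u(1) by (rule Lp_measurable)
  define U where "U x = enn2real (orb_int u a h x)" for x
  have UL: "U \<in> L2" unfolding U_def[abs_def] using a u by (intro orb_int_L2)
  have ah: "0 < a + h" using a by simp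
  have AL: "W (a + h) u \<in> L2" "W a u \<in> L2" using a u by (auto intro: W_L2)
  define A1 where "A1 t x = enn2real (orb_int u (a + h) t x) / t - W (a + h) u x" for t x
  define A0 where "A0 t x = enn2real (orb_int u a t x) / t - W a u x" for t x
  \<comment> \<open>By \<open>Lp2_diff\<close> the square root majorises the norm of
    \<open>A1 t - A0 t\<close>.\<close>
  have lim: "((\<lambda>t. sqrt (2 * (nrm (A1 t))\<^sup>2 + 2 * (nrm (A0 t))\<^sup>2)) \<longlongrightarrow> sqrt (2 * 0\<^sup>2 + 2 * 0\<^sup>2)) (at_right 0)"
    unfolding A1_def A0_def
    by (intro tendsto_intros orb_int_average_tendsto ah a u)
  have le: "0 \<le> nrm (\<lambda>x. (W t U x - U x) / t - (W (a + h) u x - W a u x)) \<and>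
      nrm (\<lambda>x. (W t U x - U x) / t - (W (a + h) u x - W a u x)) \<le> sqrt (2 * (nrm (A1 t))\<^sup>2 + 2 * (nrm (A0 t))\<^sup>2)"
    if t: "0 < t" for t
  proof -
    have A1L: "A1 t \<in> L2" unfolding A1_def
      using Lp2_diff(1)[OF Lp2_cmult(1)[OF orb_int_L2(2)[OF ah t u], of "1 / t"] AL(1)] by simp
    have A0L: "A0 t \<in> L2" unfolding A0_def
      using Lp2_diff(1)[OF Lp2_cmult(1)[OF orb_int_L2(2)[OF a(1) t u], of "1 / t"] AL(2)] by simp
    have at: "0 < a + t" using a t by simp
    have eq: "AE x in M. (W t U x - U x) / t - (W (a + h) u x - W a u x) = A1 t x - A0 t x"
      using W_orb_int[OF a t u] orb_int_L2(1)[OF a(1) t u] orb_int_L2(1)[OF at a(2) u]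
        orb_int_L2(1)[OF a u] orb_int_L2(1)[OF ah t u] AE_space
    proof eventually_elim
      case (elim x)
      have "enn2real (orb_int u a t x + orb_int u (a + t) h x) = enn2real (orb_int u a h x + orb_int u (a + h) t x)"
        using orb_int_shift[OF a t _ um] elim by simp
      then have "enn2real (orb_int u a t x) + enn2real (orb_int u (a + t) h x) = enn2real (orb_int u a h x) + enn2real (orb_int u (a + h) t x)"
        using elim by (simp add: enn2real_plus)
      moreover have "W t U x = enn2real (orb_int u (a + t) h x)" using elim(1) by (simp add: U_def[abs_def])
      ultimately have "W t U x - U x = enn2real (orb_int u (a + h) t x) - enn2real (orb_int u a t x)"
        by (simp add: U_def)
      then show ?case by (simp add: A1_def A0_def diff_divide_distrib)
    qed
    have L: "(\<lambda>x. (W t U x - U x) / t - (W (a + h) u x - W a u x)) \<in> L2"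
      using Lp2_diff(1)[OF Lp2_cmult(1)[OF Lp2_diff(1)[OF W_L2[OF less_imp_le[OF t] UL] UL], of "1 / t"] Lp2_diff(1)[OF AL]]
      by simp
    have "nrm (\<lambda>x. (W t U x - U x) / t - (W (a + h) u x - W a u x)) = nrm (\<lambda>x. A1 t x - A0 t x)"
      by (rule nrm_cong[OF L Lp2_diff(1)[OF A1L A0L] eq])
    also have "\<dots> \<le> sqrt (2 * (nrm (A1 t))\<^sup>2 + 2 * (nrm (A0 t))\<^sup>2)"
      by (rule real_le_rsqrt) (rule Lp2_diff(2)[OF A1L A0L])
    finally show ?thesis using Lp_norm_nonneg[OF L] by simp
  qed
  have "((\<lambda>t. nrm (\<lambda>x. (W t U x - U x) / t - (W (a + h) u x - W a u x))) \<longlongrightarrow> 0) (at_right 0)"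
  proof (rule tendsto_sandwich[OF _ _ tendsto_const])
    show "((\<lambda>t. sqrt (2 * (nrm (A1 t))\<^sup>2 + 2 * (nrm (A0 t))\<^sup>2)) \<longlongrightarrow> 0) (at_right 0)" using lim by simp
    show "\<forall>\<^sub>F t in at_right 0. 0 \<le> nrm (\<lambda>x. (W t U x - U x) / t - (W (a + h) u x - W a u x))"
      using eventually_at_right_less[of "0 :: real"] by eventually_elim (rule le[THEN conjunct1])
    show "\<forall>\<^sub>F t in at_right 0. nrm (\<lambda>x. (W t U x - U x) / t - (W (a + h) u x - W a u x)) \<le> sqrt (2 * (nrm (A1 t))\<^sup>2 + 2 * (nrm (A0 t))\<^sup>2)"
      using eventually_at_right_less[of "0 :: real"] by eventually_elim (rule le[THEN conjunct2])
  qed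
  then show ?thesis
    using UL Lp2_diff(1)[OF AL] by (simp add: generator_def U_def[abs_def])
qed


section \<open>Scalar orbit functions and the weak-star generator\<close>

definition corr :: "('a \<Rightarrow> real) \<Rightarrow> ('a \<Rightarrow> real) \<Rightarrow> real \<Rightarrow> ennreal" where
  "corr u v r = (\<integral>\<^sup>+x. orb u r x * ennreal (v x) \<partial>M)"

lemma corr_measurable [measurable (raw)]:
  assumes [measurable]: "u \<in> borel_measurable M" "v \<in> borel_measurable M" "f \<in> borel_measurable N"
  shows "(\<lambda>x. corr u v (f x)) \<in> borel_measurable N"
  unfolding corr_def by measurable

lemma corr_eq_pairing:
  assumes "0 < r" "u \<in> L2" "AE x in M. 0 \<le> u x" "v \<in> L2" "AE x in M. 0 \<le> v x"
  shows "corr u v r = ennreal (pairing M (W r u) v)" "0 \<le> pairing M (W r u) v"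
proof -
  show "corr u v r = ennreal (pairing M (W r u) v)" unfolding corr_def by (rule nn_integral_orb_pairing[OF assms])
  have "AE x in M. 0 \<le> W r u x" using assms by (intro W_nonneg) auto
  with assms(5) have "AE x in M. 0 \<le> W r u x * v x" by eventually_elim simp
  then show "0 \<le> pairing M (W r u) v"
    unfolding pairing_def by (rule integral_nonneg_AE)
qed

lemma pairing_cong: "AE x in M. u x = w x \<Longrightarrow> u \<in> L2 \<Longrightarrow> w \<in> L2 \<Longrightarrow> v \<in> L2 \<Longrightarrow> pairing M u v = pairing M w v"
proof -
  assume *: "AE x in M. u x = w x" "u \<in> L2" "w \<in> L2" "v \<in> L2"
  have [measurable]: "u \<in> borel_measurable M" "w \<in> borel_measurable M" "v \<in> borel_measurable M"
    using *(2-4) by (simp_all only: Lp_measurable)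
  show "pairing M u v = pairing M w v"
    unfolding pairing_def by (rule integral_cong_AE) (measurable, use *(1) in eventually_elim, simp)
qed

lemma pairing_diff: "u \<in> L2 \<Longrightarrow> w \<in> L2 \<Longrightarrow> v \<in> L2 \<Longrightarrow> pairing M (\<lambda>x. u x - w x) v = pairing M u v - pairing M w v"
  unfolding pairing_def by (simp add: left_diff_distrib integrable_mult_Lp2)

lemma pairing_eq_nn_integral:
  assumes [measurable]: "u \<in> borel_measurable M" "v \<in> borel_measurable M"
    and "AE x in M. 0 \<le> u x" "AE x in M. 0 \<le> v x"
  shows "pairing M u v = enn2real (\<integral>\<^sup>+x. ennreal (u x) * ennreal (v x) \<partial>M)"
proof -
  have "pairing M u v = enn2real (\<integral>\<^sup>+x. ennreal (u x * v x) \<partial>M)"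
    unfolding pairing_def
    by (rule integral_eq_nn_integral) (measurable, use assms(3,4) in eventually_elim, simp)
  also have "(\<integral>\<^sup>+x. ennreal (u x * v x) \<partial>M) = (\<integral>\<^sup>+x. ennreal (u x) * ennreal (v x) \<partial>M)"
    by (rule nn_integral_cong_AE, use assms(3,4) in eventually_elim) (simp add: ennreal_mult)
  finally show ?thesis .
qed

lemma pairing_right_continuous:
  assumes c: "0 \<le> c" and u: "u \<in> L2" and v: "v \<in> L2" and e: "0 < e"
  obtains d where "0 < d" "\<And>s. 0 \<le> s \<Longrightarrow> s < d \<Longrightarrow> \<bar>pairing M (W (c + s) u) v - pairing M (W c u) v\<bar> < e"
proof -
  have nv: "0 \<le> nrm v" using v by (rule Lp_norm_nonneg)
  then have "0 < e / (nrm v + 1)" using e by simp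
  from W_right_continuous[OF c u this]
  obtain d where d: "0 < d" "\<And>s. 0 \<le> s \<Longrightarrow> s < d \<Longrightarrow> nrm (\<lambda>x. W (c + s) u x - W c u x) < e / (nrm v + 1)"
    by metis
  have "\<bar>pairing M (W (c + s) u) v - pairing M (W c u) v\<bar> < e" if s: "0 \<le> s" "s < d" for s
  proof -
    have L: "W (c + s) u \<in> L2" "W c u \<in> L2" using c s u by (auto intro: W_L2)
    have "\<bar>pairing M (W (c + s) u) v - pairing M (W c u) v\<bar> = \<bar>pairing M (\<lambda>x. W (c + s) u x - W c u x) v\<bar>"
      using L v by (simp add: pairing_diff)
    also have "\<dots> \<le> nrm (\<lambda>x. W (c + s) u x - W c u x) * nrm v"
      using L v by (intro pairing_bound_Lp2 Lp2_diff)
    also have "\<dots> \<le> e / (nrm v + 1) * nrm v" using d(2)[OF s] nv by (intro mult_right_mono) auto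
    also have "\<dots> < e" using nv e by (simp add: field_simps)
    finally show ?thesis .
  qed
  with d(1) show thesis by (rule that)
qed

text \<open>At the ends of the line \<open>a + b = t\<close> both arguments of \<open>F\<close>
  move: the time of \<open>S\<close> and the vector \<open>T a u\<close> to which it is applied.
  Local boundedness makes the dependence on the vector uniform in time.\<close>

lemma pairing_jointly_right_continuous:
  assumes c: "0 \<le> c" and w: "w \<in> L2" and v: "v \<in> L2" and e: "0 < e"
  obtains d where "0 < d"
    "\<And>s w'. 0 \<le> s \<Longrightarrow> s < d \<Longrightarrow> w' \<in> L2 \<Longrightarrow> nrm (\<lambda>x. w' x - w x) < d \<Longrightarrow> \<bar>pairing M (W (c + s) w') v - pairing M (W c w) v\<bar> < e"
proof -
  obtain B where B: "0 \<le> B" "\<And>t u. 0 \<le> t \<Longrightarrow> t \<le> c + 1 \<Longrightarrow> u \<in> L2 \<Longrightarrow> nrm (W t u) \<le> B * nrm u"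
    using W_locally_bounded[of "c + 1"] by blast
  have "0 < e / 2" using e by simp
  from pairing_right_continuous[OF c w v this]
  obtain d where d: "0 < d" "\<And>s. 0 \<le> s \<Longrightarrow> s < d \<Longrightarrow> \<bar>pairing M (W (c + s) w) v - pairing M (W c w) v\<bar> < e / 2" by blast
  have nv: "0 \<le> nrm v" using v by (rule Lp_norm_nonneg)
  define k where "k = B * nrm v + 1"
  have k: "0 < k" "B * nrm v \<le> k" using B nv by (auto simp: k_def intro: add_nonneg_pos)
  \<comment> \<open>The three bounds keep \<open>c + s\<close> in the range where \<open>B\<close>
    is valid, make the time increment harmless, and limit the change of the vector to
    \<open>e / (2 * k)\<close>, which contributes at most \<open>e / 2\<close>. The summand 1 in
    \<open>k\<close> keeps \<open>k\<close> positive.\<close>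
  define d' where "d' = min 1 (min d (e / (2 * k)))"
  have d': "0 < d'" "d' \<le> 1" "d' \<le> d" "d' \<le> e / (2 * k)" using d e k by (auto simp: d'_def)
  have "\<bar>pairing M (W (c + s) w') v - pairing M (W c w) v\<bar> < e"
    if s: "0 \<le> s" "s < d'" and w': "w' \<in> L2" "nrm (\<lambda>x. w' x - w x) < d'" for s w'
  proof -
    have cs: "0 \<le> c + s" "c + s \<le> c + 1" using c s d' by auto
    have DL: "(\<lambda>x. w' x - w x) \<in> L2" using w w' by (intro Lp2_diff)
    have L: "W (c + s) w' \<in> L2" "W (c + s) w \<in> L2" "W (c + s) (\<lambda>x. w' x - w x) \<in> L2"
      using W_L2[OF cs(1)] w w' DL by auto
    have "AE x in M. W (c + s) w' x - W (c + s) w x = W (c + s) (\<lambda>x. w' x - w x) x"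
      using W_diff[OF cs(1) w'(1) w] by eventually_elim simp
    then have "pairing M (W (c + s) w') v - pairing M (W (c + s) w) v = pairing M (W (c + s) (\<lambda>x. w' x - w x)) v"
      unfolding pairing_diff[OF L(1,2) v, symmetric] by (rule pairing_cong[OF _ Lp2_diff(1)[OF L(1,2)] L(3) v])
    then have "\<bar>pairing M (W (c + s) w') v - pairing M (W (c + s) w) v\<bar> \<le> nrm (W (c + s) (\<lambda>x. w' x - w x)) * nrm v"
      using pairing_bound_Lp2[OF L(3) v] by simp
    also have "\<dots> \<le> (B * nrm (\<lambda>x. w' x - w x)) * nrm v" using B(2)[OF cs DL] nv by (rule mult_right_mono)
    also have "\<dots> = (B * nrm v) * nrm (\<lambda>x. w' x - w x)" by simp
    also have "\<dots> \<le> k * (e / (2 * k))"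
      using w'(2) d'(4) k Lp_norm_nonneg[OF DL] by (intro mult_mono) auto
    also have "\<dots> = e / 2" using k by simp
    finally have "\<bar>pairing M (W (c + s) w') v - pairing M (W (c + s) w) v\<bar> \<le> e / 2" .
    moreover have "\<bar>pairing M (W (c + s) w) v - pairing M (W c w) v\<bar> < e / 2" using d(2)[of s] s d' by auto
    ultimately show ?thesis by linarith
  qed
  with d'(1) show thesis by (rule that)
qed

lemma corr_average_tendsto:
  assumes c: "0 < c" and u: "u \<in> L2" "AE x in M. 0 \<le> u x" and v: "v \<in> L2" "AE x in M. 0 \<le> v x"
  shows "((\<lambda>t. enn2real (\<integral>\<^sup>+r\<in>{c<..<c + t}. corr u v r \<partial>lborel) / t) \<longlongrightarrow> pairing M (W c u) v) (at_right 0)"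
proof (rule averages_tendsto_of_right_continuous)
  show "(\<lambda>r. corr u v r) \<in> borel_measurable borel" using u v by measurable
  show "0 \<le> pairing M (W c u) v" using corr_eq_pairing[OF c u v] by simp
  fix e :: real assume "0 < e"
  obtain d where d: "0 < d" "\<And>s. 0 \<le> s \<Longrightarrow> s < d \<Longrightarrow> \<bar>pairing M (W (c + s) u) v - pairing M (W c u) v\<bar> < e"
    using pairing_right_continuous[OF less_imp_le[OF c] u(1) v(1) \<open>0 < e\<close>] by blast
  have "ennreal (pairing M (W c u) v - e) \<le> corr u v (c + s) \<and> corr u v (c + s) \<le> ennreal (pairing M (W c u) v + e)"
    if s: "0 < s" "s < d" for s
  proof -
    have cs: "0 < c + s" using c s by simp
    have "\<bar>pairing M (W (c + s) u) v - pairing M (W c u) v\<bar> < e" using d(2)[of s] s by simp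
    then show ?thesis unfolding corr_eq_pairing(1)[OF cs u v] by (intro conjI ennreal_leI) linarith+
  qed
  then show "\<exists>d>0. \<forall>s. 0 < s \<and> s < d \<longrightarrow> ennreal (pairing M (W c u) v - e) \<le> corr u v (c + s) \<and> corr u v (c + s) \<le> ennreal (pairing M (W c u) v + e)"
    using d(1) by blast
qed

lemma dual_orb_int_pairing:
  assumes b: "0 < b" "0 < h" and u: "u \<in> L2" "AE x in M. 0 \<le> u x" and v: "v \<in> L2" "AE x in M. 0 \<le> v x"
  shows "pairing M u (\<lambda>x. enn2real (dual_orb_int v b h x)) = enn2real (\<integral>\<^sup>+r\<in>{b<..<b + h}. corr u v r \<partial>lborel)"
proof -
  have [measurable]: "u \<in> borel_measurable M" "v \<in> borel_measurable M" using u(1) v(1) by (auto intro: Lp_measurable)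
  have "pairing M u (\<lambda>x. enn2real (dual_orb_int v b h x)) = enn2real (\<integral>\<^sup>+x. ennreal (u x) * ennreal (enn2real (dual_orb_int v b h x)) \<partial>M)"
    using u by (intro pairing_eq_nn_integral) auto
  also have "(\<integral>\<^sup>+x. ennreal (u x) * ennreal (enn2real (dual_orb_int v b h x)) \<partial>M) = (\<integral>\<^sup>+x. dual_orb_int v b h x * ennreal (u x) \<partial>M)"
    by (rule nn_integral_cong_AE, use dual_orb_int_L2(1)[OF b v] in eventually_elim) (simp add: less_top mult.commute)
  also have "\<dots> = (\<integral>\<^sup>+r\<in>{b<..<b + h}. corr u v r \<partial>lborel)"
  proof -
    have "corr u v r = (\<integral>\<^sup>+x. dual_orb v r x * ennreal (u x) \<partial>M)" for r
      unfolding corr_def by (subst orb_dual_orb) (simp_all add: mult.commute)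
    then show ?thesis by (subst nn_integral_dual_orb_int) simp_all
  qed
  finally show ?thesis .
qed

lemma dual_orb_pairing:
  assumes b: "0 < b" and u: "u \<in> L2" "AE x in M. 0 \<le> u x" and v: "v \<in> L2" "AE x in M. 0 \<le> v x"
  shows "pairing M u (\<lambda>x. enn2real (dual_orb v b x)) = pairing M (W b u) v"
proof -
  have [measurable]: "u \<in> borel_measurable M" "v \<in> borel_measurable M" using u(1) v(1) by (auto intro: Lp_measurable)
  have "pairing M u (\<lambda>x. enn2real (dual_orb v b x)) = enn2real (\<integral>\<^sup>+x. ennreal (u x) * ennreal (enn2real (dual_orb v b x)) \<partial>M)"
    using u by (intro pairing_eq_nn_integral) auto
  also have "(\<integral>\<^sup>+x. ennreal (u x) * ennreal (enn2real (dual_orb v b x)) \<partial>M) = (\<integral>\<^sup>+x. ennreal (u x) * dual_orb v b x \<partial>M)"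
    by (rule nn_integral_cong_AE, use dual_orb_L2(1)[OF b v] in eventually_elim) (simp add: less_top)
  also have "\<dots> = corr u v b" by (simp add: corr_def orb_dual_orb)
  finally show ?thesis using corr_eq_pairing[OF b u v] by simp
qed

lemma nn_integral_corr_finite:
  assumes c: "0 < c" "0 \<le> t" and u: "u \<in> L2" "AE x in M. 0 \<le> u x" and v: "v \<in> L2" "AE x in M. 0 \<le> v x"
  shows "(\<integral>\<^sup>+r\<in>{c<..<c + t}. corr u v r \<partial>lborel) < \<infinity>"
proof -
  define t0 where "t0 = t"
  obtain B where B: "0 \<le> B" "\<And>t u v. 0 < t \<Longrightarrow> t \<le> c + t0 \<Longrightarrow> u \<in> L2 \<Longrightarrow> AE x in M. 0 \<le> u x \<Longrightarrow> v \<in> L2 \<Longrightarrow> AE x in M. 0 \<le> v x \<Longrightarrow>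
    (\<integral>\<^sup>+x. orb u t x * ennreal (v x) \<partial>M) \<le> ennreal (B * nrm u * nrm v)"
    using orb_L2_bound[of "c + t0"] by blast
  have "(\<integral>\<^sup>+r\<in>{c<..<c + t}. corr u v r \<partial>lborel) \<le> ennreal (B * nrm u * nrm v * t)"
    unfolding corr_def
    by (rule interval_bound[OF c]) (use c B u v in \<open>auto simp: t0_def intro!: B(2) mult_nonneg_nonneg Lp_norm_nonneg\<close>)
  then show ?thesis by (rule le_less_trans) simp
qed

text \<open>The weak-star limit is tested against each \<open>u\<close> separately, so continuity of
  scalar functions suffices and the dual semigroup enters only through pairings. For
  \<open>u \<ge> 0\<close> the difference quotient telescopes as for the generator; a general
  \<open>u\<close> is split into its positive and negative parts.\<close>

lemma dual_orb_int_weak_star_generator: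
  assumes b: "0 < b" "0 < h" and v: "v \<in> L2" "AE x in M. 0 \<le> v x"
  shows "(\<lambda>x. enn2real (dual_orb_int v b h x), \<lambda>x. enn2real (dual_orb v (b + h) x) - enn2real (dual_orb v b x))
    \<in> weak_star_generator M 2 2 W"
proof -
  define V where "V x = enn2real (dual_orb_int v b h x)" for x
  define A where "A x = enn2real (dual_orb v (b + h) x) - enn2real (dual_orb v b x)" for x
  have bh: "0 < b + h" using b by simp
  have VL: "V \<in> L2" unfolding V_def[abs_def] using b v by (intro dual_orb_int_L2)
  have DL: "(\<lambda>x. enn2real (dual_orb v (b + h) x)) \<in> L2" "(\<lambda>x. enn2real (dual_orb v b x)) \<in> L2"
    using dual_orb_L2(2)[OF bh v] dual_orb_L2(2)[OF b(1) v] by auto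
  have AL: "A \<in> L2" unfolding A_def[abs_def] by (rule Lp2_diff(1)[OF DL])
  have vm [measurable]: "v \<in> borel_measurable M" using v(1) by (rule Lp_measurable)
  have pA: "pairing M u A = pairing M u (\<lambda>x. enn2real (dual_orb v (b + h) x)) - pairing M u (\<lambda>x. enn2real (dual_orb v b x))"
    if "u \<in> L2" for u
    unfolding pairing_def A_def using integrable_mult_Lp2[OF that DL(1)] integrable_mult_Lp2[OF that DL(2)]
    by (simp add: right_diff_distrib)
  have pos: "((\<lambda>t. 1 / t * (pairing M (W t u) V - pairing M u V)) \<longlongrightarrow> pairing M u A) (at_right 0)"
    if u: "u \<in> L2" "AE x in M. 0 \<le> u x" for u
  proof -
    have um [measurable]: "u \<in> borel_measurable M" using u(1) by (rule Lp_measurable)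
    let ?\<Phi> = "\<lambda>c t. \<integral>\<^sup>+r\<in>{c<..<c + t}. corr u v r \<partial>lborel"
    have eq: "enn2real (?\<Phi> (b + h) t) / t - enn2real (?\<Phi> b t) / t = 1 / t * (pairing M (W t u) V - pairing M u V)" if t: "0 < t" for t
    proof -
      have WL: "W t u \<in> L2" "AE x in M. 0 \<le> W t u x" using W_L2[of t u] W_nonneg[of t u] t u by auto
      \<comment> \<open>By the semigroup law, applying \<open>W t\<close> to \<open>u\<close> only
        shifts the time.\<close>
      have "corr (W t u) v r = corr u v (t + r)" if r: "0 < r" for r
      proof -
        have tr: "0 < t + r" using t r by simp
        have "AE x in M. W (r + t) u x = W r (W t u) x" using r t u by (intro W_semigroup) auto
        then have "pairing M (W (r + t) u) v = pairing M (W r (W t u)) v"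
          using r t u v WL by (intro pairing_cong W_L2) auto
        then show ?thesis unfolding corr_eq_pairing(1)[OF r WL v] corr_eq_pairing(1)[OF tr u v] by (simp add: add.commute)
      qed
      then have "(\<integral>\<^sup>+r\<in>{b<..<b + h}. corr (W t u) v r \<partial>lborel) = (\<integral>\<^sup>+r\<in>{b<..<b + h}. corr u v (t + r) \<partial>lborel)"
        using b by (intro nn_integral_cong) (simp split: split_indicator)
      also have "\<dots> = (\<integral>\<^sup>+r\<in>{t + b<..<t + (b + h)}. corr u v r \<partial>lborel)"
        by (rule nn_integral_shift) measurable
      also have "\<dots> = ?\<Phi> (b + t) h" by (simp add: ac_simps)
      finally have p1: "pairing M (W t u) V = enn2real (?\<Phi> (b + t) h)"
        using dual_orb_int_pairing[OF b WL v] by (simp add: V_def[abs_def])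
      have p0: "pairing M u V = enn2real (?\<Phi> b h)"
        using dual_orb_int_pairing[OF b u v] by (simp add: V_def[abs_def])
      have bt: "0 < b + t" using b t by simp
      have m: "(\<lambda>r. corr u v r) \<in> borel_measurable borel" by measurable
      have "?\<Phi> b (h + t) = ?\<Phi> b h + ?\<Phi> (b + h) t"
        using nn_integral_split[OF m, of b "b + h" "b + (h + t)"] b t by (simp add: add.assoc)
      moreover have "?\<Phi> b (h + t) = ?\<Phi> b t + ?\<Phi> (b + t) h"
        using nn_integral_split[OF m, of b "b + t" "b + (h + t)"] b t by (simp add: ac_simps)
      \<comment> \<open>Both sides are the integral over the interval from \<open>b\<close> to
        \<open>b + h + t\<close>; finiteness of the four parts makes subtraction legitimate.\<close>
      ultimately have sum: "?\<Phi> b h + ?\<Phi> (b + h) t = ?\<Phi> b t + ?\<Phi> (b + t) h" by simp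
      have fin: "?\<Phi> b h < \<infinity>" "?\<Phi> (b + h) t < \<infinity>" "?\<Phi> b t < \<infinity>" "?\<Phi> (b + t) h < \<infinity>"
        using nn_integral_corr_finite[OF b(1) _ u v, of h] nn_integral_corr_finite[OF bh _ u v, of t]
          nn_integral_corr_finite[OF b(1) _ u v, of t] nn_integral_corr_finite[OF bt _ u v, of h] b t
        by auto
      have "enn2real (?\<Phi> b h) + enn2real (?\<Phi> (b + h) t) = enn2real (?\<Phi> b h + ?\<Phi> (b + h) t)"
        using fin by (intro enn2real_plus[symmetric]) simp_all
      also have "\<dots> = enn2real (?\<Phi> b t) + enn2real (?\<Phi> (b + t) h)"
        unfolding sum using fin by (intro enn2real_plus) simp_all
      finally have "enn2real (?\<Phi> (b + h) t) - enn2real (?\<Phi> b t) = pairing M (W t u) V - pairing M u V"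
        unfolding p0 p1 by linarith
      then show ?thesis
        unfolding diff_divide_distrib[symmetric] times_divide_eq_left mult_1 by (rule arg_cong)
    qed
    have "((\<lambda>t. enn2real (?\<Phi> (b + h) t) / t - enn2real (?\<Phi> b t) / t) \<longlongrightarrow> pairing M (W (b + h) u) v - pairing M (W b u) v) (at_right 0)"
      by (intro tendsto_diff corr_average_tendsto bh b u v)
    moreover have "pairing M (W (b + h) u) v - pairing M (W b u) v = pairing M u A"
      unfolding pA[OF u(1)] dual_orb_pairing[OF bh u v] dual_orb_pairing[OF b(1) u v] ..
    ultimately have lim: "((\<lambda>t. enn2real (?\<Phi> (b + h) t) / t - enn2real (?\<Phi> b t) / t) \<longlongrightarrow> pairing M u A) (at_right 0)" by simp
    show ?thesis
      by (rule Lim_transform_eventually[OF lim], use eventually_at_right_less[of "0 :: real"] in eventually_elim) (rule eq)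
  qed
  have "((\<lambda>t. 1 / t * (pairing M (W t u) V - pairing M u V)) \<longlongrightarrow> pairing M u A) (at_right 0)"
    if u: "u \<in> L2" for u
  proof -
    have um [measurable]: "u \<in> borel_measurable M" using u by (rule Lp_measurable)
    define u1 where "u1 x = max 0 (u x)" for x
    define u2 where "u2 x = max 0 (- u x)" for x
    have u1m: "u1 \<in> borel_measurable M" and u2m: "u2 \<in> borel_measurable M"
      unfolding u1_def[abs_def] u2_def[abs_def] by measurable
    have u12: "u1 \<in> L2" "u2 \<in> L2"
      by (rule Lp_mono(1)[OF _ _ u u1m], simp_all add: u1_def)
        (rule Lp_mono(1)[OF _ _ u u2m], simp_all add: u2_def)
    have nn: "AE x in M. 0 \<le> u1 x" "AE x in M. 0 \<le> u2 x" by (auto simp: u1_def u2_def)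
    have ueq: "u = (\<lambda>x. u1 x - u2 x)" by (auto simp: u1_def u2_def max_def)
    have pu: "pairing M u w = pairing M u1 w - pairing M u2 w" if "w \<in> L2" for w
      unfolding ueq by (rule pairing_diff[OF u12 that])
    have eq: "1 / t * (pairing M (W t u1) V - pairing M u1 V) - 1 / t * (pairing M (W t u2) V - pairing M u2 V)
        = 1 / t * (pairing M (W t u) V - pairing M u V)" if t: "0 < t" for t
    proof -
      have WL: "W t u \<in> L2" "W t u1 \<in> L2" "W t u2 \<in> L2" using t u u12 by (auto intro: W_L2)
      have "AE x in M. W t u x = W t u1 x - W t u2 x"
        unfolding ueq using t u12 by (intro W_diff) auto
      then have "pairing M (W t u) V = pairing M (\<lambda>x. W t u1 x - W t u2 x) V"
        by (rule pairing_cong[OF _ WL(1) Lp2_diff(1)[OF WL(2,3)] VL])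
      also have "\<dots> = pairing M (W t u1) V - pairing M (W t u2) V" by (rule pairing_diff[OF WL(2,3) VL])
      finally have e: "pairing M (W t u) V = pairing M (W t u1) V - pairing M (W t u2) V" .
      show ?thesis unfolding pu[OF VL] e by (simp add: right_diff_distrib)
    qed
    have lim: "((\<lambda>t. 1 / t * (pairing M (W t u1) V - pairing M u1 V) - 1 / t * (pairing M (W t u2) V - pairing M u2 V))
       \<longlongrightarrow> pairing M u1 A - pairing M u2 A) (at_right 0)"
      by (intro tendsto_diff pos u12 nn)
    show ?thesis unfolding pu[OF AL]
      by (rule Lim_transform_eventually[OF lim], use eventually_at_right_less[of "0 :: real"] in eventually_elim) (rule eq)
  qed
  then show ?thesis
    using VL AL by (simp add: weak_star_generator_def dual_operator_def V_def[abs_def] A_def[abs_def])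
qed

section \<open>Extended integrals and the Lebesgue integrals of the theorem\<close>

definition kp :: "real \<Rightarrow> 'a \<Rightarrow> 'a \<Rightarrow> real" where
  "kp t x y = (if 0 < t then k t x y else 0)"

lemma kp_measurable [measurable (raw)]:
  assumes "f \<in> borel_measurable N" "g \<in> N \<rightarrow>\<^sub>M M" "h \<in> N \<rightarrow>\<^sub>M M"
  shows "(\<lambda>x. kp (f x) (g x) (h x)) \<in> borel_measurable N"
  unfolding kp_def by (rule k_measurable[OF assms])

text \<open>The two sides also agree where \<open>orb u t x\<close> is infinite: the Bochner
  integral is then 0 by convention, and so is \<open>enn2real \<infinity>\<close>. Unlike
  \<open>K\<close>, the function \<open>kp\<close> keeps the sign of the kernel, so nonnegativity
  has to be invoked.\<close>

lemma lebesgue_orb: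
  assumes t: "0 < t" and u: "u \<in> borel_measurable M" "AE x in M. 0 \<le> u x"
  shows "AE x in M. (LINT y|M. kp t x y * u y) = enn2real (orb u t x)"
  using kernel_nonneg_AE_AE[OF t] AE_space
proof eventually_elim
  case (elim x)
  note [measurable] = u(1)
  have [measurable]: "x \<in> space M" using elim by simp
  have "(LINT y|M. kp t x y * u y) = enn2real (\<integral>\<^sup>+y. ennreal (kp t x y * u y) \<partial>M)"
    by (rule integral_eq_nn_integral) (measurable, use elim(1) u(2) in eventually_elim, simp add: kp_def t)
  also have "(\<integral>\<^sup>+y. ennreal (kp t x y * u y) \<partial>M) = orb u t x"
    unfolding orb_def
    by (rule nn_integral_cong_AE, use elim(1) u(2) in eventually_elim) (simp add: kp_def K_def t ennreal_mult)
  finally show ?case .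
qed

lemma lebesgue_dual_orb:
  assumes t: "0 < t" and v: "v \<in> borel_measurable M" "AE x in M. 0 \<le> v x"
  shows "AE y in M. (LINT x|M. kp t x y * v x) = enn2real (dual_orb v t y)"
proof -
  have ms: "{z \<in> space (M \<Otimes>\<^sub>M M). 0 \<le> kp t (fst z) (snd z)} \<in> sets (M \<Otimes>\<^sub>M M)" by measurable
  have "AE x in M. AE y in M. 0 \<le> kp t x y" using kernel_nonneg_AE_AE[OF t] t by (simp add: kp_def)
  then have "AE y in M. AE x in M. 0 \<le> kp t x y" by (rule MM.AE_commute[OF ms, THEN iffD1])
  with AE_space show ?thesis
  proof eventually_elim
    case (elim y)
    note [measurable] = v(1)
    have [measurable]: "y \<in> space M" using elim by simp
    have "(LINT x|M. kp t x y * v x) = enn2real (\<integral>\<^sup>+x. ennreal (kp t x y * v x) \<partial>M)"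
      by (rule integral_eq_nn_integral) (measurable, use elim(2) v(2) in eventually_elim, simp)
    also have "(\<integral>\<^sup>+x. ennreal (kp t x y * v x) \<partial>M) = dual_orb v t y"
      unfolding dual_orb_def
      by (rule nn_integral_cong_AE, use elim(2) v(2) in eventually_elim) (simp add: kp_def K_def t ennreal_mult)
    finally show ?case .
  qed
qed

text \<open>In \<open>lebesgue_orb\<close> the exceptional set of points depends on the time. For a
  time integral at a fixed point the order has to be reversed, by joint measurability of
  \<open>P\<close>.\<close>

lemma lebesgue_orb_AE_AE:
  assumes [measurable]: "u \<in> borel_measurable M" and u: "AE x in M. 0 \<le> u x"
  shows "AE x in M. AE s in lborel. 0 < s \<longrightarrow> (LINT y|M. kp s x y * u y) = enn2real (orb u s x)"
proof -
  define P where "P s x \<longleftrightarrow> (0 < s \<longrightarrow> (LINT y|M. kp s x y * u y) = enn2real (orb u s x))" for s x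
  have Pm: "{z \<in> space (lborel \<Otimes>\<^sub>M M). P (fst z) (snd z)} \<in> sets (lborel \<Otimes>\<^sub>M M)"
    unfolding P_def by measurable
  have "AE x in M. P s x" for s
    unfolding P_def using lebesgue_orb[OF _ assms] by (cases "0 < s") auto
  then have "AE s in lborel. AE x in M. P s x" by (rule AE_I2)
  then have "AE x in M. AE s in lborel. P s x" by (rule TM.AE_commute[OF Pm, THEN iffD1])
  then show ?thesis unfolding P_def .
qed

lemma lebesgue_dual_orb_AE_AE:
  assumes [measurable]: "v \<in> borel_measurable M" and v: "AE x in M. 0 \<le> v x"
  shows "AE y in M. AE s in lborel. s < t \<longrightarrow> (LINT x|M. kp (t - s) x y * v x) = enn2real (dual_orb v (t - s) y)"
proof -
  define P where "P s y \<longleftrightarrow> (s < t \<longrightarrow> (LINT x|M. kp (t - s) x y * v x) = enn2real (dual_orb v (t - s) y))" for s y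
  have Pm: "{z \<in> space (lborel \<Otimes>\<^sub>M M). P (fst z) (snd z)} \<in> sets (lborel \<Otimes>\<^sub>M M)"
    unfolding P_def by measurable
  have "AE x in M. P s x" for s
    unfolding P_def using lebesgue_dual_orb[OF _ assms, of "t - s"] by (cases "s < t") auto
  then have "AE s in lborel. AE x in M. P s x" by (rule AE_I2)
  then have "AE x in M. AE s in lborel. P s x" by (rule TM.AE_commute[OF Pm, THEN iffD1])
  then show ?thesis unfolding P_def .
qed

lemma nn_integral_kernel_rectangle:
  assumes [measurable]: "A \<in> sets M" "B \<in> sets M"
  shows "(\<integral>\<^sup>+z. K t (fst z) (snd z) * indicator (A \<times> B) z \<partial>(M \<Otimes>\<^sub>M M)) = corr (indicator B) (indicator A) t"
proof -
  have "(\<integral>\<^sup>+z. K t (fst z) (snd z) * indicator (A \<times> B) z \<partial>(M \<Otimes>\<^sub>M M))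
      = (\<integral>\<^sup>+x. \<integral>\<^sup>+y. K t x y * indicator (A \<times> B) (x, y) \<partial>M \<partial>M)"
    by (subst nn_integral_fst[symmetric]) auto
  also have "\<dots> = (\<integral>\<^sup>+x. \<integral>\<^sup>+y. K t x y * ennreal (indicator B y) * ennreal (indicator A x) \<partial>M \<partial>M)"
    by (intro nn_integral_cong) (auto simp: indicator_def)
  also have "\<dots> = (\<integral>\<^sup>+x. orb (indicator B) t x * ennreal (indicator A x) \<partial>M)"
    unfolding orb_def by (intro nn_integral_cong nn_integral_multc) measurable
  finally show ?thesis unfolding corr_def .
qed

end

section \<open>Comparison of two semigroups\<close>

locale kernel_comparison =
  S: kernel_semigroup M S p p' kS + T: kernel_semigroup M T q q' kT
  for M :: "'a measure" and S T and p p' q q' :: ennreal and kS kT +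
  fixes f g' :: "'a \<Rightarrow> real" and C :: real
  assumes f: "f \<in> Lp M p" "AE x in M. 0 \<le> f x"
    and g': "g' \<in> Lp M q'" "AE x in M. 0 \<le> g' x"
    and C: "0 \<le> C"
    and form_ineq: "\<And>u Au v' Av'.
          (u, Au) \<in> generator M 2 T \<Longrightarrow> u \<in> Lp M q \<Longrightarrow> (AE x in M. 0 \<le> u x) \<Longrightarrow>
          (v', Av') \<in> weak_star_generator M 2 2 S \<Longrightarrow> v' \<in> Lp M p' \<Longrightarrow> (AE x in M. 0 \<le> v' x) \<Longrightarrow>
          pairing M Au v' \<le> pairing M u Av' + C * pairing M u g' * pairing M f v'"
begin

lemma f_measurable [measurable]: "f \<in> borel_measurable M" and g'_measurable [measurable]: "g' \<in> borel_measurable M"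
  using f(1) g'(1) Lp_measurable by auto

text \<open>The pairing is written with the two pointwise orbits, which makes joint measurability in
  \<open>(a, b)\<close> immediate. At \<open>a = 0\<close> or \<open>b = 0\<close> the value is 0,
  since the kernels are set to 0 there, so boundary values have to be obtained as limits.\<close>

definition F :: "('a \<Rightarrow> real) \<Rightarrow> ('a \<Rightarrow> real) \<Rightarrow> real \<Rightarrow> real \<Rightarrow> ennreal" where
  "F u v a b = (\<integral>\<^sup>+w. T.orb u a w * S.dual_orb v b w \<partial>M)"

lemma F_measurable [measurable (raw)]:
  assumes [measurable]: "u \<in> borel_measurable M" "v \<in> borel_measurable M" "j \<in> borel_measurable N" "k \<in> borel_measurable N"
  shows "(\<lambda>x. F u v (j x) (k x)) \<in> borel_measurable N"
  unfolding F_def by measurable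

context
  fixes u v :: "'a \<Rightarrow> real"
  assumes u: "u \<in> Lp M 2" "u \<in> Lp M q" "AE x in M. 0 \<le> u x"
    and v: "v \<in> Lp M 2" "v \<in> Lp M p'" "AE x in M. 0 \<le> v x"
begin

lemma uv_measurable [measurable]: "u \<in> borel_measurable M" "v \<in> borel_measurable M"
  using u(1) v(1) Lp_measurable by auto

lemma T_orbit:
  assumes "0 < a"
  shows "T a u \<in> Lp M 2" "AE x in M. 0 \<le> T a u x" "AE x in M. T.orb u a x = ennreal (T a u x)"
  using T.W_L2[of a u] T.W_nonneg[of a u] T.orb_eq_W[OF assms u(1,3)] u assms by auto

lemma F_eq_corr:
  assumes "0 < a"
  shows "F u v a b = S.corr (T a u) v b"
proof -
  have [measurable]: "T a u \<in> borel_measurable M" using T_orbit(1)[OF assms] by (rule Lp_measurable)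
  have "F u v a b = (\<integral>\<^sup>+w. ennreal (T a u w) * S.dual_orb v b w \<partial>M)"
    unfolding F_def by (rule nn_integral_cong_AE, use T_orbit(3)[OF assms] in eventually_elim) simp
  also have "\<dots> = S.corr (T a u) v b"
    unfolding S.corr_def by (rule S.orb_dual_orb[symmetric]) measurable
  finally show ?thesis .
qed

lemma F_eq_pairing:
  assumes "0 < a" "0 < b"
  shows "F u v a b = ennreal (pairing M (S b (T a u)) v)"
  unfolding F_eq_corr[OF assms(1)] by (rule S.corr_eq_pairing(1)[OF assms(2) T_orbit(1,2)[OF assms(1)] v(1,3)])

text \<open>\<open>F\<close> is bounded through the \<open>L\<^sub>2\<close> estimates of both
  semigroups, while the other two functions need the estimates in \<open>L\<^sub>q\<close> and
  \<open>L\<^sub>p\<close>, because \<open>g'\<close> and \<open>f\<close> need not be square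
  integrable.\<close>

lemma uniform_bound:
  obtains B where "\<And>a b. 0 < a \<Longrightarrow> a \<le> \<tau> \<Longrightarrow> 0 < b \<Longrightarrow> b \<le> \<tau> \<Longrightarrow> F u v a b \<le> ennreal B"
    "\<And>s. 0 < s \<Longrightarrow> s \<le> \<tau> \<Longrightarrow> T.corr u g' s \<le> ennreal B" "\<And>s. 0 < s \<Longrightarrow> s \<le> \<tau> \<Longrightarrow> S.corr f v s \<le> ennreal B"
proof -
  obtain B1 where B1: "0 \<le> B1" "\<And>t u v. 0 < t \<Longrightarrow> t \<le> \<tau> \<Longrightarrow> u \<in> Lp M 2 \<Longrightarrow> AE x in M. 0 \<le> u x \<Longrightarrow> v \<in> Lp M 2 \<Longrightarrow> AE x in M. 0 \<le> v x \<Longrightarrow>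
    (\<integral>\<^sup>+x. S.orb u t x * ennreal (v x) \<partial>M) \<le> ennreal (B1 * Lp_norm M 2 u * Lp_norm M 2 v)"
    using S.orb_L2_bound[of \<tau>] by blast
  obtain B2 where B2: "0 \<le> B2" "\<And>t u. 0 \<le> t \<Longrightarrow> t \<le> \<tau> \<Longrightarrow> u \<in> Lp M 2 \<Longrightarrow> Lp_norm M 2 (T t u) \<le> B2 * Lp_norm M 2 u"
    using T.W_locally_bounded[of \<tau>] by blast
  obtain B3 where B3: "0 \<le> B3" "\<And>t u v. 0 < t \<Longrightarrow> t \<le> \<tau> \<Longrightarrow> u \<in> Lp M q \<Longrightarrow> AE x in M. 0 \<le> u x \<Longrightarrow> v \<in> Lp M q' \<Longrightarrow>
    (\<integral>\<^sup>+x. T.orb u t x * ennreal (v x) \<partial>M) \<le> ennreal (B3 * Lp_norm M q u * Lp_norm M q' v)"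
    using T.orb_Lp_bound[of \<tau>] by blast
  obtain B4 where B4: "0 \<le> B4" "\<And>t u v. 0 < t \<Longrightarrow> t \<le> \<tau> \<Longrightarrow> u \<in> Lp M p \<Longrightarrow> AE x in M. 0 \<le> u x \<Longrightarrow> v \<in> Lp M p' \<Longrightarrow>
    (\<integral>\<^sup>+x. S.orb u t x * ennreal (v x) \<partial>M) \<le> ennreal (B4 * Lp_norm M p u * Lp_norm M p' v)"
    using S.orb_Lp_bound[of \<tau>] by blast
  define c1 where "c1 = B1 * (B2 * Lp_norm M 2 u) * Lp_norm M 2 v"
  define c2 where "c2 = B3 * Lp_norm M q u * Lp_norm M q' g'"
  define c3 where "c3 = B4 * Lp_norm M p f * Lp_norm M p' v"
  define B where "B = max c1 (max c2 c3)"
  have B: "c1 \<le> B" "c2 \<le> B" "c3 \<le> B" by (auto simp: B_def)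
  show thesis
  proof (rule that[of B])
    fix a b assume ab: "0 < a" "a \<le> \<tau>" "0 < b" "b \<le> \<tau>"
    have "F u v a b \<le> ennreal (B1 * Lp_norm M 2 (T a u) * Lp_norm M 2 v)"
      unfolding F_eq_corr[OF ab(1)] S.corr_def by (rule B1(2)[OF ab(3,4) T_orbit(1,2)[OF ab(1)] v(1,3)])
    also have "\<dots> \<le> ennreal c1"
      unfolding c1_def by (intro ennreal_leI mult_right_mono mult_left_mono B2 B1 u less_imp_le[OF ab(1)] ab(2) Lp_norm_nonneg[OF v(1)])
    also have "\<dots> \<le> ennreal B" using B(1) by (rule ennreal_leI)
    finally show "F u v a b \<le> ennreal B" .
  next
    fix s assume s: "0 < s" "s \<le> \<tau>"
    have "T.corr u g' s \<le> ennreal c2" unfolding T.corr_def c2_def by (rule B3(2)[OF s u(2,3) g'(1)])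
    also have "\<dots> \<le> ennreal B" using B(2) by (rule ennreal_leI)
    finally show "T.corr u g' s \<le> ennreal B" .
    have "S.corr f v s \<le> ennreal c3" unfolding S.corr_def c3_def by (rule B4(2)[OF s f v(2)])
    also have "\<dots> \<le> ennreal B" using B(3) by (rule ennreal_leI)
    finally show "S.corr f v s \<le> ennreal B" .
  qed
qed

text \<open>The four integrals of \<open>F\<close> run over the edges of the square with corners
  \<open>(a, b)\<close> and \<open>(a + h, b + h)\<close>. They are the pairings in the form
  inequality for the averages \<open>U\<close> and \<open>V\<close>: the generator turns
  \<open>U\<close> into an increment of the orbit of \<open>T\<close>, whose pairing with
  \<open>V\<close> gives the two edges with fixed first argument, and the dual generator gives the
  other two. Terms with negative sign are moved across, so that everything can be stated in
  \<open>ennreal\<close>.\<close>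

lemma step_inequality:
  assumes a: "0 < a" and b: "0 < b" and h: "0 < h"
  shows "(\<integral>\<^sup>+r\<in>{0<..<h}. F u v (a + h) (b + r) \<partial>lborel) + (\<integral>\<^sup>+r\<in>{0<..<h}. F u v (a + r) b \<partial>lborel)
       \<le> (\<integral>\<^sup>+r\<in>{0<..<h}. F u v (a + r) (b + h) \<partial>lborel) + (\<integral>\<^sup>+r\<in>{0<..<h}. F u v a (b + r) \<partial>lborel)
         + ennreal C * (\<integral>\<^sup>+r\<in>{0<..<h}. T.corr u g' (a + r) \<partial>lborel) * (\<integral>\<^sup>+r\<in>{0<..<h}. S.corr f v (b + r) \<partial>lborel)"
proof -
  have ah: "0 < a + h" and bh: "0 < b + h" using a b h by auto
  define \<tau> where "\<tau> = max (a + h) (b + h)"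
  obtain B where B: "\<And>a b. 0 < a \<Longrightarrow> a \<le> \<tau> \<Longrightarrow> 0 < b \<Longrightarrow> b \<le> \<tau> \<Longrightarrow> F u v a b \<le> ennreal B"
    "\<And>s. 0 < s \<Longrightarrow> s \<le> \<tau> \<Longrightarrow> T.corr u g' s \<le> ennreal B" "\<And>s. 0 < s \<Longrightarrow> s \<le> \<tau> \<Longrightarrow> S.corr f v s \<le> ennreal B"
    using uniform_bound[of \<tau>] by blast
  have fin: "(\<integral>\<^sup>+r\<in>{0<..<h}. G r \<partial>lborel) < \<infinity>" if "\<And>r. 0 < r \<Longrightarrow> r < h \<Longrightarrow> G r \<le> ennreal B" for G
  proof -
    have "(\<integral>\<^sup>+r\<in>{0<..<h}. G r \<partial>lborel) \<le> (\<integral>\<^sup>+r\<in>{0<..<h}. ennreal B \<partial>lborel)"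
      using that by (intro nn_integral_mono) (simp split: split_indicator)
    also have "\<dots> = ennreal B * ennreal (h - 0)" using h by (intro nn_integral_interval_const) simp
    also have "\<dots> < \<infinity>" by (simp add: ennreal_mult_less_top)
    finally show ?thesis .
  qed
  define V where "V x = enn2real (S.dual_orb_int v b h x)" for x
  define U where "U x = enn2real (T.orb_int u a h x)" for x
  define D where "D c x = enn2real (S.dual_orb v c x)" for c x
  have VL: "V \<in> Lp M 2" "V \<in> Lp M p'"
    unfolding V_def[abs_def] using S.dual_orb_int_L2(2)[OF b h v(1,3)] S.dual_orb_int_Lp'[OF b h v(2,3)] by auto
  have UL: "U \<in> Lp M 2" "U \<in> Lp M q"
    unfolding U_def[abs_def] using T.orb_int_L2(2)[OF a h u(1,3)] T.orb_int_Lp[OF a h u(2,3)] by auto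
  have DL: "D c \<in> Lp M 2" if "0 < c" for c unfolding D_def[abs_def] by (rule S.dual_orb_L2(2)[OF that v(1,3)])
  have nn: "AE x in M. 0 \<le> U x" "AE x in M. 0 \<le> V x" "AE x in M. 0 \<le> D c x" for c by (simp_all add: U_def V_def D_def)
  have Ueq: "AE x in M. ennreal (U x) = T.orb_int u a h x"
    using T.orb_int_L2(1)[OF a h u(1,3)] by eventually_elim (simp add: U_def less_top)
  have Veq: "AE x in M. ennreal (V x) = S.dual_orb_int v b h x"
    using S.dual_orb_int_L2(1)[OF b h v(1,3)] by eventually_elim (simp add: V_def less_top)
  have Deq: "AE x in M. ennreal (D c x) = S.dual_orb v c x" if "0 < c" for c
    using S.dual_orb_L2(1)[OF that v(1,3)] by eventually_elim (simp add: D_def less_top)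
  have [measurable]: "U \<in> borel_measurable M" "V \<in> borel_measurable M" using UL(1) VL(1) Lp_measurable by auto
  have [measurable]: "D c \<in> borel_measurable M" for c unfolding D_def[abs_def] by measurable
  have shift: "(\<integral>\<^sup>+r\<in>{c<..<c + h}. G r \<partial>lborel) = (\<integral>\<^sup>+r\<in>{0<..<h}. G (c + r) \<partial>lborel)"
    if "G \<in> borel_measurable borel" for c and G :: "real \<Rightarrow> ennreal"
    using nn_integral_shift[OF that, where a = 0 and b = h and c = c] by simp
  have pTV: "pairing M (T c u) V = enn2real (\<integral>\<^sup>+r\<in>{0<..<h}. F u v c (b + r) \<partial>lborel)" if c: "0 < c" for c
  proof -
    have [measurable]: "T c u \<in> borel_measurable M" using T_orbit(1)[OF c] by (rule Lp_measurable)
    have "pairing M (T c u) V = enn2real (\<integral>\<^sup>+x. ennreal (T c u x) * ennreal (V x) \<partial>M)"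
      by (rule S.pairing_eq_nn_integral) (use T_orbit(2)[OF c] nn in auto)
    also have "(\<integral>\<^sup>+x. ennreal (T c u x) * ennreal (V x) \<partial>M) = (\<integral>\<^sup>+x. S.dual_orb_int v b h x * T.orb u c x \<partial>M)"
      by (rule nn_integral_cong_AE, use T_orbit(3)[OF c] Veq in eventually_elim) (simp add: mult.commute)
    also have "\<dots> = (\<integral>\<^sup>+r\<in>{b<..<b + h}. F u v c r \<partial>lborel)"
      unfolding F_def by (subst S.nn_integral_dual_orb_int) (simp_all add: mult.commute)
    also have "\<dots> = (\<integral>\<^sup>+r\<in>{0<..<h}. F u v c (b + r) \<partial>lborel)" by (rule shift) measurable
    finally show ?thesis .
  qed
  have pUD: "pairing M U (D c) = enn2real (\<integral>\<^sup>+r\<in>{0<..<h}. F u v (a + r) c \<partial>lborel)" if c: "0 < c" for c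
  proof -
    have "pairing M U (D c) = enn2real (\<integral>\<^sup>+x. ennreal (U x) * ennreal (D c x) \<partial>M)"
      by (rule S.pairing_eq_nn_integral) (use nn in auto)
    also have "(\<integral>\<^sup>+x. ennreal (U x) * ennreal (D c x) \<partial>M) = (\<integral>\<^sup>+x. T.orb_int u a h x * S.dual_orb v c x \<partial>M)"
      by (rule nn_integral_cong_AE, use Ueq Deq[OF c] in eventually_elim) simp
    also have "\<dots> = (\<integral>\<^sup>+r\<in>{a<..<a + h}. F u v r c \<partial>lborel)"
      unfolding F_def by (subst T.nn_integral_orb_int) simp_all
    also have "\<dots> = (\<integral>\<^sup>+r\<in>{0<..<h}. F u v (a + r) c \<partial>lborel)" by (rule shift) measurable
    finally show ?thesis .
  qed
  have pUg: "pairing M U g' = enn2real (\<integral>\<^sup>+r\<in>{0<..<h}. T.corr u g' (a + r) \<partial>lborel)"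
  proof -
    have "pairing M U g' = enn2real (\<integral>\<^sup>+x. ennreal (U x) * ennreal (g' x) \<partial>M)"
      by (rule S.pairing_eq_nn_integral) (use nn g' in auto)
    also have "(\<integral>\<^sup>+x. ennreal (U x) * ennreal (g' x) \<partial>M) = (\<integral>\<^sup>+x. T.orb_int u a h x * ennreal (g' x) \<partial>M)"
      by (rule nn_integral_cong_AE, use Ueq in eventually_elim) simp
    also have "\<dots> = (\<integral>\<^sup>+r\<in>{a<..<a + h}. T.corr u g' r \<partial>lborel)"
      unfolding T.corr_def by (subst T.nn_integral_orb_int) simp_all
    also have "\<dots> = (\<integral>\<^sup>+r\<in>{0<..<h}. T.corr u g' (a + r) \<partial>lborel)" by (rule shift) measurable
    finally show ?thesis .
  qed
  have pfV: "pairing M f V = enn2real (\<integral>\<^sup>+r\<in>{0<..<h}. S.corr f v (b + r) \<partial>lborel)"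
  proof -
    have "pairing M f V = enn2real (\<integral>\<^sup>+x. ennreal (f x) * ennreal (V x) \<partial>M)"
      by (rule S.pairing_eq_nn_integral) (use nn f in auto)
    also have "(\<integral>\<^sup>+x. ennreal (f x) * ennreal (V x) \<partial>M) = (\<integral>\<^sup>+x. S.dual_orb_int v b h x * ennreal (f x) \<partial>M)"
      by (rule nn_integral_cong_AE, use Veq in eventually_elim) (simp add: mult.commute)
    also have "\<dots> = (\<integral>\<^sup>+r\<in>{b<..<b + h}. (\<integral>\<^sup>+x. S.dual_orb v r x * ennreal (f x) \<partial>M) \<partial>lborel)"
      by (rule S.nn_integral_dual_orb_int) measurable
    also have "\<dots> = (\<integral>\<^sup>+r\<in>{b<..<b + h}. S.corr f v r \<partial>lborel)"
    proof -
      have "S.corr f v r = (\<integral>\<^sup>+x. S.dual_orb v r x * ennreal (f x) \<partial>M)" for r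
        unfolding S.corr_def by (subst S.orb_dual_orb) (simp_all add: mult.commute)
      then show ?thesis by simp
    qed
    also have "\<dots> = (\<integral>\<^sup>+r\<in>{0<..<h}. S.corr f v (b + r) \<partial>lborel)" by (rule shift) measurable
    finally show ?thesis .
  qed
  define X1 where "X1 = (\<integral>\<^sup>+r\<in>{0<..<h}. F u v (a + h) (b + r) \<partial>lborel)"
  define X2 where "X2 = (\<integral>\<^sup>+r\<in>{0<..<h}. F u v (a + r) b \<partial>lborel)"
  define X3 where "X3 = (\<integral>\<^sup>+r\<in>{0<..<h}. F u v (a + r) (b + h) \<partial>lborel)"
  define X4 where "X4 = (\<integral>\<^sup>+r\<in>{0<..<h}. F u v a (b + r) \<partial>lborel)"
  define Y1 where "Y1 = (\<integral>\<^sup>+r\<in>{0<..<h}. T.corr u g' (a + r) \<partial>lborel)"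
  define Y2 where "Y2 = (\<integral>\<^sup>+r\<in>{0<..<h}. S.corr f v (b + r) \<partial>lborel)"
  have t: "a + h \<le> \<tau>" "b + h \<le> \<tau>" by (auto simp: \<tau>_def)
  \<comment> \<open>Finiteness lets the inequality pass from the real pairings to the extended
    integrals without loss through \<open>enn2real\<close>.\<close>
  have X: "X1 < \<infinity>" "X2 < \<infinity>" "X3 < \<infinity>" "X4 < \<infinity>" "Y1 < \<infinity>" "Y2 < \<infinity>"
    unfolding X1_def X2_def X3_def X4_def Y1_def Y2_def
    by (rule fin, rule B; use a b h t in linarith)+
  have "pairing M (\<lambda>x. T (a + h) u x - T a u x) V \<le> pairing M U (\<lambda>x. D (b + h) x - D b x) + C * pairing M U g' * pairing M f V"
  proof (rule form_ineq)
    show "(U, \<lambda>x. T (a + h) u x - T a u x) \<in> generator M 2 T"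
      unfolding U_def[abs_def] by (rule T.orb_int_generator[OF a h u(1,3)])
    show "(V, \<lambda>x. D (b + h) x - D b x) \<in> weak_star_generator M 2 2 S"
      unfolding V_def[abs_def] D_def by (rule S.dual_orb_int_weak_star_generator[OF b h v(1,3)])
  qed (use UL VL nn in auto)
  moreover have "pairing M (\<lambda>x. T (a + h) u x - T a u x) V = enn2real X1 - enn2real X4"
    unfolding S.pairing_diff[OF T_orbit(1)[OF ah] T_orbit(1)[OF a] VL(1)] pTV[OF ah] pTV[OF a] X1_def X4_def ..
  moreover have "pairing M U (\<lambda>x. D (b + h) x - D b x) = enn2real X3 - enn2real X2"
  proof -
    have "pairing M U (\<lambda>x. D (b + h) x - D b x) = pairing M U (D (b + h)) - pairing M U (D b)"
      unfolding pairing_def using integrable_mult_Lp2[OF UL(1) DL[OF bh]] integrable_mult_Lp2[OF UL(1) DL[OF b]]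
      by (simp add: right_diff_distrib)
    then show ?thesis unfolding pUD[OF bh] pUD[OF b] X3_def X2_def .
  qed
  ultimately have "enn2real X1 + enn2real X2 \<le> enn2real X3 + enn2real X4 + C * enn2real Y1 * enn2real Y2"
    unfolding pUg pfV Y1_def[symmetric] Y2_def[symmetric] by linarith
  then have "ennreal (enn2real X1 + enn2real X2) \<le> ennreal (enn2real X3 + enn2real X4 + C * enn2real Y1 * enn2real Y2)"
    by (rule ennreal_leI)
  also have "\<dots> = ennreal (enn2real X3) + ennreal (enn2real X4) + ennreal C * ennreal (enn2real Y1) * ennreal (enn2real Y2)"
    using C by (simp add: ennreal_plus ennreal_mult mult_nonneg_nonneg)
  also have "ennreal (enn2real X1 + enn2real X2) = ennreal (enn2real X1) + ennreal (enn2real X2)"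
    by (simp add: ennreal_plus)
  finally have "X1 + X2 \<le> X3 + X4 + ennreal C * Y1 * Y2"
    using X by (simp add: less_top)
  then show ?thesis unfolding X1_def X2_def X3_def X4_def Y1_def Y2_def .
qed

text \<open>What remains for \<open>diagonal_inequality\<close> is the behaviour at the ends: tested
  with \<open>v\<close>, the vectors \<open>S b (T (t + a) u)\<close> tend to \<open>T t u\<close>,
  and \<open>S (t + b) (T a u)\<close> to \<open>S t u\<close>.\<close>

lemma integrated_inequality:
  assumes t: "0 < t"
  shows "T.corr u v t \<le> S.corr u v t + ennreal C * (\<integral>\<^sup>+s\<in>{0<..<t}. T.corr u g' s * S.corr f v (t - s) \<partial>lborel)"
proof -
  obtain B where B: "\<And>a b. 0 < a \<Longrightarrow> a \<le> t + 2 \<Longrightarrow> 0 < b \<Longrightarrow> b \<le> t + 2 \<Longrightarrow> F u v a b \<le> ennreal B"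
    "\<And>s. 0 < s \<Longrightarrow> s \<le> t + 2 \<Longrightarrow> T.corr u g' s \<le> ennreal B" "\<And>s. 0 < s \<Longrightarrow> s \<le> t + 2 \<Longrightarrow> S.corr f v s \<le> ennreal B"
    using uniform_bound[of "t + 2"] by blast
  have nn: "0 \<le> pairing M (S t u) v" by (rule S.corr_eq_pairing(2)[OF t u(1,3) v(1,3)])
  note TL = T_orbit(1)[OF t]
  have "ennreal (pairing M (T t u) v) \<le> ennreal (pairing M (S t u) v)
      + ennreal C * (\<integral>\<^sup>+s\<in>{0<..<t}. T.corr u g' s * S.corr f v (t - s) \<partial>lborel)"
  proof (rule diagonal_inequality[where F = "F u v" and B = B])
    show "(\<lambda>(a, b). F u v a b) \<in> borel_measurable (borel \<Otimes>\<^sub>M borel)" by measurable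
    show "(\<lambda>s. T.corr u g' s) \<in> borel_measurable borel" "(\<lambda>s. S.corr f v s) \<in> borel_measurable borel" by measurable
    show "(\<integral>\<^sup>+r\<in>{0<..<h}. F u v (a + h) (b + r) \<partial>lborel) + (\<integral>\<^sup>+r\<in>{0<..<h}. F u v (a + r) b \<partial>lborel)
       \<le> (\<integral>\<^sup>+r\<in>{0<..<h}. F u v (a + r) (b + h) \<partial>lborel) + (\<integral>\<^sup>+r\<in>{0<..<h}. F u v a (b + r) \<partial>lborel)
         + ennreal C * (\<integral>\<^sup>+r\<in>{0<..<h}. T.corr u g' (a + r) \<partial>lborel) * (\<integral>\<^sup>+r\<in>{0<..<h}. S.corr f v (b + r) \<partial>lborel)"
      if "0 < a" "0 < b" "0 < h" for a b h
      by (rule step_inequality[OF that])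
    show "\<exists>d>0. \<forall>a b. 0 < a \<and> a < d \<and> 0 < b \<and> b < d \<longrightarrow> ennreal (pairing M (T t u) v - e) \<le> F u v (t + a) b" if e: "0 < e" for e
    proof -
      obtain d where d: "0 < d" "\<And>s w'. 0 \<le> s \<Longrightarrow> s < d \<Longrightarrow> w' \<in> Lp M 2 \<Longrightarrow> Lp_norm M 2 (\<lambda>x. w' x - T t u x) < d \<Longrightarrow>
          \<bar>pairing M (S (0 + s) w') v - pairing M (S 0 (T t u)) v\<bar> < e"
        using S.pairing_jointly_right_continuous[OF order_refl TL v(1) e] by blast
      obtain d2 where d2: "0 < d2" "\<And>s. 0 \<le> s \<Longrightarrow> s < d2 \<Longrightarrow> Lp_norm M 2 (\<lambda>x. T (t + s) u x - T t u x) < d"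
        using T.W_right_continuous[OF less_imp_le[OF t] u(1) d(1)] by blast
      \<comment> \<open>\<open>S 0\<close> is the identity only up to null sets, hence the passage
        through \<open>pairing_cong\<close>.\<close>
      have S0: "pairing M (S 0 (T t u)) v = pairing M (T t u) v"
        by (rule S.pairing_cong[OF S.W_0[OF TL] S.W_L2[OF order_refl TL] TL v(1)])
      have "ennreal (pairing M (T t u) v - e) \<le> F u v (t + a) b" if ab: "0 < a" "a < min d d2" "0 < b" "b < min d d2" for a b
      proof -
        have ta: "0 < t + a" using t ab by simp
        have "\<bar>pairing M (S (0 + b) (T (t + a) u)) v - pairing M (S 0 (T t u)) v\<bar> < e"
          using ab by (intro d(2) d2(2) T_orbit(1)[OF ta]) auto
        then show ?thesis unfolding F_eq_pairing[OF ta ab(3)] S0 add_0 by (intro ennreal_leI) linarith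
      qed
      then show ?thesis using d(1) d2(1) by (intro exI[of _ "min d d2"]) auto
    qed
    show "\<exists>d>0. \<forall>a b. 0 < a \<and> a < d \<and> 0 < b \<and> b < d \<longrightarrow> F u v a (t + b) \<le> ennreal (pairing M (S t u) v + e)" if e: "0 < e" for e
    proof -
      obtain d where d: "0 < d" "\<And>s w'. 0 \<le> s \<Longrightarrow> s < d \<Longrightarrow> w' \<in> Lp M 2 \<Longrightarrow> Lp_norm M 2 (\<lambda>x. w' x - u x) < d \<Longrightarrow>
          \<bar>pairing M (S (t + s) w') v - pairing M (S t u) v\<bar> < e"
        using S.pairing_jointly_right_continuous[OF less_imp_le[OF t] u(1) v(1) e] by blast
      obtain d2 where d2: "0 < d2" "\<And>s. 0 \<le> s \<Longrightarrow> s < d2 \<Longrightarrow> Lp_norm M 2 (\<lambda>x. T s u x - u x) < d"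
        using T.W_near_0[OF u(1) d(1)] by blast
      have "F u v a (t + b) \<le> ennreal (pairing M (S t u) v + e)" if ab: "0 < a" "a < min d d2" "0 < b" "b < min d d2" for a b
      proof -
        have tb: "0 < t + b" using t ab by simp
        have "\<bar>pairing M (S (t + b) (T a u)) v - pairing M (S t u) v\<bar> < e"
          using ab by (intro d(2) d2(2) T_orbit(1)[OF ab(1)]) auto
        then show ?thesis unfolding F_eq_pairing[OF ab(1) tb] by (intro ennreal_leI) linarith
      qed
      then show ?thesis using d(1) d2(1) by (intro exI[of _ "min d d2"]) auto
    qed
  qed (use t nn C B in auto)
  then show ?thesis
    unfolding T.corr_eq_pairing(1)[OF t u(1,3) v(1,3)] S.corr_eq_pairing(1)[OF t u(1,3) v(1,3)] .
qed

end


text \<open>The integral term of the theorem without the factor \<open>C\<close>, with values in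
  \<open>[0, \<infinity>]\<close>.\<close>

definition R :: "real \<Rightarrow> 'a \<Rightarrow> 'a \<Rightarrow> ennreal" where
  "R t x y = (\<integral>\<^sup>+s\<in>{0<..<t}. T.dual_orb g' (t - s) y * S.orb f s x \<partial>lborel)"

lemma R_measurable [measurable]: "(\<lambda>z. R t (fst z) (snd z)) \<in> borel_measurable (M \<Otimes>\<^sub>M M)"
  unfolding R_def by measurable

text \<open>For fixed \<open>s\<close> the integrand is a function of \<open>y\<close> times a
  function of \<open>x\<close>, so its integral over a rectangle factors into two scalar orbit
  functions.\<close>

lemma nn_integral_R_rectangle:
  assumes [measurable]: "A \<in> sets M" "B \<in> sets M"
  shows "(\<integral>\<^sup>+z. R t (fst z) (snd z) * indicator (A \<times> B) z \<partial>(M \<Otimes>\<^sub>M M))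
    = (\<integral>\<^sup>+s\<in>{0<..<t}. T.corr (indicator B) g' s * S.corr f (indicator A) (t - s) \<partial>lborel)"
proof -
  let ?u = "indicator B :: 'a \<Rightarrow> real" and ?v = "indicator A :: 'a \<Rightarrow> real"
  interpret Z: pair_sigma_finite lborel "M \<Otimes>\<^sub>M M" ..
  have "(\<integral>\<^sup>+z. R t (fst z) (snd z) * indicator (A \<times> B) z \<partial>(M \<Otimes>\<^sub>M M))
    = (\<integral>\<^sup>+z. (\<integral>\<^sup>+s. T.dual_orb g' (t - s) (snd z) * S.orb f s (fst z) * indicator {0<..<t} s * indicator (A \<times> B) z \<partial>lborel) \<partial>(M \<Otimes>\<^sub>M M))"
    unfolding R_def by (intro nn_integral_cong nn_integral_multc[symmetric]) measurable
  also have "\<dots> = (\<integral>\<^sup>+s. (\<integral>\<^sup>+z. T.dual_orb g' (t - s) (snd z) * S.orb f s (fst z) * indicator {0<..<t} s * indicator (A \<times> B) z \<partial>(M \<Otimes>\<^sub>M M)) \<partial>lborel)"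
    by (rule Z.Fubini') measurable
  also have "\<dots> = (\<integral>\<^sup>+s. T.corr ?u g' (t - s) * S.corr f ?v s * indicator {0<..<t} s \<partial>lborel)"
  proof (rule nn_integral_cong)
    fix s :: real
    have "(\<integral>\<^sup>+z. T.dual_orb g' (t - s) (snd z) * S.orb f s (fst z) * indicator {0<..<t} s * indicator (A \<times> B) z \<partial>(M \<Otimes>\<^sub>M M))
      = (\<integral>\<^sup>+x. \<integral>\<^sup>+y. T.dual_orb g' (t - s) y * S.orb f s x * indicator {0<..<t} s * indicator (A \<times> B) (x, y) \<partial>M \<partial>M)"
      by (subst S.nn_integral_fst[symmetric]) auto
    also have "\<dots> = (\<integral>\<^sup>+x. \<integral>\<^sup>+y. (ennreal (?u y) * T.dual_orb g' (t - s) y) * (S.orb f s x * ennreal (?v x) * indicator {0<..<t} s) \<partial>M \<partial>M)"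
      by (intro nn_integral_cong) (auto simp: indicator_def)
    also have "\<dots> = (\<integral>\<^sup>+x. (\<integral>\<^sup>+y. ennreal (?u y) * T.dual_orb g' (t - s) y \<partial>M) * (S.orb f s x * ennreal (?v x) * indicator {0<..<t} s) \<partial>M)"
      by (intro nn_integral_cong nn_integral_multc) measurable
    also have "(\<integral>\<^sup>+y. ennreal (?u y) * T.dual_orb g' (t - s) y \<partial>M) = T.corr ?u g' (t - s)"
      unfolding T.corr_def by (rule T.orb_dual_orb[symmetric]) measurable
    also have "(\<integral>\<^sup>+x. T.corr ?u g' (t - s) * (S.orb f s x * ennreal (?v x) * indicator {0<..<t} s) \<partial>M)
        = T.corr ?u g' (t - s) * (\<integral>\<^sup>+x. S.orb f s x * ennreal (?v x) * indicator {0<..<t} s \<partial>M)"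
      by (rule nn_integral_cmult) measurable
    also have "(\<integral>\<^sup>+x. S.orb f s x * ennreal (?v x) * indicator {0<..<t} s \<partial>M) = S.corr f ?v s * indicator {0<..<t} s"
      unfolding S.corr_def by (rule nn_integral_multc) measurable
    finally show "(\<integral>\<^sup>+z. T.dual_orb g' (t - s) (snd z) * S.orb f s (fst z) * indicator {0<..<t} s * indicator (A \<times> B) z \<partial>(M \<Otimes>\<^sub>M M))
      = T.corr ?u g' (t - s) * S.corr f ?v s * indicator {0<..<t} s"
      by (simp only: mult.assoc)
  qed
  \<comment> \<open>The reflection \<open>s \<mapsto> t - s\<close> brings the integral into the
    form that occurs in \<open>integrated_inequality\<close>.\<close>
  also have "\<dots> = (\<integral>\<^sup>+s. T.corr ?u g' s * S.corr f ?v (t - s) * indicator {0<..<t} s \<partial>lborel)"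
    by (subst nn_integral_real_affine[where c = "- 1" and t = t])
      (auto intro!: nn_integral_cong simp: indicator_def)
  finally show ?thesis .
qed

text \<open>Indicators of sets of finite measure lie in all spaces involved and may serve as
  \<open>u\<close> and \<open>v\<close>; \<open>integrated_inequality\<close> for them is the
  inequality on a rectangle. The rectangles \<open>E n \<times> E m\<close> cover the product by
  sigma-finiteness. Finiteness of \<open>R\<close> is recorded as well, for the return to real
  numbers.\<close>

lemma kernel_inequality_nn:
  assumes t: "0 < t"
  shows "AE z in M \<Otimes>\<^sub>M M. T.K t (fst z) (snd z) \<le> S.K t (fst z) (snd z) + ennreal C * R t (fst z) (snd z)"
    "AE z in M \<Otimes>\<^sub>M M. R t (fst z) (snd z) < \<infinity>"
proof -
  obtain E :: "nat \<Rightarrow> 'a set" where E0: "range E \<subseteq> sets M" and inc: "(\<Union>n. E n) = space M"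
    and E1: "\<And>n. emeasure M (E n) \<noteq> \<infinity>"
    using S.sigma_finite by metis
  have E [measurable]: "E n \<in> sets M" for n using E0 by auto
  have Efin: "emeasure M (E n) < \<infinity>" for n using E1[of n] by (simp add: less_top)
  have ind: "(indicator A :: 'a \<Rightarrow> real) \<in> Lp M s" if "A \<in> sets M" "emeasure M A < \<infinity>" "1 \<le> s" for A s
    by (rule bounded_finite_support_Lp[of _ _ A 1]) (use that in auto)
  have p': "1 \<le> p'" using one_le_dual_exponent S.p by blast
  have nn: "AE x in M. 0 \<le> (indicator A x :: real)" for A by simp
  have key: "(\<integral>\<^sup>+z. T.K t (fst z) (snd z) * indicator (A \<times> B) z \<partial>(M \<Otimes>\<^sub>M M))
      \<le> (\<integral>\<^sup>+z. (S.K t (fst z) (snd z) + ennreal C * R t (fst z) (snd z)) * indicator (A \<times> B) z \<partial>(M \<Otimes>\<^sub>M M))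
      \<and> (\<integral>\<^sup>+z. T.K t (fst z) (snd z) * indicator (A \<times> B) z \<partial>(M \<Otimes>\<^sub>M M)) < \<infinity>
      \<and> (\<integral>\<^sup>+z. (S.K t (fst z) (snd z) + ennreal C * R t (fst z) (snd z)) * indicator (A \<times> B) z \<partial>(M \<Otimes>\<^sub>M M)) < \<infinity>
      \<and> (\<integral>\<^sup>+z. R t (fst z) (snd z) * indicator (A \<times> B) z \<partial>(M \<Otimes>\<^sub>M M)) < \<infinity>"
    if AB [measurable]: "A \<in> sets M" "B \<in> sets M" and fin: "emeasure M A < \<infinity>" "emeasure M B < \<infinity>" for A B
  proof -
    let ?u = "indicator B :: 'a \<Rightarrow> real" and ?v = "indicator A :: 'a \<Rightarrow> real"
    have u: "?u \<in> Lp M 2" "?u \<in> Lp M q" "AE x in M. 0 \<le> ?u x" using ind[OF AB(2) fin(2)] T.p by auto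
    have v: "?v \<in> Lp M 2" "?v \<in> Lp M p'" "AE x in M. 0 \<le> ?v x" using ind[OF AB(1) fin(1)] p' by auto
    have Rint: "(\<integral>\<^sup>+z. R t (fst z) (snd z) * indicator (A \<times> B) z \<partial>(M \<Otimes>\<^sub>M M)) < \<infinity>"
    proof -
      obtain b where b: "\<And>s. 0 < s \<Longrightarrow> s \<le> t \<Longrightarrow> T.corr ?u g' s \<le> ennreal b" "\<And>s. 0 < s \<Longrightarrow> s \<le> t \<Longrightarrow> S.corr f ?v s \<le> ennreal b"
        by (rule uniform_bound[OF u v, where \<tau> = t]) (rule that, assumption+)
      have "(\<integral>\<^sup>+s\<in>{0<..<t}. T.corr ?u g' s * S.corr f ?v (t - s) \<partial>lborel) \<le> (\<integral>\<^sup>+s\<in>{0<..<t}. ennreal b * ennreal b \<partial>lborel)"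
      proof (rule nn_integral_mono)
        fix s show "T.corr ?u g' s * S.corr f ?v (t - s) * indicator {0<..<t} s \<le> ennreal b * ennreal b * indicator {0<..<t} s"
          using b(1)[of s] b(2)[of "t - s"] by (cases "s \<in> {0<..<t}") (auto intro!: mult_mono)
      qed
      also have "\<dots> = ennreal b * ennreal b * ennreal (t - 0)" using t by (intro nn_integral_interval_const) simp
      also have "\<dots> < \<infinity>" by (simp add: ennreal_mult_less_top)
      finally show ?thesis unfolding nn_integral_R_rectangle[OF AB] .
    qed
    have sum: "(\<integral>\<^sup>+z. (S.K t (fst z) (snd z) + ennreal C * R t (fst z) (snd z)) * indicator (A \<times> B) z \<partial>(M \<Otimes>\<^sub>M M))
       = S.corr ?u ?v t + ennreal C * (\<integral>\<^sup>+z. R t (fst z) (snd z) * indicator (A \<times> B) z \<partial>(M \<Otimes>\<^sub>M M))"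
      unfolding S.nn_integral_kernel_rectangle[OF AB, symmetric]
      by (simp add: distrib_right nn_integral_add nn_integral_cmult mult.assoc)
    show ?thesis
      unfolding sum T.nn_integral_kernel_rectangle[OF AB]
    proof (intro conjI Rint)
      show "T.corr ?u ?v t \<le> S.corr ?u ?v t + ennreal C * (\<integral>\<^sup>+z. R t (fst z) (snd z) * indicator (A \<times> B) z \<partial>(M \<Otimes>\<^sub>M M))"
        unfolding nn_integral_R_rectangle[OF AB] by (rule integrated_inequality[OF u v t])
      show "T.corr ?u ?v t < \<infinity>" by (simp add: T.corr_eq_pairing(1)[OF t u(1,3) v(1,3)])
      have "S.corr ?u ?v t < \<infinity>" by (simp add: S.corr_eq_pairing(1)[OF t u(1,3) v(1,3)])
      then show "S.corr ?u ?v t + ennreal C * (\<integral>\<^sup>+z. R t (fst z) (snd z) * indicator (A \<times> B) z \<partial>(M \<Otimes>\<^sub>M M)) < \<infinity>"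
        using Rint by (simp add: ennreal_mult_less_top)
    qed
  qed
  have cover: "\<exists>n m. z \<in> E n \<times> E m" if "z \<in> space (M \<Otimes>\<^sub>M M)" for z
  proof -
    have "fst z \<in> space M" "snd z \<in> space M" using that by (auto simp: space_pair_measure)
    then obtain n m where "fst z \<in> E n" "snd z \<in> E m" using inc by blast
    then show ?thesis by (cases z) auto
  qed
  have "AE z in M \<Otimes>\<^sub>M M. z \<in> E n \<times> E m \<longrightarrow> T.K t (fst z) (snd z) \<le> S.K t (fst z) (snd z) + ennreal C * R t (fst z) (snd z)" for n m
  proof (rule S.MM.AE_le_of_rectangles)
    fix A B assume A: "A \<in> sets M" "A \<subseteq> E n" and B: "B \<in> sets M" "B \<subseteq> E m"
    have "emeasure M A \<le> emeasure M (E n)" using A by (intro emeasure_mono) auto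
    then have fA: "emeasure M A < \<infinity>" using Efin[of n] by (rule le_less_trans)
    have "emeasure M B \<le> emeasure M (E m)" using B by (intro emeasure_mono) auto
    then have fB: "emeasure M B < \<infinity>" using Efin[of m] by (rule le_less_trans)
    show "(\<integral>\<^sup>+z. T.K t (fst z) (snd z) * indicator (A \<times> B) z \<partial>(M \<Otimes>\<^sub>M M))
      \<le> (\<integral>\<^sup>+z. (S.K t (fst z) (snd z) + ennreal C * R t (fst z) (snd z)) * indicator (A \<times> B) z \<partial>(M \<Otimes>\<^sub>M M))"
      using key[OF A(1) B(1) fA fB] by (rule conjunct1)
  qed (use key[OF E E Efin Efin, of n m] in auto)
  then have "AE z in M \<Otimes>\<^sub>M M. \<forall>n m. z \<in> E n \<times> E m \<longrightarrow> T.K t (fst z) (snd z) \<le> S.K t (fst z) (snd z) + ennreal C * R t (fst z) (snd z)"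
    by (subst AE_all_countable, intro allI, subst AE_all_countable, intro allI)
  with AE_space show "AE z in M \<Otimes>\<^sub>M M. T.K t (fst z) (snd z) \<le> S.K t (fst z) (snd z) + ennreal C * R t (fst z) (snd z)"
    by eventually_elim (use cover in blast)
  have "AE z in M \<Otimes>\<^sub>M M. R t (fst z) (snd z) * indicator (E n \<times> E m) z \<noteq> \<infinity>" for n m
    using key[OF E E Efin Efin, of n m] by (intro nn_integral_PInf_AE) auto
  then have "AE z in M \<Otimes>\<^sub>M M. \<forall>n m. R t (fst z) (snd z) * indicator (E n \<times> E m) z \<noteq> \<infinity>"
    by (subst AE_all_countable, intro allI, subst AE_all_countable, intro allI)
  with AE_space show "AE z in M \<Otimes>\<^sub>M M. R t (fst z) (snd z) < \<infinity>"
  proof eventually_elim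
    case (elim z)
    obtain n m where nm: "z \<in> E n \<times> E m" using cover[OF elim(1)] by blast
    have "R t (fst z) (snd z) * indicator (E n \<times> E m) z \<noteq> \<infinity>" using elim(2) by blast
    then show ?case using nm by (simp add: less_top)
  qed
qed

text \<open>Finiteness of \<open>R t x y\<close> makes its integrand finite at almost every time, so
  that \<open>enn2real\<close> loses nothing inside the time integral.\<close>

lemma lebesgue_R:
  assumes x [measurable]: "x \<in> space M" and y [measurable]: "y \<in> space M" and fin: "R t x y < \<infinity>"
    and Sx: "AE s in lborel. 0 < s \<longrightarrow> (LINT z|M. S.kp s x z * f z) = enn2real (S.orb f s x)"
    and Ty: "AE s in lborel. s < t \<longrightarrow> (LINT w|M. T.kp (t - s) w y * g' w) = enn2real (T.dual_orb g' (t - s) y)"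
  shows "(LBINT s:{0<..<t}. (LINT w|M. kT (t - s) w y * g' w) * (LINT z|M. kS s x z * f z)) = enn2real (R t x y)"
proof -
  \<comment> \<open>For \<open>0 < s\<close> and \<open>s < t\<close> both \<open>s\<close> and
    \<open>t - s\<close> are positive, so the functions \<open>kp\<close> coincide with the given
    kernels.\<close>
  have "(LBINT s:{0<..<t}. (LINT w|M. kT (t - s) w y * g' w) * (LINT z|M. kS s x z * f z))
     = (LINT s|lborel. indicator {0<..<t} s * ((LINT w|M. T.kp (t - s) w y * g' w) * (LINT z|M. S.kp s x z * f z)))"
    unfolding set_lebesgue_integral_def
    by (rule Bochner_Integration.integral_cong) (auto simp: indicator_def T.kp_def S.kp_def)
  also have "\<dots> = (LINT s|lborel. indicator {0<..<t} s * enn2real (T.dual_orb g' (t - s) y * S.orb f s x))"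
  proof (rule integral_cong_AE)
    show "AE s in lborel. indicator {0<..<t} s * ((LINT w|M. T.kp (t - s) w y * g' w) * (LINT z|M. S.kp s x z * f z))
      = indicator {0<..<t} s * enn2real (T.dual_orb g' (t - s) y * S.orb f s x)"
      using Sx Ty by eventually_elim (simp add: enn2real_mult split: split_indicator)
  qed measurable
  also have "\<dots> = enn2real (\<integral>\<^sup>+s. ennreal (indicator {0<..<t} s * enn2real (T.dual_orb g' (t - s) y * S.orb f s x)) \<partial>lborel)"
  proof (rule integral_eq_nn_integral)
    show "(\<lambda>s. indicator {0<..<t} s * enn2real (T.dual_orb g' (t - s) y * S.orb f s x)) \<in> borel_measurable lborel"
      by measurable
  qed simp
  also have "(\<integral>\<^sup>+s. ennreal (indicator {0<..<t} s * enn2real (T.dual_orb g' (t - s) y * S.orb f s x)) \<partial>lborel) = R t x y"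
  proof -
    have "AE s in lborel. T.dual_orb g' (t - s) y * S.orb f s x * indicator {0<..<t} s \<noteq> \<infinity>"
      using fin unfolding R_def by (intro nn_integral_PInf_AE) auto
    then have "AE s in lborel. ennreal (indicator {0<..<t} s * enn2real (T.dual_orb g' (t - s) y * S.orb f s x))
        = T.dual_orb g' (t - s) y * S.orb f s x * indicator {0<..<t} s"
    proof eventually_elim
      case (elim s)
      then show ?case by (cases "s \<in> {0<..<t}") (simp_all add: less_top)
    qed
    then show ?thesis unfolding R_def by (rule nn_integral_cong_AE)
  qed
  finally show ?thesis .
qed

text \<open>The statements about almost every \<open>x\<close> and almost every \<open>y\<close> are
  lifted to the product. The inequality can be read among real numbers because its right-hand side
  is nonnegative; a negative value of \<open>kT t x y\<close> is cut to 0 on the left, which only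
  strengthens the estimate.\<close>

lemma kernel_inequality:
  assumes t: "0 < t"
  shows "AE (x, y) in M \<Otimes>\<^sub>M M. kT t x y \<le> kS t x y +
    C * (LBINT s:{0<..<t}. (LINT w|M. kT (t - s) w y * g' w) * (LINT z|M. kS s x z * f z))"
  using kernel_inequality_nn[OF t] S.kernel_nonneg[OF t] AE_space
    S.MM.AE_fst_pair[OF S.lebesgue_orb_AE_AE[OF f_measurable f(2)]]
    S.MM.AE_snd_pair[OF T.lebesgue_dual_orb_AE_AE[OF g'_measurable g'(2), of t]]
proof eventually_elim
  case (elim z)
  obtain x y where z: "z = (x, y)" by (cases z)
  have xy: "x \<in> space M" "y \<in> space M" using elim(4) by (auto simp: z space_pair_measure)
  have fin: "R t x y < \<infinity>" using elim(2) by (simp add: z)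
  have eq: "(LBINT s:{0<..<t}. (LINT w|M. kT (t - s) w y * g' w) * (LINT z|M. kS s x z * f z)) = enn2real (R t x y)"
    by (rule lebesgue_R[OF xy fin]) (use elim(5,6) in \<open>simp_all add: z\<close>)
  have "ennreal (kT t x y) \<le> ennreal (kS t x y) + ennreal C * ennreal (enn2real (R t x y))"
    using elim(1) fin t by (simp add: z T.K_def S.K_def less_top)
  also have "\<dots> = ennreal (kS t x y + C * enn2real (R t x y))"
    using elim(3) C by (simp add: z ennreal_plus ennreal_mult)
  finally have "ennreal (kT t x y) \<le> ennreal (kS t x y + C * enn2real (R t x y))" .
  moreover have "0 \<le> kS t x y + C * enn2real (R t x y)" using elim(3) C by (simp add: z)
  ultimately have "kT t x y \<le> kS t x y + C * enn2real (R t x y)" by (subst (asm) ennreal_le_iff) auto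
  then show ?case by (simp add: z eq)
qed

end

theorem corollary4p1:
  fixes M :: "'a measure"
    and p q p' q' :: ennreal
    and S T :: "real \<Rightarrow> ('a \<Rightarrow> real) \<Rightarrow> 'a \<Rightarrow> real"
    and kS kT :: "real \<Rightarrow> 'a \<Rightarrow> 'a \<Rightarrow> real"
    and f g' :: "'a \<Rightarrow> real"
    and C :: real
  assumes "sigma_finite_measure M"
    and "1 \<le> p" "p < \<infinity>" "1 / p + 1 / p' = 1"
    and "1 \<le> q" "q < \<infinity>" "1 / q + 1 / q' = 1"
    and "C0_semigroup_on_Lp M 2 S" "positive_semigroup_on_Lp M 2 S"
    and "C0_semigroup_on_Lp M 2 T" "positive_semigroup_on_Lp M 2 T"
    and "acts_on_Lp M p S" "has_kernel_on_Lp M p S kS"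
    and "acts_on_Lp M q T" "has_kernel_on_Lp M q T kT"
    and "f \<in> Lp M p" "AE x in M. 0 \<le> f x"
    and "g' \<in> Lp M q'" "AE x in M. 0 \<le> g' x"
    and "0 \<le> C"
    and "\<And>u Au v' Av'.
          (u, Au) \<in> generator M 2 T \<Longrightarrow> u \<in> Lp M q \<Longrightarrow> (AE x in M. 0 \<le> u x) \<Longrightarrow>
          (v', Av') \<in> weak_star_generator M 2 2 S \<Longrightarrow> v' \<in> Lp M p' \<Longrightarrow> (AE x in M. 0 \<le> v' x) \<Longrightarrow>
          pairing M Au v' \<le> pairing M u Av' + C * pairing M u g' * pairing M f v'"
  shows "\<forall>t>0. AE (x, y) in M \<Otimes>\<^sub>M M.
           kT t x y \<le> kS t x y +
             C * (LBINT s:{0<..<t}.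
                    (LINT w|M. kT (t - s) w y * g' w) * (LINT z|M. kS s x z * f z))"
proof -
  interpret sigma_finite_measure M by fact
  interpret S: kernel_semigroup M S p p' kS by standard fact+
  interpret T: kernel_semigroup M T q q' kT by standard fact+
  interpret kernel_comparison M S T p p' q q' kS kT f g' C
    by standard fact+
  show ?thesis using kernel_inequality by blast
qed

end
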